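(* Let $n$ be a positive integer. (1) For every subset $I\subset[n]=\{1,\dots,n\}$, the quotient space $\mathbb{Q}\langle\mathfrak{S}^B_I\rangle/M_I$ is isomorphic, as a $\mathbb{Q}$-vector space, to $\mathbb{Q}\langle\mathfrak{A}^B_I\rangle$. (2) The $\mathbb{Q}$-linear map $\Psi\colon \bigoplus_{I\subset[n]}\mathbb{Q}\langle\mathfrak{S}^B_I\rangle/M_I\to H^\ast(X^{\mathbb{R}}_{B_n};\mathbb{Q})$ is an isomorphism of $\mathbb{Q}$-vector spaces.
   Context: **Signed permutations and $B$-snakes.** For $I\subset[n]$ with $|I|=r$, a signed permutation on $I$ is a map $x\colon I\to\mathbb{Z}$ with $|x(i)|\in I$ for all $i$ and $|x(i)|\ne|x(j)|$ for $i\neq j$. It is written as the word $x_rx_{r-1}\cdots x_1$ listing the values $x(i)$ in increasing order of $i\in I$ from left to right. The word is also written in blocks of length two starting from the right: $[x_{2k}x_{2k-1}/\cdots/x_2x_1]$ if $r=2k$, and $[x_{2k-1}/x_{2k-2}x_{2k-3}/\cdots/x_2x_1]$ if $r=2k-1$. The set of signed permutations on $I$ is $\mathfrak{S}^B_I$. Write $\bar a=-a$ for an integer $a$. A $B$-snake on $I$ is $x\in\mathfrak{S}^B_I$ with $0<x_r>x_{r-1}<x_{r-2}>\cdots x_1$ (alternating inequalities); $\mathfrak{A}^B_I$ is the set of $B$-snakes on $I$. For a set $A$, $\mathbb{Q}\langle A\rangle$ is the $\mathbb{Q}$-vector space with basis $A$. For $I=\emptyset$ the only signed permutation is the empty word,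 which is a $B$-snake. **The subspace $M_I$.** $M_I\subset\mathbb{Q}\langle\mathfrak{S}^B_I\rangle$ is the span of the following elements, for all $x=x_r\cdots x_1\in\mathfrak{S}^B_I$ (letters not displayed are unchanged); $M_\emptyset=0$. (H1) For $1\le i\le\lfloor r/2\rfloor$: $[x_r\cdots/x_{2i}x_{2i-1}/\cdots x_1]+[x_r\cdots/x_{2i-1}x_{2i}/\cdots x_1]$. (H2) For $1\le i<\lfloor r/2\rfloor$: $[\cdots/x_{2i+2}x_{2i+1}/x_{2i}x_{2i-1}/\cdots]-[\cdots/x_{2i+2}x_{2i}/x_{2i+1}x_{2i-1}/\cdots]+[\cdots/x_{2i+1}x_{2i}/x_{2i+2}x_{2i-1}/\cdots]+[\cdots/x_{2i+2}x_{2i-1}/x_{2i+1}x_{2i}/\cdots]-[\cdots/x_{2i+1}x_{2i-1}/x_{2i+2}x_{2i}/\cdots]+[\cdots/x_{2i}x_{2i-1}/x_{2i+2}x_{2i+1}/\cdots]$. (H3) If $r$ is odd: $[x_r/x_{r-1}\cdots x_1]+[\bar x_r/x_{r-1}\cdots x_1]$. (H4) If $r$ is even: $[x_rx_{r-1}/\cdots x_1]-[x_r\bar x_{r-1}/\cdots x_1]+[x_{r-1}\bar x_r/\cdots x_1]-[\bar x_{r-1}\bar x_r/\cdots x_1]$. (H5) If $r\ge3$ is odd: $[x_r/x_{r-1}x_{r-2}/\cdots]-[x_r/\bar x_{r-1}x_{r-2}/\cdots]+[x_r/\bar x_{r-2}x_{r-1}/\cdots]-[x_r/\bar x_{r-2}\bar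 x_{r-1}/\cdots]$ $-[x_{r-1}/x_rx_{r-2}/\cdots]+[x_{r-1}/\bar x_rx_{r-2}/\cdots]-[x_{r-1}/\bar x_{r-2}x_r/\cdots]+[x_{r-1}/\bar x_{r-2}\bar x_r/\cdots]$ $+[x_{r-2}/x_rx_{r-1}/\cdots]-[x_{r-2}/\bar x_rx_{r-1}/\cdots]+[x_{r-2}/\bar x_{r-1}x_r/\cdots]-[x_{r-2}/\bar x_{r-1}\bar x_r/\cdots]$. **The complexes.** $K_{B_n}$ is the simplicial complex whose vertices are the nonempty subsets $L\subset\{\pm1,\dots,\pm n\}$ containing no pair $\{i,-i\}$, and whose simplices are the chains $L_1\subsetneq\cdots\subsetneq L_{k+1}$ of vertices. For $I\subset[n]$, $(K_{B_n})_I$ is the full subcomplex on the vertices $L$ for which $\#\{i\in I: i\in L\text{ or }-i\in L\}$ is odd. **The variety.** $X^{\mathbb{R}}_{B_n}$ is the real locus of the smooth compact toric variety $X_{B_n}$ of the fan in $\mathbb{R}^n$ (lattice $\mathbb{Z}^n$, the co-weight lattice) whose maximal cones are the Weyl chambers of type $B_n$; its rays are generated by the vectors $\sum_{i\in L,\,i>0}\mathbf e_i-\sum_{-i\in L,\,i>0}\mathbf e_i$ for $L$ a vertex of $K_{B_n}$, and its cones correspond to the simplices of $K_{B_n}$. By a known theorem (Choi–Park) there is an isomorphism $H^{\ast}(X^{\mathbb{R}}_{B_n};\mathbb{Q})\cong\bigoplus_{I\subset[n]}\widetilde H^{\ast-1}((K_{B_n})_I;\mathbb{Q})$, which is fixed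 here. **The map $\Psi$.** For $x=x_r\cdots x_1\in\mathfrak{S}^B_I$ let $x^\ast$ be obtained by swapping the two letters in every block of length two and, if $r$ is odd, negating $x_r$. For $1\le i\le m:=\lfloor\frac{r+1}{2}\rfloor$ let $\mathcal{F}_i(x)=\{x_1,\dots,x_{2i-1}\}$ if $r$ is odd and $\mathcal{F}_i(x)=\{\bar x_1,\dots,\bar x_{2i-1}\}$ if $r$ is even. Let $\square_x=\{\mathcal{F}_1(x),\mathcal{F}_1(x^\ast)\}\star\cdots\star\{\mathcal{F}_m(x),\mathcal{F}_m(x^\ast)\}$ ($\star$ = simplicial join), the boundary complex of a cross-polytope in $(K_{B_n})_I$, with fundamental cycle $\sum_{\varepsilon\in\{0,1\}^m}(-1)^{\varepsilon_1+\cdots+\varepsilon_m}[F_1^{\varepsilon_1},\dots,F_m^{\varepsilon_m}]$, where $F_i^0=\mathcal{F}_i(x)$, $F_i^1=\mathcal{F}_i(x^\ast)$. Let $\Psi_I\colon\mathbb{Q}\langle\mathfrak{S}^B_I\rangle\to\widetilde H_{\lfloor\frac{r-1}{2}\rfloor}((K_{B_n})_I;\mathbb{Q})$ be the linear map $x\mapsto[\square_x]$. It vanishes on $M_I$, so it induces a map on $\mathbb{Q}\langle\mathfrak{S}^B_I\rangle/M_I$. Compose the induced map with the isomorphism $\widetilde H_{\lfloor\frac{r-1}{2}\rfloor}((K_{B_n})_I;\mathbb{Q})\to\widetilde H^{\lfloor\frac{r-1}{2}\rfloor}((K_{B_n})_I;\mathbb{Q})$ onto the dual space sending the basis $\{\Psi_I(\alpha):\alpha\in\mathfrak{A}^B_I\}$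 to its dual basis (that this is a basis is part of the setup). Taking the direct sum over all $I\subset[n]$ and using the fixed isomorphism above gives $\Psi$. *)

theory Defs
  imports
    "HOL-Homology.Homology"
    "HOL-Algebra.Module"
    "HOL-Algebra.AbelCoset"
    "HOL-Library.Poly_Mapping"
begin

section \<open>Rational vector spaces\<close>

text \<open>
  A \<open>\<rat>\<close>-vector space is a HOL-Algebra \<open>module\<close> record with scalars of type \<^typ>\<open>rat\<close>.
  The ring fields \<open>mult\<close> and \<open>one\<close>, which that record inherits, have no meaning for a
  vector space and are left undefined.
\<close>

definition linear_maps :: "(rat, 'a) module \<Rightarrow> (rat, 'b) module \<Rightarrow> ('a \<Rightarrow> 'b) set" where
  "linear_maps V W =
    {h \<in> carrier V \<rightarrow> carrier W.
      (\<forall>x \<in> carrier V. \<forall>y \<in> carrier V. h (x \<oplus>\<^bsub>V\<^esub> y) = h x \<oplus>\<^bsub>W\<^esub> h y) \<and>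
      (\<forall>c. \<forall>x \<in> carrier V. h (c \<odot>\<^bsub>V\<^esub> x) = c \<odot>\<^bsub>W\<^esub> h x)}"

definition linear_isos :: "(rat, 'a) module \<Rightarrow> (rat, 'b) module \<Rightarrow> ('a \<Rightarrow> 'b) set" where
  "linear_isos V W = {h \<in> linear_maps V W. bij_betw h (carrier V) (carrier W)}"

definition quot_space :: "(rat, 'a) module \<Rightarrow> 'a set \<Rightarrow> (rat, 'a set) module" where
  "quot_space V W =
    \<lparr>carrier = a_rcosets\<^bsub>V\<^esub> W, mult = undefined, one = undefined,
     zero = W, add = set_add V,
     smult = (\<lambda>c X. \<Union>x \<in> X. W +>\<^bsub>V\<^esub> (c \<odot>\<^bsub>V\<^esub> x))\<rparr>"

definition direct_sum :: "'i set \<Rightarrow> ('i \<Rightarrow> (rat, 'a) module) \<Rightarrow> (rat, 'i \<Rightarrow> 'a) module" where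
  "direct_sum J V =
    \<lparr>carrier = {f \<in> (\<Pi>\<^sub>E i\<in>J. carrier (V i)). finite {i \<in> J. f i \<noteq> \<zero>\<^bsub>V i\<^esub>}},
     mult = undefined, one = undefined,
     zero = (\<lambda>i\<in>J. \<zero>\<^bsub>V i\<^esub>),
     add = (\<lambda>f g. \<lambda>i\<in>J. f i \<oplus>\<^bsub>V i\<^esub> g i),
     smult = (\<lambda>c f. \<lambda>i\<in>J. c \<odot>\<^bsub>V i\<^esub> f i)\<rparr>"

definition qscale :: "rat \<Rightarrow> ('a \<Rightarrow>\<^sub>0 rat) \<Rightarrow> ('a \<Rightarrow>\<^sub>0 rat)" where
  "qscale c f = Poly_Mapping.map ((*) c) f"

lemma lookup_qscale [simp]: "Poly_Mapping.lookup (qscale c f) x = c * Poly_Mapping.lookup f x"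
  by (simp add: qscale_def Poly_Mapping.map.rep_eq when_def)

interpretation qvs: vector_space qscale
  by standard (auto intro!: poly_mapping_eqI simp: lookup_add algebra_simps)

text \<open>\<open>free_space A\<close> is \<open>\<rat>\<langle>A\<rangle>\<close>; the basis element of \<open>x\<close> is \<open>basis x\<close>.\<close>

definition free_space :: "'a set \<Rightarrow> (rat, 'a \<Rightarrow>\<^sub>0 rat) module" where
  "free_space A =
    \<lparr>carrier = {f. Poly_Mapping.keys f \<subseteq> A}, mult = undefined, one = undefined,
     zero = 0, add = (+), smult = qscale\<rparr>"

abbreviation basis :: "'a \<Rightarrow> ('a \<Rightarrow>\<^sub>0 rat)" where
  "basis x \<equiv> Poly_Mapping.single x 1"

definition linear_ext :: "('a \<Rightarrow> ('b \<Rightarrow>\<^sub>0 rat)) \<Rightarrow> ('a \<Rightarrow>\<^sub>0 rat) \<Rightarrow> ('b \<Rightarrow>\<^sub>0 rat)" where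
  "linear_ext g f = (\<Sum>x \<in> Poly_Mapping.keys f. qscale (Poly_Mapping.lookup f x) (g x))"

text \<open>
  The dual of \<open>free_space A\<close>: a linear functional is given by its values on the basis \<open>A\<close>,
  extended by \<open>0\<close> outside \<open>A\<close> so that equality of functionals is equality of functions.
\<close>

definition dual_space :: "'a set \<Rightarrow> (rat, 'a \<Rightarrow> rat) module" where
  "dual_space A =
    \<lparr>carrier = {\<phi>. \<forall>x. x \<notin> A \<longrightarrow> \<phi> x = 0}, mult = undefined, one = undefined,
     zero = (\<lambda>_. 0), add = (\<lambda>\<phi> \<psi> x. \<phi> x + \<psi> x), smult = (\<lambda>c \<phi> x. c * \<phi> x)\<rparr>"

definition evaluate :: "('a \<Rightarrow> rat) \<Rightarrow> ('a \<Rightarrow>\<^sub>0 rat) \<Rightarrow> rat" where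
  "evaluate \<phi> c = (\<Sum>x \<in> Poly_Mapping.keys c. Poly_Mapping.lookup c x * \<phi> x)"

section \<open>Reduced simplicial (co)homology\<close>

text \<open>
  A complex is given by a set \<open>K\<close> of lists closed under deletion of entries: each simplex is
  listed once, with its vertices in a fixed order. The empty list is the \<open>(-1)\<close>-simplex, so that
  the homology below is the reduced one.
\<close>

definition simplices :: "'v list set \<Rightarrow> int \<Rightarrow> 'v list set" where
  "simplices K k = {\<sigma> \<in> K. int (length \<sigma>) = k + 1}"

definition simplex_bd :: "'v list \<Rightarrow> ('v list \<Rightarrow>\<^sub>0 rat)" where
  "simplex_bd \<sigma> = (\<Sum>j<length \<sigma>. qscale ((-1) ^ j) (basis (take j \<sigma> @ drop (Suc j) \<sigma>)))"

definition cycles :: "'v list set \<Rightarrow> int \<Rightarrow> ('v list \<Rightarrow>\<^sub>0 rat) set" where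
  "cycles K k = {c \<in> carrier (free_space (simplices K k)). linear_ext simplex_bd c = 0}"

definition boundaries :: "'v list set \<Rightarrow> int \<Rightarrow> ('v list \<Rightarrow>\<^sub>0 rat) set" where
  "boundaries K k = linear_ext simplex_bd ` carrier (free_space (simplices K (k + 1)))"

definition red_homology :: "'v list set \<Rightarrow> int \<Rightarrow> (rat, ('v list \<Rightarrow>\<^sub>0 rat) set) module" where
  "red_homology K k =
    quot_space (free_space (simplices K k) \<lparr>carrier := cycles K k\<rparr>) (boundaries K k)"

definition homology_class ::
    "'v list set \<Rightarrow> int \<Rightarrow> ('v list \<Rightarrow>\<^sub>0 rat) \<Rightarrow> ('v list \<Rightarrow>\<^sub>0 rat) set" where
  "homology_class K k c = boundaries K k +>\<^bsub>free_space (simplices K k)\<^esub> c"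

text \<open>\<open>simplex_cobd K k\<close> is the coboundary from degree \<open>k - 1\<close> to degree \<open>k\<close>.\<close>

definition simplex_cobd :: "'v list set \<Rightarrow> int \<Rightarrow> ('v list \<Rightarrow> rat) \<Rightarrow> ('v list \<Rightarrow> rat)" where
  "simplex_cobd K k \<phi> =
    (\<lambda>\<sigma>. if \<sigma> \<in> simplices K k then evaluate \<phi> (simplex_bd \<sigma>) else 0)"

definition cocycles :: "'v list set \<Rightarrow> int \<Rightarrow> ('v list \<Rightarrow> rat) set" where
  "cocycles K k =
    {\<phi> \<in> carrier (dual_space (simplices K k)). simplex_cobd K (k + 1) \<phi> = (\<lambda>_. 0)}"

definition coboundaries :: "'v list set \<Rightarrow> int \<Rightarrow> ('v list \<Rightarrow> rat) set" where
  "coboundaries K k = simplex_cobd K k ` carrier (dual_space (simplices K (k - 1)))"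

definition red_cohomology :: "'v list set \<Rightarrow> int \<Rightarrow> (rat, ('v list \<Rightarrow> rat) set) module" where
  "red_cohomology K k =
    quot_space (dual_space (simplices K k) \<lparr>carrier := cocycles K k\<rparr>) (coboundaries K k)"

text \<open>
  The evaluation pairing of a cohomology class with a homology class, through which
  \<open>red_cohomology K k\<close> is the dual space of \<open>red_homology K k\<close>.
\<close>

definition kronecker :: "('v list \<Rightarrow> rat) set \<Rightarrow> ('v list \<Rightarrow>\<^sub>0 rat) set \<Rightarrow> rat" where
  "kronecker \<xi> \<eta> = the_elem {evaluate \<phi> c | \<phi> c. \<phi> \<in> \<xi> \<and> c \<in> \<eta>}"

section \<open>Singular cohomology with rational coefficients\<close>

text \<open>\<open>singular_cobd p X\<close> is the coboundary from degree \<open>p - 1\<close> to degree \<open>p\<close>, for \<open>p > 0\<close>.\<close>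

definition singular_cobd ::
    "nat \<Rightarrow> 'a topology \<Rightarrow> (((nat \<Rightarrow> real) \<Rightarrow> 'a) \<Rightarrow> rat) \<Rightarrow> (((nat \<Rightarrow> real) \<Rightarrow> 'a) \<Rightarrow> rat)" where
  "singular_cobd p X \<phi> =
    (\<lambda>f. if f \<in> singular_simplex_set p X
         then \<Sum>j\<le>p. (-1) ^ j * \<phi> (singular_face p j f) else 0)"

definition singular_cocycles :: "nat \<Rightarrow> 'a topology \<Rightarrow> (((nat \<Rightarrow> real) \<Rightarrow> 'a) \<Rightarrow> rat) set" where
  "singular_cocycles p X =
    {\<phi> \<in> carrier (dual_space (singular_simplex_set p X)). singular_cobd (Suc p) X \<phi> = (\<lambda>_. 0)}"

definition singular_coboundaries :: "nat \<Rightarrow> 'a topology \<Rightarrow> (((nat \<Rightarrow> real) \<Rightarrow> 'a) \<Rightarrow> rat) set" where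
  "singular_coboundaries p X =
    (if p = 0 then {\<lambda>_. 0}
     else singular_cobd p X ` carrier (dual_space (singular_simplex_set (p - 1) X)))"

definition singular_cohomology ::
    "nat \<Rightarrow> 'a topology \<Rightarrow> (rat, (((nat \<Rightarrow> real) \<Rightarrow> 'a) \<Rightarrow> rat) set) module" where
  "singular_cohomology p X =
    quot_space (dual_space (singular_simplex_set p X) \<lparr>carrier := singular_cocycles p X\<rparr>)
      (singular_coboundaries p X)"

definition total_cohomology ::
    "'a topology \<Rightarrow> (rat, nat \<Rightarrow> (((nat \<Rightarrow> real) \<Rightarrow> 'a) \<Rightarrow> rat) set) module" where
  "total_cohomology X = direct_sum UNIV (\<lambda>p. singular_cohomology p X)"

section \<open>Real loci of toric varieties\<close>

definition quotient_topology :: "'a topology \<Rightarrow> ('a \<times> 'a) set \<Rightarrow> 'a set topology" where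
  "quotient_topology X r =
    topology (\<lambda>U. U \<subseteq> topspace X // r \<and> openin X {x \<in> topspace X. r `` {x} \<in> U})"

lemma openin_quotient_topology:
  "openin (quotient_topology X r) U \<longleftrightarrow>
    U \<subseteq> topspace X // r \<and> openin X {x \<in> topspace X. r `` {x} \<in> U}"
proof -
  have 1: "{x \<in> topspace X. r `` {x} \<in> S \<inter> T} =
      {x \<in> topspace X. r `` {x} \<in> S} \<inter> {x \<in> topspace X. r `` {x} \<in> T}" for S T
    by auto
  have 2: "{x \<in> topspace X. r `` {x} \<in> \<Union>\<K>} =
      (\<Union>S\<in>\<K>. {x \<in> topspace X. r `` {x} \<in> S})" for \<K>
    by auto
  have "istopology (\<lambda>U. U \<subseteq> topspace X // r \<and> openin X {x \<in> topspace X. r `` {x} \<in> U})"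
    unfolding istopology_def 1 2 by blast
  then show ?thesis
    by (simp add: quotient_topology_def)
qed

text \<open>
  Coordinates are indexed by \<open>{1..n}\<close>, and vectors of \<open>\<real>\<^sup>n\<close> are functions on \<^typ>\<open>int\<close> that
  vanish outside \<open>{1..n}\<close>. Cones are subsets of \<open>\<real>\<^sup>n\<close>, with lattice \<open>\<int>\<^sup>n\<close>; \<open>characters n\<close>
  is the dual lattice.
\<close>

definition characters :: "nat \<Rightarrow> (int \<Rightarrow> int) set" where
  "characters n = {m. \<forall>i. i \<notin> {1..int n} \<longrightarrow> m i = 0}"

definition dual_monoid :: "nat \<Rightarrow> (int \<Rightarrow> real) set \<Rightarrow> (int \<Rightarrow> int) set" where
  "dual_monoid n \<sigma> =
    {m \<in> characters n. \<forall>u \<in> \<sigma>. 0 \<le> (\<Sum>i = 1..int n. of_int (m i) * u i)}"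

text \<open>
  The real points of the affine toric variety of a cone are the monoid homomorphisms from its
  dual monoid to \<open>(\<real>, \<cdot>)\<close>. As that monoid is finitely generated, the topology of pointwise
  convergence is the Euclidean topology of the real locus.
\<close>

definition affine_chart :: "nat \<Rightarrow> (int \<Rightarrow> real) set \<Rightarrow> ((int \<Rightarrow> int) \<Rightarrow> real) topology" where
  "affine_chart n \<sigma> =
    subtopology (product_topology (\<lambda>_. euclideanreal) (dual_monoid n \<sigma>))
      {\<gamma>. \<gamma> (\<lambda>_. 0) = 1 \<and>
          (\<forall>m \<in> dual_monoid n \<sigma>. \<forall>m' \<in> dual_monoid n \<sigma>. \<gamma> (\<lambda>i. m i + m' i) = \<gamma> m * \<gamma> m')}"

text \<open>Two charts are glued along the chart of the intersection of their cones.\<close>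

definition glueing ::
    "nat \<Rightarrow> (int \<Rightarrow> real) set set \<Rightarrow>
      (((int \<Rightarrow> real) set \<times> ((int \<Rightarrow> int) \<Rightarrow> real)) \<times> ((int \<Rightarrow> real) set \<times> ((int \<Rightarrow> int) \<Rightarrow> real))) set"
  where
  "glueing n \<Delta> =
    {((\<sigma>, restrict \<epsilon> (dual_monoid n \<sigma>)), (\<tau>, restrict \<epsilon> (dual_monoid n \<tau>))) | \<sigma> \<tau> \<epsilon>.
      \<sigma> \<in> \<Delta> \<and> \<tau> \<in> \<Delta> \<and> \<epsilon> \<in> topspace (affine_chart n (\<sigma> \<inter> \<tau>))}"

definition real_toric_variety ::
    "nat \<Rightarrow> (int \<Rightarrow> real) set set \<Rightarrow> ((int \<Rightarrow> real) set \<times> ((int \<Rightarrow> int) \<Rightarrow> real)) set topology" where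
  "real_toric_variety n \<Delta> =
    quotient_topology (sum_topology (affine_chart n) \<Delta>) (glueing n \<Delta>)"

section \<open>The complexes and the variety of type B\<close>

definition KB_vertices :: "nat \<Rightarrow> int set set" where
  "KB_vertices n = {L. L \<noteq> {} \<and> L \<subseteq> {- int n..int n} - {0} \<and> (\<forall>i \<in> L. - i \<notin> L)}"

text \<open>Simplices are listed in increasing order of inclusion; the empty list is included.\<close>

definition KB :: "nat \<Rightarrow> int set list set" where
  "KB n = {\<sigma>. set \<sigma> \<subseteq> KB_vertices n \<and> sorted_wrt (\<subset>) \<sigma>}"

definition KB_sub :: "nat \<Rightarrow> int set \<Rightarrow> int set list set" where
  "KB_sub n I = {\<sigma> \<in> KB n. \<forall>L \<in> set \<sigma>. odd (card {i \<in> I. i \<in> L \<or> - i \<in> L})}"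

definition ray :: "int set \<Rightarrow> int \<Rightarrow> real" where
  "ray L i = (if 0 < i \<and> i \<in> L then 1 else if 0 < i \<and> - i \<in> L then -1 else 0)"

definition simplex_cone :: "int set set \<Rightarrow> (int \<Rightarrow> real) set" where
  "simplex_cone S = {\<lambda>i. \<Sum>L\<in>S. c L * ray L i | c. \<forall>L \<in> S. 0 \<le> c L}"

definition XB :: "nat \<Rightarrow> ((int \<Rightarrow> real) set \<times> ((int \<Rightarrow> int) \<Rightarrow> real)) set topology" where
  "XB n = real_toric_variety n ((\<lambda>\<sigma>. simplex_cone (set \<sigma>)) ` KB n)"

section \<open>Signed permutations and snakes\<close>

definition signed_perms :: "int set \<Rightarrow> (int \<Rightarrow> int) set" where
  "signed_perms I =
    {x \<in> extensional I. (\<forall>i \<in> I. \<bar>x i\<bar> \<in> I) \<and> (\<forall>i \<in> I. \<forall>j \<in> I. i \<noteq> j \<longrightarrow> \<bar>x i\<bar> \<noteq> \<bar>x j\<bar>)}"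

text \<open>
  A signed permutation is identified with its word \<open>x\<^sub>r \<dots> x\<^sub>1\<close>, so that the letter \<open>x\<^sub>i\<close> is
  entry \<open>r - i\<close> of the list.
\<close>

definition SB :: "int set \<Rightarrow> int list set" where
  "SB I = (\<lambda>x. map x (sorted_list_of_set I)) ` signed_perms I"

definition snakes :: "int set \<Rightarrow> int list set" where
  "snakes I =
    {w \<in> SB I. (w \<noteq> [] \<longrightarrow> 0 < hd w) \<and>
      (\<forall>j. Suc j < length w \<longrightarrow> (if even j then w ! j > w ! Suc j else w ! j < w ! Suc j))}"

text \<open>In the relations, \<open>even (length v)\<close> says that \<open>v\<close> consists of complete blocks.\<close>

definition rel_H1 :: "int set \<Rightarrow> (int list \<Rightarrow>\<^sub>0 rat) set" where
  "rel_H1 I =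
    {basis (u @ [a, b] @ v) + basis (u @ [b, a] @ v) | u a b v.
      u @ [a, b] @ v \<in> SB I \<and> even (length v)}"

definition rel_H2 :: "int set \<Rightarrow> (int list \<Rightarrow>\<^sub>0 rat) set" where
  "rel_H2 I =
    {basis (u @ [a, b, c, d] @ v) - basis (u @ [a, c, b, d] @ v) + basis (u @ [b, c, a, d] @ v)
      + basis (u @ [a, d, b, c] @ v) - basis (u @ [b, d, a, c] @ v) + basis (u @ [c, d, a, b] @ v)
      | u a b c d v. u @ [a, b, c, d] @ v \<in> SB I \<and> even (length v)}"

definition rel_H3 :: "int set \<Rightarrow> (int list \<Rightarrow>\<^sub>0 rat) set" where
  "rel_H3 I = {basis (a # v) + basis (- a # v) | a v. a # v \<in> SB I \<and> even (length v)}"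

definition rel_H4 :: "int set \<Rightarrow> (int list \<Rightarrow>\<^sub>0 rat) set" where
  "rel_H4 I =
    {basis ([a, b] @ v) - basis ([a, - b] @ v) + basis ([b, - a] @ v) - basis ([- b, - a] @ v)
      | a b v. [a, b] @ v \<in> SB I \<and> even (length v)}"

definition rel_H5 :: "int set \<Rightarrow> (int list \<Rightarrow>\<^sub>0 rat) set" where
  "rel_H5 I =
    {basis ([a, b, c] @ v) - basis ([a, - b, c] @ v)
      + basis ([a, - c, b] @ v) - basis ([a, - c, - b] @ v)
      - basis ([b, a, c] @ v) + basis ([b, - a, c] @ v)
      - basis ([b, - c, a] @ v) + basis ([b, - c, - a] @ v)
      + basis ([c, a, b] @ v) - basis ([c, - a, b] @ v)
      + basis ([c, - b, a] @ v) - basis ([c, - b, - a] @ v)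
      | a b c v. [a, b, c] @ v \<in> SB I \<and> even (length v)}"

definition MB :: "int set \<Rightarrow> (int list \<Rightarrow>\<^sub>0 rat) set" where
  "MB I = qvs.span (rel_H1 I \<union> rel_H2 I \<union> rel_H3 I \<union> rel_H4 I \<union> rel_H5 I)"

section \<open>The map Psi\<close>

fun swap_pairs :: "int list \<Rightarrow> int list" where
  "swap_pairs (a # b # v) = b # a # swap_pairs v"
| "swap_pairs v = v"

definition star :: "int list \<Rightarrow> int list" where
  "star w = (if odd (length w) then - hd w # swap_pairs (tl w) else swap_pairs w)"

text \<open>The letters \<open>x\<^sub>1, \<dots>, x\<^sub>2\<^sub>i\<^sub>-\<^sub>1\<close> are the last \<open>2 i - 1\<close> entries of the list.\<close>

definition Fset :: "nat \<Rightarrow> int list \<Rightarrow> int set" where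
  "Fset i w =
    (let S = set (drop (length w - (2 * i - 1)) w) in if odd (length w) then S else uminus ` S)"

definition fund_cycle :: "int list \<Rightarrow> (int set list \<Rightarrow>\<^sub>0 rat)" where
  "fund_cycle w =
    (let m = (length w + 1) div 2 in
      \<Sum>\<epsilon> \<in> {1..m} \<rightarrow>\<^sub>E {0, 1::nat}.
        qscale ((-1) ^ (\<Sum>i = 1..m. \<epsilon> i))
          (basis (map (\<lambda>i. Fset i (if \<epsilon> i = 0 then w else star w)) [1..<Suc m])))"

text \<open>For \<open>I = {}\<close> the degree is \<open>-1\<close>, as \<open>div\<close> on \<^typ>\<open>int\<close> rounds down.\<close>

definition top_deg :: "int set \<Rightarrow> int" where
  "top_deg I = (int (card I) - 1) div 2"

definition Psi_hom :: "nat \<Rightarrow> int set \<Rightarrow> (int list \<Rightarrow>\<^sub>0 rat) \<Rightarrow> (int set list \<Rightarrow>\<^sub>0 rat) set" where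
  "Psi_hom n I f = homology_class (KB_sub n I) (top_deg I) (linear_ext fund_cycle f)"

definition Psi_quot :: "nat \<Rightarrow> int set \<Rightarrow> (int list \<Rightarrow>\<^sub>0 rat) set \<Rightarrow> (int set list \<Rightarrow>\<^sub>0 rat) set" where
  "Psi_quot n I X = the_elem (Psi_hom n I ` X)"

text \<open>
  The isomorphism from homology onto its dual, sending the basis \<open>{\<Psi>\<^sub>I(\<alpha>)}\<close>, \<open>\<alpha>\<close> a snake, to
  its dual basis; it is determined by its values on that basis.
\<close>

definition dual_basis_iso :: "nat \<Rightarrow> int set \<Rightarrow> (int set list \<Rightarrow>\<^sub>0 rat) set \<Rightarrow> (int set list \<Rightarrow> rat) set" where
  "dual_basis_iso n I =
    (THE D. D \<in> extensional (carrier (red_homology (KB_sub n I) (top_deg I))) \<and>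
      D \<in> linear_isos (red_homology (KB_sub n I) (top_deg I)) (red_cohomology (KB_sub n I) (top_deg I)) \<and>
      (\<forall>\<alpha> \<in> snakes I. \<forall>\<beta> \<in> snakes I.
        kronecker (D (Psi_hom n I (basis \<alpha>))) (Psi_hom n I (basis \<beta>)) =
          (if \<alpha> = \<beta> then 1 else 0)))"

definition quotient_sum :: "nat \<Rightarrow> (rat, int set \<Rightarrow> (int list \<Rightarrow>\<^sub>0 rat) set) module" where
  "quotient_sum n = direct_sum (Pow {1..int n}) (\<lambda>I. quot_space (free_space (SB I)) (MB I))"

text \<open>The degree \<open>k\<close> part of \<open>\<Oplus>\<^sub>I H\<^sup>*\<^sup>-\<^sup>1((K\<^sub>B\<^sub>n)\<^sub>I)\<close> (reduced cohomology).\<close>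

definition complex_cohomology :: "nat \<Rightarrow> nat \<Rightarrow> (rat, int set \<Rightarrow> (int set list \<Rightarrow> rat) set) module" where
  "complex_cohomology n k =
    direct_sum (Pow {1..int n}) (\<lambda>I. red_cohomology (KB_sub n I) (int k - 1))"

text \<open>
  \<open>\<Phi> k\<close> is the degree \<open>k\<close> part of the chosen isomorphism from the cohomology of \<open>XB n\<close> to
  the sum of the groups \<open>complex_cohomology n k\<close>. The summand of \<open>u\<close> at \<open>I\<close> lands in reduced
  degree \<open>top_deg I\<close>, that is, in the part \<open>k = top_deg I + 1\<close>.
\<close>

definition Psi ::
    "nat \<Rightarrow>
     (nat \<Rightarrow> (((nat \<Rightarrow> real) \<Rightarrow> ((int \<Rightarrow> real) set \<times> ((int \<Rightarrow> int) \<Rightarrow> real)) set) \<Rightarrow> rat) set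
        \<Rightarrow> int set \<Rightarrow> (int set list \<Rightarrow> rat) set) \<Rightarrow>
     (int set \<Rightarrow> (int list \<Rightarrow>\<^sub>0 rat) set) \<Rightarrow>
     nat \<Rightarrow> (((nat \<Rightarrow> real) \<Rightarrow> ((int \<Rightarrow> real) set \<times> ((int \<Rightarrow> int) \<Rightarrow> real)) set) \<Rightarrow> rat) set" where
  "Psi n \<Phi> u =
    (\<lambda>k. inv_into (carrier (singular_cohomology k (XB n))) (\<Phi> k)
      (\<lambda>I \<in> Pow {1..int n}.
        if int k - 1 = top_deg I then dual_basis_iso n I (Psi_quot n I (u I))
        else \<zero>\<^bsub>red_cohomology (KB_sub n I) (int k - 1)\<^esub>))"

end

theory Submission
  imports Defs "HOL-Library.Multiset"
begin

text \<open>
  Words are read from the right, with all letters negated if \<open>r = |I|\<close> is even; call the result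
  \<open>y\<close>. A chain of odd signed subsets of \<open>I\<close> has a lexicographically least compatible word, and that
  word is characterised by having all its descents (the word being followed by the letter \<open>0\<close>) at
  sizes of members of the chain. Chains with the same least word \<open>y\<close> form a Boolean interval, so
  they cancel in homology unless the descent set of \<open>y\<close> is the set of all odd \<open>t \<le> r\<close>, that is,
  unless \<open>y\<close> comes from a snake; then the interval is a single top-dimensional chain. Chains with
  members not contained in \<open>\<plusminus>I\<close> cancel by intersecting their least such member with \<open>\<plusminus>I\<close>. The
  leading chain of the cycle of a snake is the chain of its own word, so these cycles form a basis
  of the homology of \<open>(K\<^sub>B\<^sub>n)\<^sub>I\<close>, which sits in one degree. On the other side, (H2), (H4) and (H5)
  rewrite a word that is not a snake into lexicographically smaller ones, (H1) and (H3) having been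
  used to order the blocks; so the snakes span the quotient by \<open>M\<^sub>I\<close>, on which the map to homology
  is well defined.
\<close>

section \<open>Quotients of rational vector spaces\<close>

text \<open>The sign change puts both parities of \<open>r\<close> on one footing: with it the
  inequalities of a snake, including \<open>0 < x_r\<close>, say that the descents are exactly the
  odd positions, and the sets \<open>Fset i w\<close> become prefixes of the reversed word. A
  leading term alone does not give independence modulo boundaries, because \<open>KB_sub n I\<close>
  may have simplices above degree \<open>top_deg I\<close>. Such a simplex degenerates once its
  members are intersected with \<open>\<plusminus>I\<close>. Coefficients read off after this
  intersection therefore vanish on boundaries, and there the triangular matrix of the snake cycles
  can be inverted. This one functional serves for independence in homology, for independence in the
  quotient by \<open>MB I\<close>, and for the cocycles that make the dual basis isomorphism
  explicit. Straightening runs in two opposite directions: (H1) and (H3) move a word up in the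
  lexicographic order, (H2), (H4) and (H5) move it down. Hence there are two separate inductions;
  the descending one can stay among words with ordered blocks, since only (H4) leaves them and (H1)
  repairs this at once.\<close>

abbreviation "coef \<equiv> Poly_Mapping.lookup"

abbreviation "supp \<equiv> Poly_Mapping.keys"

text \<open>\<open>C\<close> will be the cycles, the cocycles or the whole space, and
  \<open>W\<close> the subspace divided out. The assumptions are the vector space laws that coset
  arithmetic in \<open>quot_space\<close> relies on.\<close>

locale subquotient =
  fixes V :: "(rat, 'a) module" (structure) and C W :: "'a set"
  assumes abelian: "abelian_group V"
    and smult_closed: "\<And>c x. x \<in> carrier V \<Longrightarrow> c \<odot> x \<in> carrier V"
    and smult_add: "\<And>c x y. x \<in> carrier V \<Longrightarrow> y \<in> carrier V \<Longrightarrow>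
          c \<odot> (x \<oplus> y) = c \<odot> x \<oplus> c \<odot> y"
    and smult_minus_one: "\<And>x. x \<in> carrier V \<Longrightarrow> (-1) \<odot> x = \<ominus> x"
    and smult_zero: "\<And>x. x \<in> carrier V \<Longrightarrow> 0 \<odot> x = \<zero>"
    and C_sub: "C \<subseteq> carrier V" and C_zero: "\<zero> \<in> C"
    and C_add: "\<And>x y. x \<in> C \<Longrightarrow> y \<in> C \<Longrightarrow> x \<oplus> y \<in> C"
    and C_smult: "\<And>c x. x \<in> C \<Longrightarrow> c \<odot> x \<in> C"
    and W_sub: "W \<subseteq> carrier V" and W_zero: "\<zero> \<in> W"
    and W_add: "\<And>x y. x \<in> W \<Longrightarrow> y \<in> W \<Longrightarrow> x \<oplus> y \<in> W"
    and W_smult: "\<And>c x. x \<in> W \<Longrightarrow> c \<odot> x \<in> W"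
begin

interpretation abelian_group V by (rule abelian)

abbreviation "Q \<equiv> quot_space (V\<lparr>carrier := C\<rparr>) W"

lemma additive_W: "additive_subgroup W V"
proof -
  have "\<ominus> x \<in> W" if "x \<in> W" for x
    using that W_sub W_smult[OF that, of "-1"] smult_minus_one by auto
  then show ?thesis using W_sub W_zero W_add
    by unfold_locales (auto simp: a_inv_def)
qed

interpretation W: abelian_subgroup W V
  by (rule abelian_subgroupI3[OF additive_W abelian])

lemma coset_sub: "W +>\<^bsub>V\<lparr>carrier := C\<rparr>\<^esub> x = W +> x"
  by (simp add: a_r_coset_def')

lemma carrier_Q: "carrier Q = (\<lambda>x. W +> x) ` C"
  by (simp add: quot_space_def A_RCOSETS_def' coset_sub UNION_singleton_eq_range)

lemma zero_Q: "\<zero>\<^bsub>Q\<^esub> = W +> \<zero>"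
  using a_coset_add_zero[OF W_sub] by (simp add: quot_space_def)

lemma add_Q:
  assumes "x \<in> C" "y \<in> C"
  shows "(W +> x) \<oplus>\<^bsub>Q\<^esub> (W +> y) = W +> (x \<oplus> y)"
proof -
  have "(W +> x) <+> (W +> y) = W +> (x \<oplus> y)"
    using assms C_sub by (intro W.a_rcos_sum) auto
  then show ?thesis
    by (simp add: quot_space_def set_add_def')
qed

lemma coset_eq_iff:
  assumes "x \<in> carrier V" "y \<in> carrier V"
  shows "W +> x = W +> y \<longleftrightarrow> x \<ominus> y \<in> W"
  using assms W.a_repr_independence'[of x y] W.a_rcos_module[of y x] W.a_rcos_self[of x]
  by (auto simp: a_minus_def)

lemma self_in_coset: "x \<in> carrier V \<Longrightarrow> x \<in> W +> x"
  by (rule W.a_rcos_self)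

text \<open>\<open>quot_space\<close> takes a union over all representatives. A representative
  \<open>w \<oplus> x\<close> contributes the coset of \<open>c w \<oplus> c x\<close>, and
  \<open>c w\<close> lies in \<open>W\<close>, so all cosets in the union are the same.\<close>

lemma smult_Q:
  assumes "x \<in> C"
  shows "c \<odot>\<^bsub>Q\<^esub> (W +> x) = W +> (c \<odot> x)"
proof -
  have x: "x \<in> carrier V" using assms C_sub by auto
  have "W +> (c \<odot> z) = W +> (c \<odot> x)" if z: "z \<in> W +> x" for z
  proof -
    obtain w where w: "w \<in> W" "z = w \<oplus> x" using z unfolding a_r_coset_def' by auto
    have wc: "w \<in> carrier V" "c \<odot> w \<in> W" "c \<odot> w \<in> carrier V" "c \<odot> x \<in> carrier V"
      using w W_sub W_smult smult_closed x by auto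
    have "c \<odot> z = c \<odot> w \<oplus> c \<odot> x" using w wc x smult_add by auto
    then have "c \<odot> z \<in> W +> (c \<odot> x)" using wc unfolding a_r_coset_def' by auto
    then show ?thesis using W.a_repr_independence' wc(4) by blast
  qed
  then have "(\<Union>z \<in> W +> x. W +> (c \<odot> z)) = (\<Union>z \<in> W +> x. W +> (c \<odot> x))"
    by (intro SUP_cong refl)
  also have "\<dots> = W +> (c \<odot> x)"
    using self_in_coset[OF x] by blast
  finally show ?thesis by (simp add: quot_space_def coset_sub)
qed

lemma coset_in_Q: "x \<in> C \<Longrightarrow> W +> x \<in> carrier Q"
  by (simp add: carrier_Q)

lemma Q_cases:
  assumes "X \<in> carrier Q" obtains x where "x \<in> C" "x \<in> carrier V" "X = W +> x"
  using assms C_sub unfolding carrier_Q by blast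

lemma add_closed_Q: "x \<in> carrier Q \<Longrightarrow> y \<in> carrier Q \<Longrightarrow> x \<oplus>\<^bsub>Q\<^esub> y \<in> carrier Q"
  by (elim Q_cases) (simp add: add_Q coset_in_Q C_add)

lemma smult_closed_Q: "x \<in> carrier Q \<Longrightarrow> c \<odot>\<^bsub>Q\<^esub> x \<in> carrier Q"
  by (elim Q_cases) (simp add: smult_Q coset_in_Q C_smult)

lemma zero_closed_Q: "\<zero>\<^bsub>Q\<^esub> \<in> carrier Q"
  unfolding zero_Q by (intro coset_in_Q C_zero)

lemma smult_zero_Q: "x \<in> carrier Q \<Longrightarrow> 0 \<odot>\<^bsub>Q\<^esub> x = \<zero>\<^bsub>Q\<^esub>"
  unfolding zero_Q by (elim Q_cases) (simp add: smult_Q smult_zero)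

lemma add_zero_Q: "x \<in> carrier Q \<Longrightarrow> x \<oplus>\<^bsub>Q\<^esub> \<zero>\<^bsub>Q\<^esub> = x"
  unfolding zero_Q by (elim Q_cases) (simp add: add_Q C_zero)

lemma smult_zero_right_Q: "c \<odot>\<^bsub>Q\<^esub> \<zero>\<^bsub>Q\<^esub> = \<zero>\<^bsub>Q\<^esub>"
proof -
  have "c \<odot> \<zero> \<in> W" using W_zero W_smult by auto
  then have "W +> (c \<odot> \<zero>) = W"
    by (rule W.a_rcos_const)
  then show ?thesis using smult_Q[OF C_zero] a_coset_add_zero[OF W_sub]
    by (simp add: zero_Q)
qed

lemma carrier_trivial: "C \<subseteq> W \<Longrightarrow> carrier Q = {\<zero>\<^bsub>Q\<^esub>}"
proof -
  assume "C \<subseteq> W"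
  then have "W +> x = W" if "x \<in> C" for x using that W.a_rcos_const by blast
  then have "(\<lambda>x. W +> x) ` C = {W}" using C_zero by force
  then show ?thesis unfolding carrier_Q by (simp add: quot_space_def)
qed

end

text \<open>Enough of a vector space for isomorphisms to be inverted and to be replaced by maps
  agreeing on the carrier; the clause on the scalar 0 makes linear maps preserve zero.\<close>

definition closed_space :: "(rat, 'a) module \<Rightarrow> bool" where
  "closed_space V \<longleftrightarrow> \<zero>\<^bsub>V\<^esub> \<in> carrier V \<and>
    (\<forall>x \<in> carrier V. \<forall>y \<in> carrier V. x \<oplus>\<^bsub>V\<^esub> y \<in> carrier V) \<and>
    (\<forall>c. \<forall>x \<in> carrier V. c \<odot>\<^bsub>V\<^esub> x \<in> carrier V \<and> 0 \<odot>\<^bsub>V\<^esub> x = \<zero>\<^bsub>V\<^esub>)"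

lemma (in subquotient) closed_space_Q: "closed_space Q"
  by (auto simp: closed_space_def zero_closed_Q add_closed_Q smult_closed_Q smult_zero_Q)

lemma linear_map_zero:
  assumes "h \<in> linear_maps V W" "closed_space V" "closed_space W"
  shows "h \<zero>\<^bsub>V\<^esub> = \<zero>\<^bsub>W\<^esub>"
proof -
  have z: "\<zero>\<^bsub>V\<^esub> \<in> carrier V" "0 \<odot>\<^bsub>V\<^esub> \<zero>\<^bsub>V\<^esub> = \<zero>\<^bsub>V\<^esub>" using assms by (auto simp: closed_space_def)
  have "h (0 \<odot>\<^bsub>V\<^esub> \<zero>\<^bsub>V\<^esub>) = 0 \<odot>\<^bsub>W\<^esub> h \<zero>\<^bsub>V\<^esub>" using assms(1) z(1) by (simp add: linear_maps_def)
  then have "h \<zero>\<^bsub>V\<^esub> = 0 \<odot>\<^bsub>W\<^esub> h \<zero>\<^bsub>V\<^esub>" using z by simp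
  moreover have "h \<zero>\<^bsub>V\<^esub> \<in> carrier W" using assms(1) z by (auto simp: linear_maps_def)
  ultimately show ?thesis using assms(3) by (auto simp: closed_space_def)
qed

lemma linear_isosI:
  assumes "\<And>x. x \<in> carrier V \<Longrightarrow> h x \<in> carrier W"
    and "\<And>x y. x \<in> carrier V \<Longrightarrow> y \<in> carrier V \<Longrightarrow> h (x \<oplus>\<^bsub>V\<^esub> y) = h x \<oplus>\<^bsub>W\<^esub> h y"
    and "\<And>c x. x \<in> carrier V \<Longrightarrow> h (c \<odot>\<^bsub>V\<^esub> x) = c \<odot>\<^bsub>W\<^esub> h x"
    and "inj_on h (carrier V)" "\<And>y. y \<in> carrier W \<Longrightarrow> \<exists>x \<in> carrier V. h x = y"
  shows "h \<in> linear_isos V W"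
  unfolding linear_isos_def linear_maps_def bij_betw_def using assms by blast

lemma linear_isosD:
  assumes "h \<in> linear_isos V W"
  shows "\<And>x. x \<in> carrier V \<Longrightarrow> h x \<in> carrier W"
    and "\<And>x y. x \<in> carrier V \<Longrightarrow> y \<in> carrier V \<Longrightarrow> h (x \<oplus>\<^bsub>V\<^esub> y) = h x \<oplus>\<^bsub>W\<^esub> h y"
    and "\<And>c x. x \<in> carrier V \<Longrightarrow> h (c \<odot>\<^bsub>V\<^esub> x) = c \<odot>\<^bsub>W\<^esub> h x"
    and "inj_on h (carrier V)" "h ` carrier V = carrier W" "h \<in> linear_maps V W"
  using assms unfolding linear_isos_def linear_maps_def bij_betw_def by blast+

lemma linear_isos_inv:
  assumes h: "h \<in> linear_isos V W" and V: "closed_space V"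
  shows "inv_into (carrier V) h \<in> linear_isos W V"
proof (rule linear_isosI)
  note D = linear_isosD[OF h]
  let ?g = "inv_into (carrier V) h"
  have g: "?g y \<in> carrier V" "h (?g y) = y" if "y \<in> carrier W" for y
    using that D(5) by (auto intro: inv_into_into f_inv_into_f)
  have gu: "?g (h x) = x" if "x \<in> carrier V" for x using that D(4) by simp
  show "?g y \<in> carrier V" if "y \<in> carrier W" for y using g that by auto
  show "?g (x \<oplus>\<^bsub>W\<^esub> y) = ?g x \<oplus>\<^bsub>V\<^esub> ?g y" if "x \<in> carrier W" "y \<in> carrier W" for x y
    using g[OF that(1)] g[OF that(2)] D(2) gu V by (metis closed_space_def)
  show "?g (c \<odot>\<^bsub>W\<^esub> x) = c \<odot>\<^bsub>V\<^esub> ?g x" if "x \<in> carrier W" for c x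
    using g[OF that] D(3) gu V by (metis closed_space_def)
  show "inj_on ?g (carrier W)" using D(5) by (auto intro: inj_on_inv_into)
  show "\<exists>x\<in>carrier W. ?g x = y" if "y \<in> carrier V" for y using gu[OF that] D(1) that by blast
qed

lemma linear_isos_comp:
  assumes "h \<in> linear_isos V W" "g \<in> linear_isos W X"
  shows "g \<circ> h \<in> linear_isos V X"
proof -
  note D = linear_isosD[OF assms(1)] and E = linear_isosD[OF assms(2)]
  have "inj_on (g \<circ> h) (carrier V)" using D E by (intro comp_inj_on) auto
  moreover have "\<exists>x\<in>carrier V. (g \<circ> h) x = y" if "y \<in> carrier X" for y
    using that unfolding E(5)[symmetric] D(5)[symmetric] by auto
  ultimately show ?thesis using D(1-3) E(1-3) by (intro linear_isosI) auto
qed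

lemma linear_isos_cong:
  assumes "h \<in> linear_isos V W" "closed_space V" "\<And>x. x \<in> carrier V \<Longrightarrow> g x = h x"
  shows "g \<in> linear_isos V W"
proof -
  note D = linear_isosD[OF assms(1)]
  have cl: "\<And>x y. x \<in> carrier V \<Longrightarrow> y \<in> carrier V \<Longrightarrow> x \<oplus>\<^bsub>V\<^esub> y \<in> carrier V"
    "\<And>c x. x \<in> carrier V \<Longrightarrow> c \<odot>\<^bsub>V\<^esub> x \<in> carrier V"
    using assms(2) by (auto simp: closed_space_def)
  have "inj_on g (carrier V)" using D(4) assms(3) by (simp add: inj_on_def)
  moreover have "\<exists>x\<in>carrier V. g x = y" if "y \<in> carrier W" for y
    using that assms(3) unfolding D(5)[symmetric] by auto
  ultimately show ?thesis
    using D(1-3) assms(3) cl by (intro linear_isosI) auto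
qed

section \<open>Free and dual spaces, and maps out of a free space\<close>

lemma carrier_free_iff:
  "f \<in> carrier (free_space S) \<longleftrightarrow> (\<forall>x. x \<notin> S \<longrightarrow> coef f x = 0)"
  by (auto simp: free_space_def in_keys_iff subset_iff)

lemma subspace_free: "qvs.subspace (carrier (free_space S))"
  by (auto simp: qvs.subspace_def carrier_free_iff lookup_add)

lemma free_space_simps [simp]:
  "\<zero>\<^bsub>free_space S\<^esub> = 0" "x \<oplus>\<^bsub>free_space S\<^esub> y = x + y" "c \<odot>\<^bsub>free_space S\<^esub> x = qscale c x"
  by (auto simp: free_space_def)

lemma closed_space_free: "closed_space (free_space S)"
  by (auto simp: closed_space_def carrier_free_iff lookup_add)

text \<open>The common shape of the three isomorphisms from the span of the snakes: onto the
  quotient by \<open>MB I\<close>, onto homology and onto cohomology. In each, \<open>f\<close>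
  chooses representatives, and the last two assumptions are independence and spanning modulo
  \<open>W\<close>.\<close>

lemma (in subquotient) free_space_iso_quotient:
  fixes f :: "('s \<Rightarrow>\<^sub>0 rat) \<Rightarrow> 'a"
  assumes "\<And>x. x \<in> carrier (free_space S) \<Longrightarrow> f x \<in> C"
    and add: "\<And>x y. f (x + y) = f x \<oplus> f y"
    and smult: "\<And>c x. f (qscale c x) = c \<odot> f x"
    and inj: "\<And>x. x \<in> carrier (free_space S) \<Longrightarrow> f x \<in> W \<Longrightarrow> x = 0"
    and surj: "\<And>y. y \<in> C \<Longrightarrow> \<exists>x \<in> carrier (free_space S). y \<ominus> f x \<in> W"
  shows "(\<lambda>x. W +> f x) \<in> linear_isos (free_space S) Q"
proof (rule linear_isosI)
  let ?F = "free_space S"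
  have fV: "f x \<in> carrier V" if "x \<in> carrier ?F" for x using assms(1)[OF that] C_sub by auto
  show "inj_on (\<lambda>x. W +> f x) (carrier ?F)"
  proof (rule inj_onI)
    fix x y assume xy: "x \<in> carrier ?F" "y \<in> carrier ?F" "W +> f x = W +> f y"
    have c: "x + qscale (- 1) y \<in> carrier ?F"
      using xy unfolding carrier_free_iff by (simp del: qvs.scale_minus_left add: lookup_add)
    have "f (x + qscale (- 1) y) = f x \<ominus> f y"
      using xy fV by (simp del: qvs.scale_minus_left add: add smult smult_minus_one a_minus_def)
    then have "f (x + qscale (- 1) y) \<in> W" using xy fV coset_eq_iff by auto
    then have "x + qscale (- 1) y = 0" using inj c by blast
    then show "x = y" by (simp add: qvs.scale_minus_left)
  qed
  show "\<exists>x\<in>carrier ?F. W +> f x = y" if "y \<in> carrier Q" for y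
  proof -
    from that obtain c where c: "c \<in> C" "y = W +> c" by (rule Q_cases)
    then obtain x where x: "x \<in> carrier ?F" "c \<ominus> f x \<in> W" using surj by blast
    then have "W +> c = W +> f x" using c C_sub fV coset_eq_iff by blast
    then show ?thesis using x c by auto
  qed
  fix x y c assume x: "x \<in> carrier ?F"
  show "W +> f x \<in> carrier Q" using x assms(1) by (simp add: carrier_Q)
  show "W +> f (c \<odot>\<^bsub>?F\<^esub> x) = c \<odot>\<^bsub>Q\<^esub> (W +> f x)"
    using x by (simp add: smult_Q assms(1) smult)
  assume y: "y \<in> carrier ?F"
  show "W +> f (x \<oplus>\<^bsub>?F\<^esub> y) = (W +> f x) \<oplus>\<^bsub>Q\<^esub> (W +> f y)"
    using x y by (simp add: add_Q assms(1) add)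
qed

text \<open>For the uniqueness of the dual basis isomorphism. The induction removes one basis
  element at a time, as \<open>V\<close> is known only to be a \<open>closed_space\<close>.\<close>

lemma linear_maps_eq_on_free:
  assumes h: "h \<in> linear_maps (free_space S) V" "h' \<in> linear_maps (free_space S) V"
    and V: "closed_space V"
    and basis: "\<And>x. x \<in> S \<Longrightarrow> h (basis x) = h' (basis x)"
    and f: "f \<in> carrier (free_space S)"
  shows "h f = h' f"
proof -
  have fin: "finite T \<Longrightarrow> T \<subseteq> S \<Longrightarrow> supp f \<subseteq> T \<Longrightarrow> h f = h' f" for T f
  proof (induction T arbitrary: f rule: finite_induct)
    case empty
    then have "f = 0" by simp
    moreover have "h 0 = \<zero>\<^bsub>V\<^esub>" "h' 0 = \<zero>\<^bsub>V\<^esub>"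
      using linear_map_zero[OF h(1) closed_space_free V] linear_map_zero[OF h(2) closed_space_free V]
      by (auto simp: free_space_def)
    ultimately show ?case by simp
  next
    case (insert x T)
    define b where "b = qscale (coef f x) (basis x)"
    define g where "g = f - b"
    have fg: "f = g + b" by (simp add: g_def)
    have kb: "supp (basis x) \<subseteq> S" "supp b \<subseteq> S"
      using insert by (auto simp: b_def in_keys_iff lookup_single when_def split: if_splits)
    have kg: "supp g \<subseteq> T"
      using insert by (auto simp: g_def b_def in_keys_iff lookup_minus lookup_single when_def
          split: if_splits)
    have "h g = h' g" using insert.IH[OF _ kg] insert by auto
    moreover have "h b = h' b"
      using h basis[of x] insert kb(1)
      by (auto simp: b_def linear_maps_def free_space_def)
    moreover have "h f = h g \<oplus>\<^bsub>V\<^esub> h b" "h' f = h' g \<oplus>\<^bsub>V\<^esub> h' b"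
      using h kg kb insert unfolding fg by (auto simp: linear_maps_def free_space_def)
    ultimately show ?case by simp
  qed
  show ?thesis using fin[of "supp f" f] f by (auto simp: free_space_def)
qed

lemma abelian_group_free: "abelian_group (free_space S)"
proof (rule abelian_groupI)
  fix x assume x: "x \<in> carrier (free_space S)"
  show "\<exists>y\<in>carrier (free_space S). y \<oplus>\<^bsub>free_space S\<^esub> x = \<zero>\<^bsub>free_space S\<^esub>"
    using x by (intro bexI[of _ "- x"]) (auto simp: carrier_free_iff)
qed (auto simp: carrier_free_iff lookup_add ac_simps)

lemma minus_free: "x \<in> carrier (free_space S) \<Longrightarrow> \<ominus>\<^bsub>free_space S\<^esub> x = - x"
  by (rule abelian_group.minus_equality[OF abelian_group_free]) (auto simp: carrier_free_iff)

lemma diff_free: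
  "x \<in> carrier (free_space S) \<Longrightarrow> y \<in> carrier (free_space S) \<Longrightarrow> x \<ominus>\<^bsub>free_space S\<^esub> y = x - y"
  by (simp add: a_minus_def minus_free)

lemma subquotient_free:
  assumes "qvs.subspace C" "qvs.subspace W"
    "C \<subseteq> carrier (free_space S)" "W \<subseteq> carrier (free_space S)"
  shows "subquotient (free_space S) C W"
proof -
  have "qscale (-1) x = - x" for x :: "'a \<Rightarrow>\<^sub>0 rat"
    using qvs.scale_minus_left[of 1 x] by simp
  then show ?thesis
    using assms closed_space_free[of S]
    by (intro subquotient.intro abelian_group_free)
      (auto simp: minus_free closed_space_def qvs.subspace_def qvs.scale_right_distrib)
qed

lemma abelian_group_dual: "abelian_group (dual_space S)"
proof (rule abelian_groupI)
  fix x assume x: "x \<in> carrier (dual_space S)"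
  show "\<exists>y\<in>carrier (dual_space S). y \<oplus>\<^bsub>dual_space S\<^esub> x = \<zero>\<^bsub>dual_space S\<^esub>"
    using x by (intro bexI[of _ "\<lambda>i. - x i"]) (auto simp: dual_space_def)
qed (auto simp: dual_space_def ac_simps)

lemma minus_dual: "x \<in> carrier (dual_space S) \<Longrightarrow> \<ominus>\<^bsub>dual_space S\<^esub> x = (\<lambda>i. - x i)"
  by (rule abelian_group.minus_equality[OF abelian_group_dual]) (auto simp: dual_space_def)

lemma diff_dual:
  "x \<in> carrier (dual_space S) \<Longrightarrow> y \<in> carrier (dual_space S) \<Longrightarrow>
    x \<ominus>\<^bsub>dual_space S\<^esub> y = (\<lambda>i. x i - y i)"
  by (simp add: a_minus_def minus_dual) (simp add: dual_space_def)

definition fun_subspace :: "('a \<Rightarrow> rat) set \<Rightarrow> bool" where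
  "fun_subspace C \<longleftrightarrow> (\<lambda>_. 0) \<in> C \<and> (\<forall>x \<in> C. \<forall>y \<in> C. (\<lambda>i. x i + y i) \<in> C) \<and>
     (\<forall>c. \<forall>x \<in> C. (\<lambda>i. c * x i) \<in> C)"

lemma subquotient_dual:
  assumes "fun_subspace C" "fun_subspace W"
    "C \<subseteq> carrier (dual_space S)" "W \<subseteq> carrier (dual_space S)"
  shows "subquotient (dual_space S) C W"
  using assms
  by (intro subquotient.intro abelian_group_dual)
    (auto simp: minus_dual fun_subspace_def, auto simp: dual_space_def algebra_simps)

section \<open>Chains and boundaries\<close>

interpretation lin: vector_space_pair qscale qscale ..

lemma linear_ext_superset:
  assumes "finite S" "supp f \<subseteq> S"
  shows "linear_ext g f = (\<Sum>x\<in>S. qscale (coef f x) (g x))"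
  unfolding linear_ext_def using assms
  by (intro sum.mono_neutral_left) (auto simp: in_keys_iff)

lemma linear_ext_add: "linear_ext g (x + y) = linear_ext g x + linear_ext g y"
proof -
  let ?S = "supp x \<union> supp y"
  have "supp (x + y) \<subseteq> ?S" by (rule keys_add)
  then show ?thesis
    by (simp add: linear_ext_superset[of ?S] lookup_add qvs.scale_left_distrib sum.distrib)
qed

lemma linear_ext_qscale: "linear_ext g (qscale c x) = qscale c (linear_ext g x)"
proof -
  have "supp (qscale c x) \<subseteq> supp x" by (auto simp: in_keys_iff)
  then show ?thesis
    by (simp add: linear_ext_superset[of "supp x"] qvs.scale_sum_right)
qed

lemma linear_linear_ext: "Vector_Spaces.linear qscale qscale (linear_ext g)"
  by (intro Vector_Spaces.linear.intro module_hom.intro module_hom_axioms.intro)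
    (auto simp: linear_ext_add linear_ext_qscale qvs.vector_space_axioms
      qvs.module_axioms)

lemmas linear_ext_zero [simp] = lin.linear_0[OF linear_linear_ext]
lemmas linear_ext_diff = lin.linear_diff[OF linear_linear_ext]
lemmas linear_ext_sum = lin.linear_sum[OF linear_linear_ext]

lemma linear_ext_basis [simp]: "linear_ext g (basis x) = g x"
  by (simp add: linear_ext_def)

lemma lookup_sum: "coef (\<Sum>i\<in>A. f i) x = (\<Sum>i\<in>A. coef (f i) x)"
  by (induction A rule: infinite_finite_induct) (auto simp: lookup_add)

lemma lookup_linear_ext:
  "finite S \<Longrightarrow> supp f \<subseteq> S \<Longrightarrow>
    coef (linear_ext g f) y = (\<Sum>x\<in>S. coef f x * coef (g x) y)"
  by (simp add: linear_ext_superset lookup_sum)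

lemmas lookup_linear_ext_keys = lookup_linear_ext[OF finite_keys order_refl]

lemma keys_linear_ext:
  "supp (linear_ext g f) \<subseteq> (\<Union>x\<in>supp f. supp (g x))"
proof
  fix y assume "y \<in> supp (linear_ext g f)"
  then have "(\<Sum>x\<in>supp f. coef f x * coef (g x) y) \<noteq> 0"
    by (simp add: in_keys_iff lookup_linear_ext_keys)
  then obtain x where "x \<in> supp f" "coef (g x) y \<noteq> 0"
    by (metis (no_types, lifting) mult_not_zero sum.neutral)
  then show "y \<in> (\<Union>x\<in>supp f. supp (g x))" by (auto simp: in_keys_iff)
qed

lemma linear_ext_compose:
  assumes "\<And>x. x \<in> supp f \<Longrightarrow> linear_ext h (g x) = k x"
  shows "linear_ext h (linear_ext g f) = linear_ext k f"
  using assms by (simp add: linear_ext_def[of g] linear_ext_def[of k] linear_ext_sum linear_ext_qscale)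

lemma poly_mapping_basis_sum: "linear_ext basis f = f"
proof (rule poly_mapping_eqI)
  fix y
  have "coef f x * coef (basis x) y =
      (if x = y then coef f x else 0)" for x
    by (simp add: lookup_single when_def)
  then show "coef (linear_ext basis f) y = coef f y"
    by (simp add: lookup_linear_ext_keys in_keys_iff)
qed

lemma linear_ext_linear:
  assumes "Vector_Spaces.linear qscale qscale h"
  shows "h f = linear_ext (\<lambda>x. h (basis x)) f"
proof -
  have "h f = h (linear_ext basis f)" by (simp add: poly_mapping_basis_sum)
  then show ?thesis
    using assms by (simp add: linear_ext_def lin.linear_sum lin.linear_scale)
qed

subsection \<open>Appending a vertex\<close>

text \<open>The cone with apex \<open>p\<close>. The apex comes last, so the faces of the base keep
  their positions and signs, and the boundary formula gets a single extra term.\<close>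

definition snoc :: "'v \<Rightarrow> ('v list \<Rightarrow>\<^sub>0 rat) \<Rightarrow> ('v list \<Rightarrow>\<^sub>0 rat)" where
  "snoc p = linear_ext (\<lambda>\<sigma>. basis (\<sigma> @ [p]))"

lemma snoc_basis [simp]: "snoc p (basis \<sigma>) = basis (\<sigma> @ [p])"
  by (simp add: snoc_def)

lemma snoc_linear: "Vector_Spaces.linear qscale qscale (snoc p)"
  unfolding snoc_def by (rule linear_linear_ext)

lemmas snoc_zero [simp] = lin.linear_0[OF snoc_linear]
lemmas snoc_diff = lin.linear_diff[OF snoc_linear]
lemmas snoc_add = lin.linear_add[OF snoc_linear]
lemmas snoc_qscale = lin.linear_scale[OF snoc_linear]
lemmas snoc_sum = lin.linear_sum[OF snoc_linear]

lemma lookup_snoc: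
  "coef (snoc p f) \<sigma> =
    (if \<sigma> \<noteq> [] \<and> last \<sigma> = p then coef f (butlast \<sigma>) else 0)"
proof -
  have eq: "\<tau> @ [p] = \<sigma> \<longleftrightarrow> \<sigma> \<noteq> [] \<and> last \<sigma> = p \<and> \<tau> = butlast \<sigma>" for \<tau>
    by (metis append_butlast_last_id butlast_snoc last_snoc snoc_eq_iff_butlast)
  show ?thesis
    unfolding snoc_def
    by (subst lookup_linear_ext[of "insert (butlast \<sigma>) (supp f)"])
      (auto simp: lookup_single when_def eq sum.delta if_distrib cong: if_cong)
qed

lemma keys_snoc: "supp (snoc p f) = (\<lambda>\<sigma>. \<sigma> @ [p]) ` supp f"
proof (intro equalityI subsetI)
  fix \<sigma> assume "\<sigma> \<in> supp (snoc p f)"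
  then have "\<sigma> \<noteq> []" "last \<sigma> = p" "butlast \<sigma> \<in> supp f"
    by (auto simp: in_keys_iff lookup_snoc split: if_splits)
  then show "\<sigma> \<in> (\<lambda>\<sigma>. \<sigma> @ [p]) ` supp f"
    by (intro image_eqI[of _ _ "butlast \<sigma>"]) auto
qed (auto simp: in_keys_iff lookup_snoc)

lemma simplex_bd_snoc:
  "simplex_bd (\<sigma> @ [p]) = snoc p (simplex_bd \<sigma>) + qscale ((-1) ^ length \<sigma>) (basis \<sigma>)"
  by (simp add: simplex_bd_def snoc_sum snoc_qscale)

abbreviation bd :: "('v list \<Rightarrow>\<^sub>0 rat) \<Rightarrow> ('v list \<Rightarrow>\<^sub>0 rat)" where
  "bd \<equiv> linear_ext simplex_bd"

lemma bd_snoc: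
  assumes "\<And>\<sigma>. \<sigma> \<in> supp x \<Longrightarrow> length \<sigma> = l"
  shows "bd (snoc p x) = snoc p (bd x) + qscale ((-1) ^ l) x"
proof -
  have "bd (snoc p x) = linear_ext (\<lambda>\<sigma>. simplex_bd (\<sigma> @ [p])) x"
    unfolding snoc_def by (rule linear_ext_compose) simp
  also have "\<dots> = linear_ext (\<lambda>\<sigma>. snoc p (simplex_bd \<sigma>)) x + qscale ((-1) ^ l) (linear_ext basis x)"
    using assms unfolding linear_ext_def
    by (simp add: simplex_bd_snoc qvs.scale_right_distrib sum.distrib qvs.scale_sum_right mult.commute)
  also have "linear_ext (\<lambda>\<sigma>. snoc p (simplex_bd \<sigma>)) x = snoc p (bd x)"
    unfolding linear_ext_def by (simp add: snoc_sum snoc_qscale)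
  finally show ?thesis by (simp add: poly_mapping_basis_sum)
qed

lemma keys_simplex_bd:
  assumes "\<tau> \<in> supp (simplex_bd \<sigma>)"
  obtains a x b where "\<sigma> = a @ x # b" "\<tau> = a @ b"
proof -
  have "(\<Sum>j<length \<sigma>. (-1) ^ j * coef (basis (take j \<sigma> @ drop (Suc j) \<sigma>)) \<tau>) \<noteq> (0::rat)"
    using assms by (simp add: simplex_bd_def in_keys_iff lookup_sum)
  then obtain j where j: "j < length \<sigma>" "coef (basis (take j \<sigma> @ drop (Suc j) \<sigma>)) \<tau> \<noteq> (0::rat)"
    by (metis (no_types, lifting) lessThan_iff mult_not_zero sum.neutral)
  then have "\<tau> = take j \<sigma> @ drop (Suc j) \<sigma>" by (auto simp: lookup_single when_def split: if_splits)
  with j that[of "take j \<sigma>" "\<sigma> ! j" "drop (Suc j) \<sigma>"] show ?thesis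
    by (simp add: id_take_nth_drop[symmetric])
qed

lemma lookup_simplex_bd:
  assumes "distinct (a @ x # b)"
  shows "coef (simplex_bd (a @ x # b)) (a @ b) = (-1) ^ length a"
proof -
  let ?\<sigma> = "a @ x # b"
  have "coef (basis (take j ?\<sigma> @ drop (Suc j) ?\<sigma>)) (a @ b) = (if j = length a then 1 else (0::rat))"
    if "j < length ?\<sigma>" for j
  proof (cases "j = length a")
    case False
    have "x \<in> set (take j ?\<sigma> @ drop (Suc j) ?\<sigma>)"
      using False that by (cases "j < length a") (auto simp: take_Cons' drop_Cons')
    moreover have "x \<notin> set (a @ b)" using assms by auto
    ultimately have "take j ?\<sigma> @ drop (Suc j) ?\<sigma> \<noteq> a @ b" by metis
    then show ?thesis using False by (simp add: lookup_single when_def)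
  qed simp
  then have "coef (simplex_bd ?\<sigma>) (a @ b) =
      (\<Sum>j<length ?\<sigma>. (-1) ^ j * (if j = length a then 1 else 0))"
    unfolding simplex_bd_def lookup_sum lookup_qscale by (intro sum.cong) auto
  also have "\<dots> = (-1) ^ length a"
    by (simp add: sum.delta if_distrib cong: if_cong)
  finally show ?thesis .
qed

lemma length_keys_simplex_bd:
  "\<tau> \<in> supp (simplex_bd \<sigma>) \<Longrightarrow> length \<sigma> = Suc (length \<tau>)"
  by (elim keys_simplex_bd) simp

lemma bd_simplex_bd: "bd (simplex_bd \<sigma>) = 0"
proof (induction \<sigma> rule: rev_induct)
  case Nil
  then show ?case by (simp add: simplex_bd_def)
next
  case (snoc p \<sigma>)
  show ?case
  proof (cases "\<sigma> = []")
    case True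
    then show ?thesis by (simp add: simplex_bd_def)
  next
    case False
    have l: "length \<tau> = length \<sigma> - 1" if "\<tau> \<in> supp (simplex_bd \<sigma>)" for \<tau>
      using length_keys_simplex_bd[OF that] by simp
    \<comment> \<open>\<open>simplex_bd \<sigma>\<close> arises twice, with the apex removed last
      and with the apex removed first; its two positions differ by one, so the terms cancel.\<close>
    have "(-1) ^ length \<sigma> = - ((-1) ^ (length \<sigma> - 1) :: rat)"
      using False by (cases \<sigma>) auto
    then show ?thesis
      using snoc by (simp add: simplex_bd_snoc linear_ext_diff linear_ext_qscale bd_snoc[OF l])
  qed
qed

lemma bd_bd: "bd (bd x) = 0"
  using linear_ext_compose[of x simplex_bd simplex_bd "\<lambda>_. 0"]
  by (simp add: bd_simplex_bd) (simp add: linear_ext_def)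

lemma cycles_subspace: "qvs.subspace (cycles K k)"
  using subspace_free[of "simplices K k"]
  by (auto simp: cycles_def qvs.subspace_def linear_ext_add linear_ext_qscale)

lemma boundaries_subspace: "qvs.subspace (boundaries K k)"
  unfolding boundaries_def by (rule lin.linear_subspace_image[OF linear_linear_ext subspace_free])

definition face_closed :: "'v list set \<Rightarrow> bool" where
  "face_closed K \<longleftrightarrow> (\<forall>a x b. a @ x # b \<in> K \<longrightarrow> a @ b \<in> K)"

lemma bd_in_chains:
  assumes "face_closed K" "c \<in> carrier (free_space (simplices K k))"
  shows "bd c \<in> carrier (free_space (simplices K (k - 1)))"
proof -
  have "\<tau> \<in> simplices K (k - 1)" if t: "\<tau> \<in> supp (bd c)" for \<tau>
  proof -
    obtain \<sigma> where s: "\<sigma> \<in> supp c" "\<tau> \<in> supp (simplex_bd \<sigma>)"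
      using keys_linear_ext[of simplex_bd c] t by auto
    from s(2) obtain a x b where "\<sigma> = a @ x # b" "\<tau> = a @ b" by (rule keys_simplex_bd)
    with s(1) assms show ?thesis
      by (auto simp: free_space_def simplices_def face_closed_def subset_iff)
  qed
  then show ?thesis by (auto simp: free_space_def)
qed

lemma boundaries_cycles:
  assumes "face_closed K"
  shows "boundaries K k \<subseteq> cycles K k"
  using bd_in_chains[OF assms, of _ "k + 1"] by (auto simp: boundaries_def cycles_def bd_bd)

text \<open>
  A discrete Morse argument. The label of a simplex is the pair of \<open>\<mu>\<close> and \<open>V\<close>; on simplices with
  the same non-critical label, adding or deleting the vertex \<open>V\<close> is an acyclic matching. A cycle
  is reduced by removing its leading terms, those of maximal \<open>\<mu>\<close>.
\<close>

lemma morse_reduction: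
  fixes K :: "'v list set" and \<mu> :: "'v list \<Rightarrow> nat"
  assumes closed: "face_closed K"
    and dist: "\<And>\<sigma>. \<sigma> \<in> K \<Longrightarrow> distinct \<sigma>"
    and set_inj: "\<And>\<sigma> \<tau>. \<sigma> \<in> K \<Longrightarrow> \<tau> \<in> K \<Longrightarrow> set \<sigma> = set \<tau> \<Longrightarrow> \<sigma> = \<tau>"
    and face: "\<And>a x b. a @ x # b \<in> K \<Longrightarrow> \<mu> (a @ b) < \<mu> (a @ x # b) \<or>
        (\<mu> (a @ b) = \<mu> (a @ x # b) \<and> V (a @ b) = V (a @ x # b) \<and> (crit (a @ b) \<longleftrightarrow> crit (a @ x # b)))"
    and ins: "\<And>\<sigma>. \<sigma> \<in> K \<Longrightarrow> \<not> crit \<sigma> \<Longrightarrow> V \<sigma> \<notin> set \<sigma> \<Longrightarrow>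
        \<exists>a b. \<sigma> = a @ b \<and> a @ V \<sigma> # b \<in> K \<and> \<mu> (a @ V \<sigma> # b) = \<mu> \<sigma>"
    and del: "\<And>a x b. a @ x # b \<in> K \<Longrightarrow> \<not> crit (a @ x # b) \<Longrightarrow> V (a @ x # b) = x \<Longrightarrow>
        \<mu> (a @ b) = \<mu> (a @ x # b)"
    and zeta: "\<And>\<sigma>. \<sigma> \<in> simplices K k \<Longrightarrow> crit \<sigma> \<Longrightarrow> \<zeta> \<sigma> \<in> cycles K k \<and>
        coef (\<zeta> \<sigma>) \<sigma> = 1 \<and> (\<forall>\<tau> \<in> supp (\<zeta> \<sigma>). \<tau> \<noteq> \<sigma> \<longrightarrow> \<mu> \<tau> < \<mu> \<sigma>)"
    and z: "z \<in> cycles K k"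
  shows "\<exists>b c. b \<in> boundaries K k \<and> c \<in> carrier (free_space {\<sigma> \<in> simplices K k. crit \<sigma>}) \<and>
    z = b + linear_ext \<zeta> c"
proof -
  let ?C = "carrier (free_space {\<sigma> \<in> simplices K k. crit \<sigma>})"
  \<comment> \<open>One round of reduction: all terms at the top level \<open>M\<close> are removed
    at the cost of a boundary and a combination of the cycles \<open>\<zeta>\<close>.\<close>
  have step: "\<exists>b c. b \<in> boundaries K k \<and> c \<in> ?C \<and> (\<forall>\<sigma> \<in> supp (z - b - linear_ext \<zeta> c). \<mu> \<sigma> < M)"
    if z: "z \<in> cycles K k" and zM: "\<forall>\<sigma> \<in> supp z. \<mu> \<sigma> < Suc M" for z M
  proof -
    have kz: "\<sigma> \<in> simplices K k" "\<sigma> \<in> K" "\<mu> \<sigma> \<le> M" if "\<sigma> \<in> supp z" for \<sigma>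
      using that z zM by (auto simp: cycles_def free_space_def simplices_def less_Suc_eq_le)
    \<comment> \<open>The non-critical top-level terms that lack their matching vertex; each is
      paired with a simplex \<open>up \<sigma>\<close> that has it.\<close>
    define S where "S = {\<sigma> \<in> supp z. \<mu> \<sigma> = M \<and> \<not> crit \<sigma> \<and> V \<sigma> \<notin> set \<sigma>}"
    have finS: "finite S" by (simp add: S_def)
    have "\<exists>p. \<sigma> = fst p @ snd p \<and> fst p @ V \<sigma> # snd p \<in> K \<and> \<mu> (fst p @ V \<sigma> # snd p) = \<mu> \<sigma>"
      if "\<sigma> \<in> S" for \<sigma>
      using ins[of \<sigma>] kz(2)[of \<sigma>] that by (fastforce simp: S_def)
    then obtain sp where sp: "\<And>\<sigma>. \<sigma> \<in> S \<Longrightarrow> \<sigma> = fst (sp \<sigma>) @ snd (sp \<sigma>) \<and>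
        fst (sp \<sigma>) @ V \<sigma> # snd (sp \<sigma>) \<in> K \<and> \<mu> (fst (sp \<sigma>) @ V \<sigma> # snd (sp \<sigma>)) = \<mu> \<sigma>"
      by metis
    define up where "up \<sigma> = fst (sp \<sigma>) @ V \<sigma> # snd (sp \<sigma>)" for \<sigma>
    define sg :: "'v list \<Rightarrow> rat" where "sg \<sigma> = (-1) ^ length (fst (sp \<sigma>))" for \<sigma>
    have up: "up \<sigma> \<in> K" "\<mu> (up \<sigma>) = M" "set (up \<sigma>) = insert (V \<sigma>) (set \<sigma>)"
        "V (up \<sigma>) = V \<sigma>" "\<not> crit (up \<sigma>)" "coef (simplex_bd (up \<sigma>)) \<sigma> = sg \<sigma>"
        "length (up \<sigma>) = Suc (length \<sigma>)" if "\<sigma> \<in> S" for \<sigma>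
    proof -
      have s: "\<sigma> \<in> S" by fact
      note p = sp[OF s]
      have eq: "\<sigma> = fst (sp \<sigma>) @ snd (sp \<sigma>)" using p by simp
      show "up \<sigma> \<in> K" "\<mu> (up \<sigma>) = M" using p s by (auto simp: up_def S_def)
      have "set (fst (sp \<sigma>)) \<union> set (snd (sp \<sigma>)) = set \<sigma>"
        by (subst (3) eq) simp
      then show "set (up \<sigma>) = insert (V \<sigma>) (set \<sigma>)" unfolding up_def by auto
      have "\<mu> (fst (sp \<sigma>) @ snd (sp \<sigma>)) = \<mu> (up \<sigma>)" using p by (simp add: up_def)
      with face[of "fst (sp \<sigma>)" "V \<sigma>" "snd (sp \<sigma>)"] p
      have "V (fst (sp \<sigma>) @ snd (sp \<sigma>)) = V (up \<sigma>) \<and> (crit (fst (sp \<sigma>) @ snd (sp \<sigma>)) \<longleftrightarrow> crit (up \<sigma>))"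
        by (simp add: up_def)
      then show "V (up \<sigma>) = V \<sigma>" "\<not> crit (up \<sigma>)" using eq s by (auto simp: S_def)
      have "coef (simplex_bd (up \<sigma>)) (fst (sp \<sigma>) @ snd (sp \<sigma>)) = sg \<sigma>"
        unfolding up_def sg_def using p dist by (intro lookup_simplex_bd) blast
      then show "coef (simplex_bd (up \<sigma>)) \<sigma> = sg \<sigma>" using eq by simp
      have "length \<sigma> = length (fst (sp \<sigma>)) + length (snd (sp \<sigma>))" by (subst eq) simp
      then show "length (up \<sigma>) = Suc (length \<sigma>)" by (simp add: up_def)
    qed
    \<comment> \<open>\<open>sg \<sigma>\<close> is the coefficient of \<open>\<sigma>\<close> in
      the boundary of \<open>up \<sigma>\<close> and is its own inverse, so \<open>bd w\<close>
      reproduces the coefficients of \<open>z\<close> on \<open>S\<close>.\<close>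
    define w where "w = (\<Sum>\<sigma>\<in>S. qscale (coef z \<sigma> * sg \<sigma>) (basis (up \<sigma>)))"
    define b where "b = bd w"
    have "w \<in> carrier (free_space (simplices K (k + 1)))"
      unfolding w_def
    proof (intro qvs.subspace_sum[OF subspace_free] qvs.subspace_scale[OF subspace_free])
      fix \<sigma> assume s: "\<sigma> \<in> S"
      then have "\<sigma> \<in> simplices K k" using kz by (simp add: S_def)
      then show "basis (up \<sigma>) \<in> carrier (free_space (simplices K (k + 1)))"
        using up[OF s] by (simp add: free_space_def simplices_def)
    qed
    then have b: "b \<in> boundaries K k" by (auto simp: b_def boundaries_def)
    have lb: "coef b \<tau> = (\<Sum>\<sigma>\<in>S. coef z \<sigma> * sg \<sigma> * coef (simplex_bd (up \<sigma>)) \<tau>)" for \<tau>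
      by (simp add: b_def w_def linear_ext_sum linear_ext_qscale lookup_sum mult.assoc)
    \<comment> \<open>Acyclicity: at level \<open>M\<close>, a face of \<open>up \<sigma>\<close>
      other than \<open>\<sigma>\<close> still contains the matching vertex, so the pairs do not
      interfere.\<close>
    have faceS: "\<tau> = \<sigma> \<or> V \<tau> \<in> set \<tau> \<and> V \<tau> = V \<sigma>" "\<not> crit \<tau>"
      if "\<sigma> \<in> S" "coef (simplex_bd (up \<sigma>)) \<tau> \<noteq> 0" "\<mu> \<tau> = M" for \<sigma> \<tau>
    proof -
      note u = up[OF that(1)]
      from that(2) have "\<tau> \<in> supp (simplex_bd (up \<sigma>))" by (simp add: in_keys_iff)
      then obtain a x b where f: "up \<sigma> = a @ x # b" "\<tau> = a @ b" by (rule keys_simplex_bd)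
      have lab: "V \<tau> = V \<sigma>" "\<not> crit \<tau>" using face[of a x b] f u that(3) by auto
      show "\<not> crit \<tau>" by fact
      have dx: "x \<notin> set \<tau>" "set (up \<sigma>) = insert x (set \<tau>)" using dist[OF u(1)] f by auto
      have tK: "\<tau> \<in> K" using closed u(1) f unfolding face_closed_def by auto
      show "\<tau> = \<sigma> \<or> V \<tau> \<in> set \<tau> \<and> V \<tau> = V \<sigma>"
      proof (cases "x = V \<sigma>")
        case True
        moreover have "V \<sigma> \<notin> set \<sigma>" using that(1) by (simp add: S_def)
        ultimately have "set \<tau> = set \<sigma>" using dx u(3) by (metis Diff_insert_absorb)
        then show ?thesis using set_inj[OF tK] kz(2) that(1) by (auto simp: S_def)
      next
        case False
        then show ?thesis using lab dx u(3) by auto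
      qed
    qed
    have lb0: "\<mu> \<tau> \<le> M" if "coef b \<tau> \<noteq> 0" for \<tau>
    proof -
      obtain \<sigma> where s: "\<sigma> \<in> S" "coef (simplex_bd (up \<sigma>)) \<tau> \<noteq> 0"
        using \<open>coef b \<tau> \<noteq> 0\<close> unfolding lb by (metis (no_types, lifting) mult_not_zero sum.neutral)
      then have "\<tau> \<in> supp (simplex_bd (up \<sigma>))" by (simp add: in_keys_iff)
      then obtain a x b where f: "up \<sigma> = a @ x # b" "\<tau> = a @ b" by (rule keys_simplex_bd)
      then show ?thesis using face[of a x b] up[OF s(1)] by auto
    qed
    define c where "c = (\<Sum>\<sigma> \<in> {\<sigma> \<in> supp z. \<mu> \<sigma> = M \<and> crit \<sigma>}. qscale (coef z \<sigma>) (basis \<sigma>))"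
    have lc: "coef c \<sigma> = (if \<mu> \<sigma> = M \<and> crit \<sigma> then coef z \<sigma> else 0)" for \<sigma>
      by (auto simp: c_def lookup_sum lookup_single when_def if_distrib in_keys_iff cong: if_cong)
    have c: "c \<in> ?C"
      using kz(1) by (force simp: carrier_free_iff lc in_keys_iff split: if_splits)
    have kc: "\<sigma> \<in> simplices K k \<and> crit \<sigma> \<and> \<mu> \<sigma> = M \<and> coef c \<sigma> = coef z \<sigma>" if "\<sigma> \<in> supp c" for \<sigma>
      using that kz(1) by (auto simp: in_keys_iff lc split: if_splits)
    have lzc: "coef (linear_ext \<zeta> c) \<tau> = (if crit \<tau> then coef z \<tau> else 0)" if "\<mu> \<tau> = M" for \<tau>
    proof -
      have "coef c \<sigma> * coef (\<zeta> \<sigma>) \<tau> = (if \<sigma> = \<tau> then coef c \<tau> else 0)" if "\<sigma> \<in> supp c" for \<sigma>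
        using zeta[of \<sigma>] kc[OF that] \<open>\<mu> \<tau> = M\<close> by (auto simp: in_keys_iff)
      then have "coef (linear_ext \<zeta> c) \<tau> = (\<Sum>\<sigma>\<in>supp c. if \<sigma> = \<tau> then coef c \<tau> else 0)"
        by (simp add: lookup_linear_ext_keys)
      also have "\<dots> = coef c \<tau>" by (simp add: in_keys_iff)
      finally show ?thesis using that by (simp add: lc)
    qed
    have lzc0: "\<mu> \<tau> \<le> M" if nz: "coef (linear_ext \<zeta> c) \<tau> \<noteq> 0" for \<tau>
    proof -
      have "\<tau> \<in> supp (linear_ext \<zeta> c)" using nz by (simp add: in_keys_iff)
      then obtain \<sigma> where s: "\<sigma> \<in> supp c" "\<tau> \<in> supp (\<zeta> \<sigma>)"
        using keys_linear_ext[of \<zeta> c] by auto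
      then show ?thesis using zeta[of \<sigma>] kc[OF s(1)] by (cases "\<tau> = \<sigma>") auto
    qed
    have zc: "linear_ext \<zeta> c \<in> cycles K k"
      unfolding linear_ext_def using kc zeta
      by (intro qvs.subspace_sum[OF cycles_subspace] qvs.subspace_scale[OF cycles_subspace]) auto
    define z1 where "z1 = z - b - linear_ext \<zeta> c"
    have z1: "z1 \<in> cycles K k"
      unfolding z1_def using z b boundaries_cycles[OF closed] zc
      by (intro qvs.subspace_diff[OF cycles_subspace]) auto
    have z1M: "\<mu> \<sigma> \<le> M" if "coef z1 \<sigma> \<noteq> 0" for \<sigma>
    proof (rule ccontr)
      assume "\<not> \<mu> \<sigma> \<le> M"
      then have "coef z \<sigma> = 0" "coef b \<sigma> = 0" "coef (linear_ext \<zeta> c) \<sigma> = 0"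
        using kz(3)[of \<sigma>] lb0[of \<sigma>] lzc0[of \<sigma>] by (auto simp: in_keys_iff)
      then show False using that by (simp add: z1_def lookup_minus)
    qed
    have crit0: "coef z1 \<tau> = 0" if "\<mu> \<tau> = M" "crit \<tau>" for \<tau>
    proof -
      have "coef b \<tau> = 0" unfolding lb using faceS(2)[of _ \<tau>] that by (intro sum.neutral) auto
      then show ?thesis using that by (simp add: z1_def lookup_minus lzc)
    qed
    have out0: "coef z1 \<tau> = 0" if "\<mu> \<tau> = M" "\<not> crit \<tau>" "V \<tau> \<notin> set \<tau>" for \<tau>
    proof -
      have "coef z \<sigma> * sg \<sigma> * coef (simplex_bd (up \<sigma>)) \<tau> = (if \<sigma> = \<tau> then coef z \<tau> else 0)" if "\<sigma> \<in> S" for \<sigma>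
      proof (cases "\<sigma> = \<tau>")
        case True
        then show ?thesis using up(6)[OF that] by (simp add: sg_def power_mult_distrib[symmetric] flip: power_add)
      next
        case False
        then show ?thesis using faceS(1)[OF that, of \<tau>] \<open>\<mu> \<tau> = M\<close> \<open>V \<tau> \<notin> set \<tau>\<close> by auto
      qed
      then have "coef b \<tau> = (\<Sum>\<sigma>\<in>S. if \<sigma> = \<tau> then coef z \<tau> else 0)" unfolding lb by simp
      also have "\<dots> = coef z \<tau>" using that finS by (auto simp: S_def in_keys_iff)
      finally show ?thesis using that by (simp add: z1_def lookup_minus lzc)
    qed
    \<comment> \<open>What is left at level \<open>M\<close> contains the matching vertex. Deleting
      it from such a \<open>\<tau>\<close> gives a face \<open>\<rho>\<close> which, by
      \<open>out0\<close>, no other term of \<open>z1\<close> has; so the coefficient of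
      \<open>\<tau>\<close> stands alone in the boundary of the cycle \<open>z1\<close>.\<close>
    have in0: "coef z1 \<tau> = 0" if "\<mu> \<tau> = M" "\<not> crit \<tau>" "V \<tau> \<in> set \<tau>" for \<tau>
    proof (rule ccontr)
      assume nz: "coef z1 \<tau> \<noteq> 0"
      have tK: "\<tau> \<in> K" using z1 nz by (auto simp: cycles_def carrier_free_iff simplices_def)
      obtain a b' where t: "\<tau> = a @ V \<tau> # b'" using \<open>V \<tau> \<in> set \<tau>\<close> by (meson split_list)
      define \<rho> where "\<rho> = a @ b'"
      have \<rho>: "\<mu> \<rho> = M" using del[of a "V \<tau>" b'] t tK that by (simp add: \<rho>_def)
      have \<rho>V: "V \<rho> = V \<tau>" "\<not> crit \<rho>" using face[of a "V \<tau>" b'] t tK that \<rho> by (auto simp: \<rho>_def)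
      have Vn: "V \<tau> \<notin> set \<rho>" using dist[OF tK] t unfolding \<rho>_def
        by (metis distinct.simps(2) distinct_append not_distinct_conv_prefix set_append Un_iff disjoint_insert(2) list.simps(15))
      have "coef z1 \<sigma> * coef (simplex_bd \<sigma>) \<rho> = (if \<sigma> = \<tau> then coef z1 \<tau> * (-1) ^ length a else 0)"
        if "\<sigma> \<in> supp z1" for \<sigma>
      proof (cases "\<sigma> = \<tau>")
        case True
        have "coef (simplex_bd \<tau>) \<rho> = (-1) ^ length a"
          using lookup_simplex_bd[of a "V \<tau>" b'] dist[OF tK] t by (simp add: \<rho>_def)
        then show ?thesis using True by simp
      next
        case False
        have "coef (simplex_bd \<sigma>) \<rho> = 0"
        proof (rule ccontr)
          assume "coef (simplex_bd \<sigma>) \<rho> \<noteq> 0"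
          then have "\<rho> \<in> supp (simplex_bd \<sigma>)" by (simp add: in_keys_iff)
          then obtain a' x' b'' where f: "\<sigma> = a' @ x' # b''" "\<rho> = a' @ b''" by (rule keys_simplex_bd)
          have sK: "\<sigma> \<in> K" using z1 that by (auto simp: cycles_def free_space_def simplices_def)
          have sM: "\<mu> \<sigma> \<le> M" using z1M that by (simp add: in_keys_iff)
          then have lab: "\<mu> \<sigma> = M" "V \<sigma> = V \<tau>" "\<not> crit \<sigma>"
            using face[of a' x' b''] f sK \<rho> \<rho>V by auto
          then have "V \<tau> \<in> set \<sigma>" using out0[of \<sigma>] that by (auto simp: in_keys_iff)
          then have "x' = V \<tau>" using Vn f by auto
          then have "set \<sigma> = insert (V \<tau>) (set \<rho>)" using f by auto
          also have "\<dots> = set \<tau>" by (subst (2) t) (auto simp: \<rho>_def)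
          finally show False using set_inj[OF sK tK] False by simp
        qed
        then show ?thesis using False by simp
      qed
      then have "coef (bd z1) \<rho> = (\<Sum>\<sigma>\<in>supp z1. if \<sigma> = \<tau> then coef z1 \<tau> * (-1) ^ length a else 0)"
        by (simp add: lookup_linear_ext_keys)
      also have "\<dots> = coef z1 \<tau> * (-1) ^ length a" using nz by (simp add: in_keys_iff)
      finally show False using z1 nz by (simp add: cycles_def)
    qed
    have "\<forall>\<sigma> \<in> supp z1. \<mu> \<sigma> < M"
      using z1M crit0 out0 in0 by (metis in_keys_iff le_neq_implies_less)
    then show ?thesis using b c z1_def by blast
  qed
  have main: "\<exists>b c. b \<in> boundaries K k \<and> c \<in> ?C \<and> z = b + linear_ext \<zeta> c"
    if "z \<in> cycles K k" "\<forall>\<sigma> \<in> supp z. \<mu> \<sigma> < M" for M z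
    using that
  proof (induction M arbitrary: z)
    case 0
    then have "z = 0" by (simp add: keys_eq_empty[symmetric] del: keys_eq_empty)
    then show ?case
      using qvs.subspace_0[OF boundaries_subspace] qvs.subspace_0[OF subspace_free]
      by (intro exI[of _ 0]) auto
  next
    case (Suc M)
    obtain b c where bc: "b \<in> boundaries K k" "c \<in> ?C"
      "\<forall>\<sigma> \<in> supp (z - b - linear_ext \<zeta> c). \<mu> \<sigma> < M"
      using step[OF Suc.prems] by blast
    have kc: "\<sigma> \<in> simplices K k \<and> crit \<sigma>" if "\<sigma> \<in> supp c" for \<sigma>
      using that bc(2) by (auto simp: free_space_def)
    have "linear_ext \<zeta> c \<in> cycles K k"
      unfolding linear_ext_def using kc zeta
      by (intro qvs.subspace_sum[OF cycles_subspace] qvs.subspace_scale[OF cycles_subspace]) auto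
    then have "z - b - linear_ext \<zeta> c \<in> cycles K k"
      using Suc.prems bc boundaries_cycles[OF closed]
      by (intro qvs.subspace_diff[OF cycles_subspace]) auto
    from Suc.IH[OF this bc(3)] obtain b' c' where
      "b' \<in> boundaries K k" "c' \<in> ?C" "z - b - linear_ext \<zeta> c = b' + linear_ext \<zeta> c'" by blast
    then have "b + b' \<in> boundaries K k" "c + c' \<in> ?C" "z = (b + b') + linear_ext \<zeta> (c + c')"
      using bc qvs.subspace_add[OF boundaries_subspace] qvs.subspace_add[OF subspace_free]
      by (auto simp: linear_ext_add algebra_simps)
    then show ?case by blast
  qed
  show ?thesis
  \<comment> \<open>The element 0 keeps the maximum defined when \<open>z\<close> is zero.\<close>
  proof (rule main[OF z, of "Suc (Max (insert 0 (\<mu> ` supp z)))"])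
    show "\<forall>\<sigma>\<in>supp z. \<mu> \<sigma> < Suc (Max (insert 0 (\<mu> ` supp z)))"
      by (auto simp: less_Suc_eq_le)
  qed
qed

section \<open>The pairing of cohomology and homology\<close>

lemma evaluate_superset:
  assumes "finite S" "supp f \<subseteq> S"
  shows "evaluate \<phi> f = (\<Sum>x\<in>S. coef f x * \<phi> x)"
  unfolding evaluate_def using assms
  by (intro sum.mono_neutral_left) (auto simp: in_keys_iff)

lemma evaluate_add: "evaluate \<phi> (x + y) = evaluate \<phi> x + evaluate \<phi> y"
proof -
  let ?S = "supp x \<union> supp y"
  have "supp (x + y) \<subseteq> ?S" by (rule keys_add)
  then show ?thesis
    by (simp add: evaluate_superset[of ?S] lookup_add sum.distrib algebra_simps)
qed

lemma evaluate_qscale: "evaluate \<phi> (qscale c x) = c * evaluate \<phi> x"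
proof -
  have "supp (qscale c x) \<subseteq> supp x" by (auto simp: in_keys_iff)
  then show ?thesis
    by (simp add: evaluate_superset[of "supp x"] sum_distrib_left mult.assoc)
qed

lemma evaluate_zero [simp]: "evaluate \<phi> 0 = 0"
  by (simp add: evaluate_def)

lemma evaluate_diff: "evaluate \<phi> (x - y) = evaluate \<phi> x - evaluate \<phi> y"
  using evaluate_add[of \<phi> "x - y" y] by simp

lemma evaluate_sum: "evaluate \<phi> (\<Sum>i\<in>A. f i) = (\<Sum>i\<in>A. evaluate \<phi> (f i))"
  by (induction A rule: infinite_finite_induct) (auto simp: evaluate_add)

lemma evaluate_basis [simp]: "evaluate \<phi> (basis x) = \<phi> x"
  by (simp add: evaluate_def)

lemma evaluate_fun_add: "evaluate (\<lambda>x. \<phi> x + \<psi> x) c = evaluate \<phi> c + evaluate \<psi> c"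
  by (simp add: evaluate_def sum.distrib algebra_simps)

lemma evaluate_fun_smult: "evaluate (\<lambda>x. a * \<phi> x) c = a * evaluate \<phi> c"
  by (simp add: evaluate_def sum_distrib_left mult.left_commute)

lemma evaluate_fun_diff: "evaluate (\<lambda>x. \<phi> x - \<psi> x) c = evaluate \<phi> c - evaluate \<psi> c"
  by (simp add: evaluate_def sum_subtractf algebra_simps)

lemma evaluate_fun_zero [simp]: "evaluate (\<lambda>x. 0) c = 0"
  by (simp add: evaluate_def)

lemma evaluate_linear_ext: "evaluate \<phi> (linear_ext g c) = evaluate (\<lambda>x. evaluate \<phi> (g x)) c"
  by (simp add: linear_ext_def evaluate_sum evaluate_qscale) (simp add: evaluate_def)

lemma evaluate_cobd:
  assumes "c \<in> carrier (free_space (simplices K k))"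
  shows "evaluate (simplex_cobd K k \<phi>) c = evaluate \<phi> (bd c)"
  unfolding evaluate_linear_ext unfolding evaluate_def simplex_cobd_def using assms
  by (intro sum.cong) (auto simp: free_space_def)

lemma cobd_add: "simplex_cobd K k (\<lambda>x. \<phi> x + \<psi> x) = (\<lambda>x. simplex_cobd K k \<phi> x + simplex_cobd K k \<psi> x)"
  by (auto simp: simplex_cobd_def evaluate_fun_add)

lemma cobd_smult: "simplex_cobd K k (\<lambda>x. a * \<phi> x) = (\<lambda>x. a * simplex_cobd K k \<phi> x)"
  by (auto simp: simplex_cobd_def evaluate_fun_smult)

lemma fun_subspace_cocycles: "fun_subspace (cocycles K k)"
  by (auto simp: fun_subspace_def cocycles_def cobd_add cobd_smult dual_space_def)
    (auto simp: simplex_cobd_def)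

lemma fun_subspace_coboundaries: "fun_subspace (coboundaries K k)"
  unfolding fun_subspace_def coboundaries_def
proof (intro conjI ballI allI)
  let ?D = "carrier (dual_space (simplices K (k - 1)))"
  show "(\<lambda>_. 0) \<in> simplex_cobd K k ` ?D"
    by (intro image_eqI[of _ _ "\<lambda>_. 0"]) (auto simp: simplex_cobd_def dual_space_def)
  fix x assume "x \<in> simplex_cobd K k ` ?D"
  then obtain \<phi> where p: "\<phi> \<in> ?D" "x = simplex_cobd K k \<phi>" by auto
  show "(\<lambda>i. c * x i) \<in> simplex_cobd K k ` ?D" for c
    using p by (intro image_eqI[of _ _ "\<lambda>i. c * \<phi> i"]) (auto simp: cobd_smult dual_space_def)
  fix y assume "y \<in> simplex_cobd K k ` ?D"
  then obtain \<psi> where q: "\<psi> \<in> ?D" "y = simplex_cobd K k \<psi>" by auto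
  show "(\<lambda>i. x i + y i) \<in> simplex_cobd K k ` ?D"
    using p q by (intro image_eqI[of _ _ "\<lambda>i. \<phi> i + \<psi> i"]) (auto simp: cobd_add dual_space_def)
qed

lemma subquotient_cohomology:
  "subquotient (dual_space (simplices K k)) (cocycles K k) (coboundaries K k)"
  by (intro subquotient_dual fun_subspace_cocycles fun_subspace_coboundaries)
    (auto simp: cocycles_def coboundaries_def dual_space_def simplex_cobd_def)

lemma subquotient_homology:
  assumes "face_closed K"
  shows "subquotient (free_space (simplices K k)) (cycles K k) (boundaries K k)"
  using boundaries_cycles[OF assms, of k]
  by (intro subquotient_free cycles_subspace boundaries_subspace) (auto simp: cycles_def)

lemma evaluate_cocycle_boundary:
  assumes "\<phi> \<in> cocycles K k" "b \<in> boundaries K k"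
  shows "evaluate \<phi> b = 0"
proof -
  obtain w where w: "w \<in> carrier (free_space (simplices K (k + 1)))" "b = bd w"
    using assms by (auto simp: boundaries_def)
  then have "evaluate \<phi> b = evaluate (simplex_cobd K (k + 1) \<phi>) w" by (simp add: evaluate_cobd)
  then show ?thesis using assms by (simp add: cocycles_def)
qed

lemma cocyclesI:
  assumes "\<phi> \<in> carrier (dual_space (simplices K k))" "\<And>b. b \<in> boundaries K k \<Longrightarrow> evaluate \<phi> b = 0"
  shows "\<phi> \<in> cocycles K k"
proof -
  have "simplex_cobd K (k + 1) \<phi> \<sigma> = 0" for \<sigma>
  proof (cases "\<sigma> \<in> simplices K (k + 1)")
    case True
    then have "bd (basis \<sigma>) \<in> boundaries K k" unfolding boundaries_def
      by (intro imageI) (simp add: free_space_def)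
    then show ?thesis using assms(2) True by (simp add: simplex_cobd_def)
  qed (simp add: simplex_cobd_def)
  then show ?thesis using assms(1) by (auto simp: cocycles_def)
qed

lemma evaluate_coboundary_cycle:
  assumes "\<phi> \<in> coboundaries K k" "z \<in> cycles K k"
  shows "evaluate \<phi> z = 0"
proof -
  obtain \<psi> where "\<phi> = simplex_cobd K k \<psi>" using assms by (auto simp: coboundaries_def)
  then show ?thesis using assms(2) by (simp add: cycles_def evaluate_cobd)
qed

text \<open>A cochain vanishing on cycles factors through the boundary operator, by means of a linear
  right inverse of the latter.\<close>

lemma coboundariesI:
  assumes K: "face_closed K" and \<phi>: "\<phi> \<in> carrier (dual_space (simplices K k))"
    and van: "\<And>z. z \<in> cycles K k \<Longrightarrow> evaluate \<phi> z = 0"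
  shows "\<phi> \<in> coboundaries K k"
proof -
  let ?C = "carrier (free_space (simplices K k))"
  obtain g where g: "range g \<subseteq> ?C" "Vector_Spaces.linear qscale qscale g"
      "\<And>x. x \<in> bd ` ?C \<Longrightarrow> bd (g x) = x"
    using lin.linear_exists_right_inverse_on[OF linear_linear_ext subspace_free] by blast
  define \<psi> where "\<psi> \<tau> = (if \<tau> \<in> simplices K (k - 1) then evaluate \<phi> (g (basis \<tau>)) else 0)" for \<tau>
  have "simplex_cobd K k \<psi> \<sigma> = \<phi> \<sigma>" for \<sigma>
  proof (cases "\<sigma> \<in> simplices K k")
    case True
    let ?b = "bd (basis \<sigma>)"
    have s: "basis \<sigma> \<in> ?C" using True by (simp add: free_space_def)
    have "?b \<in> carrier (free_space (simplices K (k - 1)))" by (rule bd_in_chains[OF K s])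
    then have "evaluate \<psi> ?b = evaluate (\<lambda>\<tau>. evaluate \<phi> (g (basis \<tau>))) ?b"
      unfolding evaluate_def \<psi>_def by (intro sum.cong) (auto simp: free_space_def)
    also have "\<dots> = evaluate \<phi> (g ?b)"
      unfolding linear_ext_linear[OF g(2), of ?b] by (simp only: evaluate_linear_ext)
    \<comment> \<open>\<open>g ?b\<close> and \<open>basis \<sigma>\<close> have the same boundary,
      and \<open>\<phi>\<close> vanishes on their difference, which is a cycle.\<close>
    also have "\<dots> = evaluate \<phi> (basis \<sigma>)"
    proof -
      have "g ?b \<in> ?C" using g(1) by auto
      then have "g ?b - basis \<sigma> \<in> ?C" using s by (intro qvs.subspace_diff[OF subspace_free])
      moreover have "bd (g ?b - basis \<sigma>) = 0" using g(3)[OF imageI, OF s] by (simp add: linear_ext_diff)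
      ultimately have "evaluate \<phi> (g ?b - basis \<sigma>) = 0" by (intro van) (simp add: cycles_def)
      then show ?thesis by (simp add: evaluate_diff)
    qed
    finally show ?thesis using True by (simp add: simplex_cobd_def)
  qed (use \<phi> in \<open>simp add: simplex_cobd_def dual_space_def\<close>)
  then have "\<phi> = simplex_cobd K k \<psi>" by auto
  moreover have "\<psi> \<in> carrier (dual_space (simplices K (k - 1)))" by (simp add: \<psi>_def dual_space_def)
  ultimately show ?thesis unfolding coboundaries_def by blast
qed

text \<open>Coboundaries vanish on cycles and cocycles on boundaries, so the set of values in
  \<open>kronecker\<close> is a singleton and \<open>the_elem\<close> is meaningful.\<close>

lemma kronecker_cosets:
  assumes K: "face_closed K" and "\<phi> \<in> cocycles K k" "z \<in> cycles K k"
  shows "kronecker (coboundaries K k +>\<^bsub>dual_space (simplices K k)\<^esub> \<phi>) (homology_class K k z) = evaluate \<phi> z"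
proof -
  let ?X = "coboundaries K k +>\<^bsub>dual_space (simplices K k)\<^esub> \<phi>"
  have ev: "evaluate \<phi>' c = evaluate \<phi> z" if in_cosets: "\<phi>' \<in> ?X" "c \<in> homology_class K k z" for \<phi>' c
  proof -
    obtain \<psi> where p: "\<psi> \<in> coboundaries K k" "\<phi>' = (\<lambda>x. \<psi> x + \<phi> x)"
      using in_cosets(1) unfolding a_r_coset_def' by (auto simp: dual_space_def)
    obtain b where b: "b \<in> boundaries K k" "c = b + z"
      using in_cosets(2) unfolding homology_class_def a_r_coset_def' by auto
    have "b \<in> cycles K k" using boundaries_cycles[OF K] b by auto
    then show ?thesis using assms b p
      by (simp add: evaluate_fun_add evaluate_add evaluate_coboundary_cycle evaluate_cocycle_boundary)
  qed
  have m1: "(\<lambda>x. 0 + \<phi> x) \<in> ?X"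
    using fun_subspace_coboundaries[of K k] unfolding a_r_coset_def' fun_subspace_def
    by (intro UN_I[of "\<lambda>_. 0"]) (simp_all add: dual_space_def)
  have m2: "0 + z \<in> homology_class K k z"
    using qvs.subspace_0[OF boundaries_subspace] unfolding homology_class_def a_r_coset_def' by auto
  let ?E = "{evaluate \<phi>' c | \<phi>' c. \<phi>' \<in> ?X \<and> c \<in> homology_class K k z}"
  have "\<exists>\<phi>' c. evaluate \<phi> z = evaluate \<phi>' c \<and> \<phi>' \<in> ?X \<and> c \<in> homology_class K k z"
    by (intro exI conjI, rule ev[OF m1 m2, symmetric], rule m1, rule m2)
  then have "{evaluate \<phi> z} \<subseteq> ?E" by simp
  moreover have "?E \<subseteq> {evaluate \<phi> z}" using ev by blast
  ultimately have "?E = {evaluate \<phi> z}" by (rule equalityI[rotated])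
  then show ?thesis by (simp add: kronecker_def)
qed

text \<open>A cocycle vanishes on boundaries, hence here on all cycles, and so is a coboundary by
  \<open>coboundariesI\<close>.\<close>

lemma cohomology_trivial:
  assumes "face_closed K" "cycles K k \<subseteq> boundaries K k"
  shows "carrier (red_cohomology K k) = {\<zero>\<^bsub>red_cohomology K k\<^esub>}"
  unfolding red_cohomology_def
proof (rule subquotient.carrier_trivial[OF subquotient_cohomology], rule subsetI)
  fix \<phi> assume "\<phi> \<in> cocycles K k"
  moreover from this have "\<phi> \<in> carrier (dual_space (simplices K k))" by (simp add: cocycles_def)
  ultimately show "\<phi> \<in> coboundaries K k"
    using assms evaluate_cocycle_boundary by (intro coboundariesI) blast+
qed

section \<open>Words, descents and chains of signed sets\<close>

abbreviation lless :: "int list \<Rightarrow> int list \<Rightarrow> bool" (infix "\<lless>" 50) where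
  "y \<lless> z \<equiv> (y, z) \<in> lexord {(a, b). a < b}"

lemma lless_trans: "x \<lless> y \<Longrightarrow> y \<lless> z \<Longrightarrow> x \<lless> z"
  by (rule lexord_trans) (auto simp: trans_def)

lemma lless_irrefl: "\<not> x \<lless> x"
  by (simp add: lexord_irreflexive)

lemma lless_linear: "x \<lless> y \<or> x = y \<or> y \<lless> x"
  by (rule lexord_linear) auto

lemma llessI: "p < length y \<Longrightarrow> p < length z \<Longrightarrow> take p y = take p z \<Longrightarrow> y ! p < z ! p \<Longrightarrow> y \<lless> z"
  by (auto simp: lexord_take_index_conv)

lemma llessE:
  assumes "y \<lless> z" "length y = length z"
  obtains p where "p < length y" "take p y = take p z" "y ! p < z ! p"
  using assms by (auto simp: lexord_take_index_conv)

text \<open>Descents, with the convention that the word is followed by the letter \<open>0\<close>.\<close>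

definition Des :: "int list \<Rightarrow> nat set" where
  "Des y = {t \<in> {1..length y}. (y @ [0]) ! t < (y @ [0]) ! (t - 1)}"

text \<open>In the Coxeter complex of type B: the face \<open>\<sigma>\<close> belongs to the
  chamber of \<open>y\<close>, whose vertices are the sets of first letters of
  \<open>y\<close>.\<close>

definition compat :: "int list \<Rightarrow> int set list \<Rightarrow> bool" where
  "compat y \<sigma> \<longleftrightarrow> (\<forall>F \<in> set \<sigma>. set (take (card F) y) = F)"

definition sset :: "int set \<Rightarrow> int set \<Rightarrow> bool" where
  "sset I F \<longleftrightarrow> abs ` F \<subseteq> I \<and> inj_on abs F"

lemma map_the_map_of_zip:
  assumes "distinct l" "length w = length l"
  shows "map (\<lambda>i. the (map_of (zip l w) i)) l = w"
  using assms by (intro nth_equalityI) (auto simp: map_of_zip_nth)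

locale index_set =
  fixes n :: nat and I :: "int set"
  assumes I_sub: "I \<subseteq> {1..int n}"
begin

abbreviation "r \<equiv> card I"

lemma fin_I: "finite I" using I_sub finite_subset by blast

lemma I_pos: "i \<in> I \<Longrightarrow> 0 < i" using I_sub by auto

lemma SB_iff: "w \<in> SB I \<longleftrightarrow> length w = r \<and> distinct (map abs w) \<and> abs ` set w \<subseteq> I"
proof
  let ?l = "sorted_list_of_set I"
  have l: "distinct ?l" "set ?l = I" "length ?l = r" using fin_I by auto
  {
    assume "w \<in> SB I"
    then obtain x where x: "x \<in> signed_perms I" "w = map x ?l" by (auto simp: SB_def)
    have "inj_on (abs \<circ> x) I" using x(1) by (force simp: signed_perms_def inj_on_def)
    then show "length w = r \<and> distinct (map abs w) \<and> abs ` set w \<subseteq> I"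
      using x l by (auto simp: distinct_map signed_perms_def comp_inj_on_iff)
  }
  assume w: "length w = r \<and> distinct (map abs w) \<and> abs ` set w \<subseteq> I"
  define x where "x = restrict (\<lambda>i. the (map_of (zip ?l w) i)) I"
  have "map x ?l = map (\<lambda>i. the (map_of (zip ?l w) i)) ?l" using l by (auto simp: x_def)
  also have "\<dots> = w" using w l by (intro map_the_map_of_zip) auto
  finally have xw: "map x ?l = w" .
  have "distinct (map (abs \<circ> x) ?l)" using w xw by (metis map_map)
  then have "inj_on (abs \<circ> x) I" using l by (simp add: distinct_map)
  moreover have "abs ` x ` I \<subseteq> I" using w xw l by (metis set_map)
  moreover have "x \<in> extensional I" by (simp add: x_def)
  ultimately have "x \<in> signed_perms I" by (force simp: signed_perms_def inj_on_def)
  then show "w \<in> SB I" using xw by (force simp: SB_def)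
qed

lemma abs_SB: "w \<in> SB I \<Longrightarrow> abs ` set w = I"
  using fin_I distinct_card[of "map abs w"] by (intro card_subset_eq) (auto simp: SB_iff)

lemma finite_SB: "finite (SB I)"
proof (rule finite_subset)
  show "SB I \<subseteq> {w. set w \<subseteq> {- int n..int n} \<and> length w = r}"
    using I_sub by (force simp: SB_iff)
qed (simp add: finite_lists_length_eq)

lemma SB_mset: "y \<in> SB I \<Longrightarrow> mset y' = mset y \<Longrightarrow> y' \<in> SB I"
  using mset_eq_imp_distinct_iff[of "map abs y'" "map abs y"]
  by (auto simp: SB_iff dest: mset_eq_setD mset_eq_length)

lemma SB_abs: "y \<in> SB I \<Longrightarrow> map abs y' = map abs y \<Longrightarrow> y' \<in> SB I"
  unfolding SB_iff by (metis length_map set_map)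

lemma SB_distinct: "y \<in> SB I \<Longrightarrow> distinct y"
  by (auto simp: SB_iff distinct_map)

lemma SB_abs_nth: "y \<in> SB I \<Longrightarrow> i < r \<Longrightarrow> j < r \<Longrightarrow> \<bar>y ! i\<bar> = \<bar>y ! j\<bar> \<Longrightarrow> i = j"
  using nth_eq_iff_index_eq[of "map abs y" i j] by (simp add: SB_iff)

lemma SB_nz: "y \<in> SB I \<Longrightarrow> a \<in> set y \<Longrightarrow> a \<noteq> 0"
  using I_pos by (force simp: SB_iff)

lemma SB_length: "y \<in> SB I \<Longrightarrow> length y = r" by (simp add: SB_iff)

text \<open>The lexicographic order as a natural number: a level for the Morse reduction and a
  measure for the inductions.\<close>

definition rk :: "int list \<Rightarrow> nat" where "rk y = card {z \<in> SB I. z \<lless> y}"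

lemma rk_mono: "y \<in> SB I \<Longrightarrow> y \<lless> z \<Longrightarrow> rk y < rk z"
proof -
  assume "y \<in> SB I" "y \<lless> z"
  then have "{x \<in> SB I. x \<lless> y} \<subseteq> {x \<in> SB I. x \<lless> z}" "y \<in> {x \<in> SB I. x \<lless> z}"
    "y \<notin> {x \<in> SB I. x \<lless> y}"
    using lless_trans lless_irrefl by blast+
  then show ?thesis unfolding rk_def using finite_SB by (intro psubset_card_mono) auto
qed

lemma rk_le: "rk y \<le> card (SB I)"
  unfolding rk_def by (intro card_mono finite_SB) auto

text \<open>Between two member sizes \<open>y\<close> has no descent, so it lists each new portion
  of letters in increasing order, the least possible. After the last member the appended 0 forces
  the remaining letters to be negative, the least choice of signs.\<close>

lemma compat_minimal:
  assumes y: "y \<in> SB I" and z: "z \<in> SB I" and cy: "compat y \<sigma>" and cz: "compat z \<sigma>"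
    and des: "Des y \<subseteq> card ` set \<sigma>" and ne: "y \<noteq> z"
  shows "y \<lless> z"
proof (rule ccontr)
  assume "\<not> y \<lless> z"
  then have "z \<lless> y" using ne lless_linear by blast
  then obtain p where p: "p < length z" "take p z = take p y" "z ! p < y ! p"
    using y z by (elim llessE) (auto simp: SB_iff)
  have ly: "length y = r" "length z = r" using y z by (auto simp: SB_iff)
  define Y where "Y = y @ [0]"
  have Yy: "Y ! i = y ! i" if "i < r" for i using that ly by (simp add: Y_def nth_append)
  have Yr: "Y ! r = 0" using ly by (simp add: Y_def nth_append)
  have inc: "Y ! i \<le> Y ! q" if "i \<le> q" "q \<le> r" "\<And>t. t \<in> card ` set \<sigma> \<Longrightarrow> i < t \<Longrightarrow> t \<le> q \<Longrightarrow> False" for i q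
    using that
  proof (induction q rule: dec_induct)
    case base
    show ?case by (rule order_refl)
  next
    case (step q)
    have "Suc q \<notin> card ` set \<sigma>" using step.prems(2)[of "Suc q"] step.hyps by auto
    then have "Suc q \<notin> Des y" using des by blast
    then have "Y ! q \<le> Y ! Suc q" using step(4) ly by (simp add: Des_def Y_def)
    moreover have "Y ! i \<le> Y ! q"
      using step.prems(1) le_SucI[of _ q] by (intro step.IH) (auto intro: step.prems(2))
    ultimately show ?case by linarith
  qed
  have eqp: "y ! i = z ! i" if "i < p" for i
    using p(2) that nth_take[of i p y] nth_take[of i p z] by simp
  show False
  proof (cases "\<exists>t \<in> card ` set \<sigma>. p < t")
    \<comment> \<open>Both words have the same letters up to the next member size \<open>t\<close>.
      So \<open>z ! p\<close> stands in \<open>y\<close> at a place from \<open>p\<close> to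
      \<open>t - 1\<close>, where no letter is below \<open>y ! p\<close>.\<close>
    case True
    define t where "t = (LEAST t. t \<in> card ` set \<sigma> \<and> p < t)"
    have t: "t \<in> card ` set \<sigma>" "p < t" using LeastI_ex[of "\<lambda>t. t \<in> card ` set \<sigma> \<and> p < t"] True
      by (auto simp: t_def)
    have tmin: "s \<in> card ` set \<sigma> \<Longrightarrow> p < s \<Longrightarrow> t \<le> s" for s
      unfolding t_def by (rule Least_le) simp
    obtain F where F: "F \<in> set \<sigma>" "t = card F" using t by auto
    have Fe: "F = set (take t y)" "F = set (take t z)" using F cy cz by (auto simp: compat_def)
    have "z ! p \<in> set (take t z)"
      using t(2) p(1) by (metis in_set_conv_nth length_take min_less_iff_conj nth_take)
    then have "z ! p \<in> set (take t y)" using Fe by simp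
    then obtain i where i: "i < t" "i < r" "z ! p = y ! i"
      using ly by (auto simp: in_set_conv_nth)
    have "p \<le> i"
    proof (rule ccontr)
      assume "\<not> p \<le> i"
      then have "z ! p = z ! i" using i eqp by simp
      then show False using \<open>\<not> p \<le> i\<close> SB_distinct[OF z] p ly by (simp add: nth_eq_iff_index_eq)
    qed
    then have "Y ! p \<le> Y ! i" using i tmin by (intro inc) (blast, linarith, fastforce)
    then show False using i p ly by (simp add: Yy)
  next
    case False
    \<comment> \<open>Only absolute values can be compared beyond the last member. There
      \<open>y ! p \<le> y ! i \<le> 0\<close>, so no letter of absolute value
      \<open>\<bar>y ! i\<bar>\<close> is below \<open>y ! p\<close>.\<close>
    have "\<bar>z ! p\<bar> \<in> abs ` set y" using abs_SB[OF y] abs_SB[OF z] p by auto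
    then obtain i where i: "i < r" "\<bar>z ! p\<bar> = \<bar>y ! i\<bar>" using ly by (auto simp: in_set_conv_nth)
    have "p \<le> i"
    proof (rule ccontr)
      assume "\<not> p \<le> i"
      then have "\<bar>z ! p\<bar> = \<bar>z ! i\<bar>" using i eqp by simp
      then show False using \<open>\<not> p \<le> i\<close> SB_abs_nth[OF z _ i(1), of p] p ly by simp
    qed
    moreover have "Y ! p \<le> Y ! i"
      using \<open>p \<le> i\<close> i False by (intro inc) (blast, linarith, blast)
    moreover have "Y ! i \<le> Y ! r"
      using \<open>p \<le> i\<close> i False by (intro inc) (linarith, blast, metis le_less_trans)
    ultimately have "y ! p \<le> y ! i" "y ! i \<le> 0" using i(1) p(1) ly(2) by (simp_all only: Yy Yr)
    then show False using i(2) p(3) by arith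
  qed
qed

text \<open>The simple reflection at \<open>t\<close>, which exchanges the letters around
  \<open>t\<close> or negates the last one if \<open>t = r\<close>, affects only the prefix set of
  size \<open>t\<close>; undoing a descent lowers the word.\<close>

lemma compat_reduce:
  assumes y: "y \<in> SB I" and c: "compat y \<sigma>" and t: "t \<in> Des y" "t \<notin> card ` set \<sigma>"
  shows "\<exists>y' \<in> SB I. compat y' \<sigma> \<and> y' \<lless> y"
proof -
  have ly: "length y = r" using y by (simp add: SB_iff)
  have t1: "1 \<le> t" "t \<le> r" "(y @ [0]) ! t < (y @ [0]) ! (t - 1)" using t(1) ly by (auto simp: Des_def)
  \<comment> \<open>Negating the last letter alters every prefix of length at least
    \<open>r\<close>, so sizes beyond \<open>r\<close> have to be ruled out.\<close>
  have cF: "card F \<le> r" if "F \<in> set \<sigma>" for F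
  proof -
    have "card F = card (set (take (card F) y))" using c that by (simp add: compat_def)
    also have "\<dots> \<le> length (take (card F) y)" by (rule card_length)
    finally show ?thesis using ly by simp
  qed
  show ?thesis
  proof (cases "t < r")
    case True
    define y' where "y' = y[t := y ! (t - 1), t - 1 := y ! t]"
    have "t - 1 < length y" "t < length y" using t1 True ly by linarith+
    then have lt: "y ! t < y ! (t - 1)" using t1(3) by (simp only: nth_append_left)
    have "mset y' = mset y" unfolding y'_def using t1 True ly by (intro mset_swap) auto
    then have "y' \<in> SB I" by (rule SB_mset[OF y])
    moreover have "set (take s y') = set (take s y)" if "s \<noteq> t" for s
    proof (cases "s < t")
      case True
      then show ?thesis by (simp add: y'_def)
    next
      case False
      then have "take s y' = (take s y)[t := take s y ! (t - 1), t - 1 := take s y ! t]"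
        using that by (simp add: y'_def take_update_swap)
      also have "set \<dots> = set (take s y)" using False that t1 True ly by (intro set_swap) auto
      finally show ?thesis .
    qed
    then have "compat y' \<sigma>" using c t(2) unfolding compat_def by (metis image_eqI)
    moreover have "y' \<lless> y"
      by (rule llessI[of "t - 1"]) (use t1 True ly lt in \<open>auto simp: y'_def\<close>)
    ultimately show ?thesis by blast
  next
    case False
    then have tr: "t = r" using t1 by simp
    define y' where "y' = y[t - 1 := - y ! (t - 1)]"
    have "t - 1 < length y" "(y @ [0]) ! t = 0" using t1 tr ly by (linarith, simp add: nth_append)
    then have gt: "0 < y ! (t - 1)" using t1(3) by (simp only: nth_append_left)
    have "map abs y' = map abs y"
    proof (rule nth_equalityI)
      fix i assume "i < length (map abs y')"
      then show "map abs y' ! i = map abs y ! i"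
        by (cases "i = t - 1") (simp_all add: y'_def)
    qed (simp add: y'_def)
    then have "y' \<in> SB I" by (rule SB_abs[OF y])
    moreover have "set (take s y') = set (take s y)" if "s \<noteq> t" "s \<le> r" for s
      using that tr by (simp add: y'_def)
    then have "compat y' \<sigma>" using c t(2) cF unfolding compat_def by (metis image_eqI)
    moreover have "y' \<lless> y"
      by (rule llessI[of "t - 1"]) (use t1 tr ly gt in \<open>auto simp: y'_def\<close>)
    ultimately show ?thesis by blast
  qed
qed

lemma compat_extend:
  assumes "sorted_wrt (\<subset>) \<sigma>" "\<And>F. F \<in> set \<sigma> \<Longrightarrow> F \<subseteq> U" "finite U"
  shows "\<exists>y. distinct y \<and> set y = U \<and> compat y \<sigma>"
  using assms
proof (induction \<sigma> arbitrary: U rule: rev_induct)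
  case Nil
  then show ?case using finite_distinct_list[of U] by (auto simp: compat_def)
next
  case (snoc L \<sigma>)
  have L: "L \<subseteq> U" "finite L" using snoc.prems finite_subset[of L U] by auto
  have "\<And>F. F \<in> set \<sigma> \<Longrightarrow> F \<subset> L" using snoc.prems(1) by (simp add: sorted_wrt_append)
  then obtain y0 where y0: "distinct y0" "set y0 = L" "compat y0 \<sigma>"
    using snoc.IH[of L] snoc.prems(1) L by (auto simp: sorted_wrt_append)
  obtain l where l: "distinct l" "set l = U - L" using finite_distinct_list[of "U - L"] snoc.prems by auto
  have len: "card F \<le> length y0" if "F \<in> set \<sigma>" for F
    using y0(1,2) \<open>\<And>F. F \<in> set \<sigma> \<Longrightarrow> F \<subset> L\<close>[OF that] L(2)
    by (metis card_mono distinct_card psubset_imp_subset)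
  have "compat (y0 @ l) (\<sigma> @ [L])"
    using y0 len distinct_card[OF y0(1)] by (auto simp: compat_def)
  then show ?case using y0 l L by (intro exI[of _ "y0 @ l"]) auto
qed

lemma finite_sset: "sset I F \<Longrightarrow> finite F"
  using fin_I finite_image_iff finite_subset unfolding sset_def by metis

lemma compat_exists:
  assumes "sorted_wrt (\<subset>) \<sigma>" "\<And>F. F \<in> set \<sigma> \<Longrightarrow> sset I F"
  shows "\<exists>y \<in> SB I. compat y \<sigma>"
proof -
  define L where "L = (if \<sigma> = [] then {} else last \<sigma>)"
  have L: "sset I L" using assms(2) by (auto simp: L_def sset_def)
  have FL: "F \<subseteq> L" if "F \<in> set \<sigma>" for F
  proof -
    have "\<sigma> = butlast \<sigma> @ [last \<sigma>]" using that by (cases \<sigma>) auto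
    then have "sorted_wrt (\<subset>) (butlast \<sigma> @ [last \<sigma>])" "F \<in> set (butlast \<sigma> @ [last \<sigma>])"
      using assms(1) that by simp_all
    then have "F = last \<sigma> \<or> F \<subset> last \<sigma>" unfolding sorted_wrt_append by auto
    then show ?thesis using that by (auto simp: L_def)
  qed
  \<comment> \<open>Absolute values missing from the largest member enter with positive
    sign.\<close>
  define U where "U = L \<union> (I - abs ` L)"
  have "inj_on abs U" using L I_pos unfolding U_def sset_def inj_on_Un
    by (auto simp: inj_on_def abs_of_pos)
  moreover have "abs ` (I - abs ` L) = I - abs ` L" using I_pos by (force simp: image_iff)
  then have "abs ` U = I" using L unfolding U_def sset_def image_Un by blast
  moreover have finU: "finite U" using L fin_I finite_sset by (auto simp: U_def)
  moreover obtain y where y: "distinct y" "set y = U" "compat y \<sigma>"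
    using compat_extend[OF assms(1) _ finU] FL by (auto simp: U_def)
  ultimately have "y \<in> SB I"
    by (auto simp: SB_iff distinct_map card_image distinct_card[symmetric])
  then show ?thesis using y by blast
qed

text \<open>Singled out by its descents, not as a minimum: \<open>lab_unique\<close> then recognises
  the label without comparing words, and \<open>lab_le\<close> recovers minimality.\<close>

definition lab :: "int set list \<Rightarrow> int list" where
  "lab \<sigma> = (SOME y. y \<in> SB I \<and> compat y \<sigma> \<and> Des y \<subseteq> card ` set \<sigma>)"

lemma lab:
  assumes "sorted_wrt (\<subset>) \<sigma>" "\<And>F. F \<in> set \<sigma> \<Longrightarrow> sset I F"
  shows "lab \<sigma> \<in> SB I" "compat (lab \<sigma>) \<sigma>" "Des (lab \<sigma>) \<subseteq> card ` set \<sigma>"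
proof -
  have "\<exists>y. y \<in> SB I \<and> compat y \<sigma>" using compat_exists[OF assms] by blast
  \<comment> \<open>A compatible word of least rank; a descent at any other place could be removed
    by \<open>compat_reduce\<close>.\<close>
  then obtain y where y: "y \<in> SB I \<and> compat y \<sigma>" "\<And>z. z \<in> SB I \<and> compat z \<sigma> \<Longrightarrow> rk y \<le> rk z"
    using ex_has_least_nat[of "\<lambda>y. y \<in> SB I \<and> compat y \<sigma>" _ rk] by blast
  have "Des y \<subseteq> card ` set \<sigma>"
  proof (rule ccontr)
    assume "\<not> Des y \<subseteq> card ` set \<sigma>"
    then obtain t where "t \<in> Des y" "t \<notin> card ` set \<sigma>" by auto
    then obtain y' where "y' \<in> SB I" "compat y' \<sigma>" "y' \<lless> y" using compat_reduce y(1) by blast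
    then show False using y(2)[of y'] rk_mono[of y' y] by simp
  qed
  then have "lab \<sigma> \<in> SB I \<and> compat (lab \<sigma>) \<sigma> \<and> Des (lab \<sigma>) \<subseteq> card ` set \<sigma>"
    unfolding lab_def using y(1)
    by (intro someI[of "\<lambda>y. y \<in> SB I \<and> compat y \<sigma> \<and> Des y \<subseteq> card ` set \<sigma>" y]) blast
  then show "lab \<sigma> \<in> SB I" "compat (lab \<sigma>) \<sigma>" "Des (lab \<sigma>) \<subseteq> card ` set \<sigma>" by auto
qed

lemma lab_unique:
  assumes "y \<in> SB I" "compat y \<sigma>" "Des y \<subseteq> card ` set \<sigma>"
  shows "lab \<sigma> = y"
proof -
  have l: "lab \<sigma> \<in> SB I \<and> compat (lab \<sigma>) \<sigma> \<and> Des (lab \<sigma>) \<subseteq> card ` set \<sigma>"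
    unfolding lab_def using assms
    by (intro someI[of "\<lambda>y. y \<in> SB I \<and> compat y \<sigma> \<and> Des y \<subseteq> card ` set \<sigma>" y]) blast
  show ?thesis
    using compat_minimal[of y "lab \<sigma>" \<sigma>] compat_minimal[of "lab \<sigma>" y \<sigma>] l assms
      lless_trans lless_irrefl by blast
qed

lemma lab_le:
  assumes "sorted_wrt (\<subset>) \<sigma>" "\<And>F. F \<in> set \<sigma> \<Longrightarrow> sset I F" "y \<in> SB I" "compat y \<sigma>"
  shows "lab \<sigma> = y \<or> lab \<sigma> \<lless> y"
  using compat_minimal[of "lab \<sigma>" y \<sigma>] lab[OF assms(1,2)] assms by blast

lemma compat_subset: "compat y \<sigma> \<Longrightarrow> set \<tau> \<subseteq> set \<sigma> \<Longrightarrow> compat y \<tau>"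
  by (auto simp: compat_def)

lemma sset_take: "y \<in> SB I \<Longrightarrow> sset I (set (take t y))"
  unfolding sset_def SB_iff distinct_map using set_take_subset[of t y]
  by (blast intro: inj_on_subset)

lemma card_take: "y \<in> SB I \<Longrightarrow> t \<le> r \<Longrightarrow> card (set (take t y)) = t"
  using distinct_card[of "take t y"] SB_distinct[of y] SB_length[of y] by simp

end

section \<open>The Morse matching on the odd complexes\<close>

lemma insert_comparable:
  assumes "sorted_wrt (\<subset>) \<sigma>" "\<And>L. L \<in> set \<sigma> \<Longrightarrow> L \<subset> x \<or> x \<subset> L"
  shows "\<exists>a b. \<sigma> = a @ b \<and> sorted_wrt (\<subset>) (a @ x # b)"
proof (intro exI conjI)
  let ?P = "\<lambda>L. L \<subset> x"
  show "\<sigma> = takeWhile ?P \<sigma> @ dropWhile ?P \<sigma>" by simp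
  have s: "sorted_wrt (\<subset>) (takeWhile ?P \<sigma> @ dropWhile ?P \<sigma>)" using assms(1) by simp
  have t: "L \<subset> x" if "L \<in> set (takeWhile ?P \<sigma>)" for L using set_takeWhileD[OF that] by simp
  have d: "x \<subset> L" if "L \<in> set (dropWhile ?P \<sigma>)" for L
  proof (cases "dropWhile ?P \<sigma>")
    case (Cons M \<tau>)
    then have "\<not> M \<subset> x" using hd_dropWhile[of ?P \<sigma>] by simp
    moreover have "M \<in> set (dropWhile ?P \<sigma>)" unfolding Cons by simp
    then have "M \<in> set \<sigma>" by (rule set_dropWhileD)
    ultimately have "x \<subset> M" using assms(2) by blast
    moreover have "M \<subset> L \<or> L = M" using s Cons that by (auto simp: sorted_wrt_append)
    ultimately show ?thesis by auto
  next
    case Nil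
    then show ?thesis using that unfolding Nil by simp
  qed
  show "sorted_wrt (\<subset>) (takeWhile ?P \<sigma> @ x # dropWhile ?P \<sigma>)"
    using s t d by (auto simp: sorted_wrt_append)
qed

lemma sorted_psubset_distinct:
  fixes \<sigma> :: "'a set list"
  shows "sorted_wrt (\<subset>) \<sigma> \<Longrightarrow> distinct \<sigma>"
  by (induction \<sigma>) auto

lemma sorted_psubset_unique:
  fixes \<sigma> \<tau> :: "'a set list"
  assumes "sorted_wrt (\<subset>) \<sigma>" "sorted_wrt (\<subset>) \<tau>" "set \<sigma> = set \<tau>"
  shows "\<sigma> = \<tau>"
  using assms
proof (induction \<sigma> arbitrary: \<tau>)
  case (Cons x \<sigma>)
  from Cons.prems(3) obtain y \<tau>' where \<tau>: "\<tau> = y # \<tau>'" by (cases \<tau>) auto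
  have "x = y"
  proof (rule ccontr)
    assume ne: "x \<noteq> y"
    then have "x \<in> set \<tau>'" "y \<in> set \<sigma>" using Cons.prems \<tau> by auto
    then have "y \<subset> x" "x \<subset> y" using Cons.prems \<tau> by auto
    then show False by auto
  qed
  moreover have "x \<notin> set \<sigma>" "y \<notin> set \<tau>'" using Cons.prems \<tau> by auto
  moreover have "insert x (set \<sigma>) = insert y (set \<tau>')" using Cons.prems(3) \<tau> by simp
  ultimately have "set \<sigma> = set \<tau>'" by (metis insert_ident)
  then have "\<sigma> = \<tau>'" using Cons.IH[of \<tau>'] Cons.prems \<tau> by simp
  then show ?case using \<open>x = y\<close> \<tau> by simp
qed simp

context index_set
begin

abbreviation "K \<equiv> KB_sub n I"

text \<open>Monotone, idempotent and below the identity: a retraction of the poset of vertices onto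
  those inside \<open>\<plusminus>I\<close>, preserving the parity that defines
  \<open>KB_sub\<close>.\<close>

definition trace :: "int set \<Rightarrow> int set" where "trace L = {i \<in> L. \<bar>i\<bar> \<in> I}"

definition vert :: "int set \<Rightarrow> bool" where
  "vert L \<longleftrightarrow> L \<in> KB_vertices n \<and> odd (card (trace L))"

definition T :: "nat set" where "T = {t. odd t \<and> t \<le> r}"

lemma inj_abs_vertex: "L \<in> KB_vertices n \<Longrightarrow> inj_on abs L"
  unfolding KB_vertices_def inj_on_def by (auto simp: abs_eq_iff)

lemma card_trace:
  assumes "L \<in> KB_vertices n"
  shows "card {i \<in> I. i \<in> L \<or> - i \<in> L} = card (trace L)"
proof -
  have "{i \<in> I. i \<in> L \<or> - i \<in> L} = abs ` trace L"
  proof (intro equalityI subsetI)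
    fix i assume i: "i \<in> {i \<in> I. i \<in> L \<or> - i \<in> L}"
    then have "0 < i" using I_pos by auto
    then have "i = \<bar>i\<bar>" "i = \<bar>- i\<bar>" by auto
    moreover have "i \<in> trace L \<or> - i \<in> trace L" using i \<open>0 < i\<close> by (auto simp: trace_def)
    ultimately show "i \<in> abs ` trace L" by blast
  next
    fix i assume "i \<in> abs ` trace L"
    then obtain j where "j \<in> L" "\<bar>j\<bar> \<in> I" "i = \<bar>j\<bar>" by (auto simp: trace_def)
    then show "i \<in> {i \<in> I. i \<in> L \<or> - i \<in> L}" by (cases "0 \<le> j") auto
  qed
  moreover have "inj_on abs (trace L)"
    using inj_abs_vertex[OF assms] by (auto simp: trace_def intro: inj_on_subset)
  ultimately show ?thesis by (simp add: card_image)
qed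

lemma K_iff: "\<sigma> \<in> K \<longleftrightarrow> sorted_wrt (\<subset>) \<sigma> \<and> (\<forall>L \<in> set \<sigma>. vert L)"
proof -
  have "vert L \<longleftrightarrow> L \<in> KB_vertices n \<and> odd (card {i \<in> I. i \<in> L \<or> - i \<in> L})" for L
    using card_trace[of L] by (cases "L \<in> KB_vertices n") (simp_all add: vert_def)
  then show ?thesis unfolding KB_sub_def KB_def by blast
qed

lemma trace_sub: "trace L \<subseteq> L" by (auto simp: trace_def)

lemma trace_idem [simp]: "trace (trace L) = trace L" by (auto simp: trace_def)

lemma trace_mono: "L \<subseteq> M \<Longrightarrow> trace L \<subseteq> trace M" by (auto simp: trace_def)

lemma trace_fixed_sub: "L \<subseteq> M \<Longrightarrow> trace M = M \<Longrightarrow> trace L = L" by (auto simp: trace_def)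

lemma vert_trace: "vert L \<Longrightarrow> vert (trace L)"
proof -
  assume v: "vert L"
  then have "trace L \<noteq> {}" by (auto simp: vert_def)
  then show ?thesis using v trace_sub[of L] by (auto simp: vert_def KB_vertices_def)
qed

lemma vert_sset:
  assumes "vert L" "trace L = L"
  shows "sset I L"
proof -
  have "L \<in> KB_vertices n" using assms by (simp add: vert_def)
  moreover have "abs ` L \<subseteq> I" using assms(2) unfolding trace_def by blast
  ultimately show ?thesis using inj_abs_vertex by (simp add: sset_def)
qed

lemma sset_vert:
  assumes "sset I L" "odd (card L)"
  shows "vert L" "trace L = L"
proof -
  show tr: "trace L = L" using assms by (auto simp: sset_def trace_def)
  have "L \<noteq> {}" using assms(2) by auto
  moreover have "- i \<notin> L" if "i \<in> L" for i
  proof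
    assume "- i \<in> L"
    then have "i = - i" using assms(1) that inj_onD[of abs L i "- i"] by (simp add: sset_def)
    then have "i = 0" by simp
    then show False using assms(1) that I_pos[of 0] by (auto simp: sset_def)
  qed
  moreover have "L \<subseteq> {- int n..int n} - {0}"
  proof
    fix i assume "i \<in> L"
    then have "\<bar>i\<bar> \<in> {1..int n}" using assms(1) I_sub unfolding sset_def by blast
    then show "i \<in> {- int n..int n} - {0}" by auto
  qed
  ultimately show "vert L" using assms(2) tr by (simp add: vert_def KB_vertices_def)
qed

lemma sset_card_le: "sset I L \<Longrightarrow> card L \<le> r"
  unfolding sset_def using card_mono[OF fin_I, of "abs ` L"] by (simp add: card_image)

lemma fixed_card_T: "vert L \<Longrightarrow> trace L = L \<Longrightarrow> card L \<in> T"
  using sset_card_le[OF vert_sset] by (simp add: vert_def T_def)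

lemma vert_take:
  assumes "y \<in> SB I" "t \<in> T"
  shows "vert (set (take t y))" "trace (set (take t y)) = set (take t y)"
  using sset_vert[OF sset_take[OF assms(1), of t]] card_take[OF assms(1), of t] assms(2)
  by (auto simp: T_def)

lemma face_closed_K: "face_closed K"
  by (auto simp: face_closed_def K_iff sorted_wrt_append)

abbreviation outer :: "int set list \<Rightarrow> int set list" where
  "outer \<sigma> \<equiv> filter (\<lambda>L. trace L \<noteq> L) \<sigma>"

text \<open>Two tiers: \<open>card (SB I)\<close> bounds every \<open>rk\<close>, so a chain with an
  outer member lies above all inner chains, and among such chains the number of outer members
  decides.\<close>

definition \<mu> :: "int set list \<Rightarrow> nat" where
  "\<mu> \<sigma> = (if outer \<sigma> = [] then rk (lab \<sigma>) else card (SB I) + length (outer \<sigma>))"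

text \<open>Depends on the label alone, so the whole Boolean interval of a label is matched along
  one vertex.\<close>

definition t0 :: "int list \<Rightarrow> nat" where
  "t0 y = (LEAST t. t \<in> T - Des y)"

definition V :: "int set list \<Rightarrow> int set" where
  "V \<sigma> = (if outer \<sigma> = [] then set (take (t0 (lab \<sigma>)) (lab \<sigma>)) else trace (hd (outer \<sigma>)))"

definition crit :: "int set list \<Rightarrow> bool" where
  "crit \<sigma> \<longleftrightarrow> outer \<sigma> = [] \<and> Des (lab \<sigma>) = T"

lemma inner:
  assumes "\<sigma> \<in> K" "outer \<sigma> = []"
  shows "sorted_wrt (\<subset>) \<sigma>" "\<And>L. L \<in> set \<sigma> \<Longrightarrow> sset I L" "card ` set \<sigma> \<subseteq> T"
    "lab \<sigma> \<in> SB I" "compat (lab \<sigma>) \<sigma>" "Des (lab \<sigma>) \<subseteq> card ` set \<sigma>"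
proof -
  have fixd: "trace L = L" if "L \<in> set \<sigma>" for L using assms(2) that by (auto simp: filter_empty_conv)
  show s: "sorted_wrt (\<subset>) \<sigma>" using assms(1) by (simp add: K_iff)
  show ss: "sset I L" if "L \<in> set \<sigma>" for L
    using assms(1) fixd[OF that] that by (intro vert_sset) (auto simp: K_iff)
  show "card ` set \<sigma> \<subseteq> T" using assms(1) fixd fixed_card_T by (auto simp: K_iff)
  show "lab \<sigma> \<in> SB I" "compat (lab \<sigma>) \<sigma>" "Des (lab \<sigma>) \<subseteq> card ` set \<sigma>"
    using lab[OF s ss] by auto
qed

lemma t0:
  assumes "\<sigma> \<in> K" "outer \<sigma> = []" "\<not> crit \<sigma>"
  shows "t0 (lab \<sigma>) \<in> T" "t0 (lab \<sigma>) \<notin> Des (lab \<sigma>)"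
proof -
  have "\<exists>t. t \<in> T - Des (lab \<sigma>)" using inner(3,6)[OF assms(1,2)] assms(2,3) by (auto simp: crit_def)
  then have "t0 (lab \<sigma>) \<in> T - Des (lab \<sigma>)" unfolding t0_def by (rule LeastI_ex)
  then show "t0 (lab \<sigma>) \<in> T" "t0 (lab \<sigma>) \<notin> Des (lab \<sigma>)" by auto
qed

lemma outer_hd_le:
  assumes "\<sigma> \<in> K" "L \<in> set (outer \<sigma>)"
  shows "hd (outer \<sigma>) \<subseteq> L"
proof -
  have "sorted_wrt (\<subset>) (outer \<sigma>)" using assms(1) by (simp add: K_iff sorted_wrt_filter)
  then show ?thesis using assms(2) by (cases "outer \<sigma>") auto
qed

lemma K_comparable:
  assumes "\<sigma> \<in> K" "L \<in> set \<sigma>" "M \<in> set \<sigma>"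
  shows "L \<subset> M \<or> L = M \<or> M \<subset> L"
proof -
  have "sorted_wrt (\<subset>) \<sigma>" using assms by (simp add: K_iff)
  then show ?thesis using assms(2,3) by (induction \<sigma>) auto
qed

text \<open>Dropping a vertex inside \<open>\<plusminus>I\<close> leaves the outer members alone and
  can only add compatible words, so the least one stays or goes down. Dropping an outer vertex
  lowers the tier or the count.\<close>

lemma matching_face:
  assumes "a @ x # b \<in> K"
  shows "\<mu> (a @ b) < \<mu> (a @ x # b) \<or>
    (\<mu> (a @ b) = \<mu> (a @ x # b) \<and> V (a @ b) = V (a @ x # b) \<and> (crit (a @ b) \<longleftrightarrow> crit (a @ x # b)))"
proof (cases "trace x = x")
  case fixed: True
  then have o: "outer (a @ b) = outer (a @ x # b)" by simp
  show ?thesis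
  proof (cases "outer (a @ x # b) = []")
    case True
    note i = inner[OF assms True]
    have ab: "a @ b \<in> K" using assms face_closed_K unfolding face_closed_def by blast
    have c: "compat (lab (a @ x # b)) (a @ b)" using i(5) by (rule compat_subset) auto
    have j: "sorted_wrt (\<subset>) (a @ b)" "\<And>L. L \<in> set (a @ b) \<Longrightarrow> sset I L" "lab (a @ b) \<in> SB I"
      using inner[OF ab] o True by auto
    have "lab (a @ b) = lab (a @ x # b) \<or> lab (a @ b) \<lless> lab (a @ x # b)"
      using lab_le[OF j(1,2) i(4) c] by blast
    then show ?thesis
    proof
      assume "lab (a @ b) = lab (a @ x # b)"
      then show ?thesis using o by (simp add: \<mu>_def V_def crit_def)
    next
      assume "lab (a @ b) \<lless> lab (a @ x # b)"
      from rk_mono[OF j(3) this] show ?thesis using o True by (simp add: \<mu>_def)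
    qed
  next
    case False
    then show ?thesis unfolding \<mu>_def V_def crit_def o by (simp only: if_False simp_thms)
  qed
next
  case False
  then have "length (outer (a @ b)) < length (outer (a @ x # b))" by simp
  moreover from this have "outer (a @ x # b) \<noteq> []" by (metis list.size(3) not_less_zero)
  then have "\<mu> (a @ x # b) = card (SB I) + length (outer (a @ x # b))"
    unfolding \<mu>_def by (simp only: if_False)
  moreover have "\<mu> (a @ b) \<le> card (SB I) + length (outer (a @ b))"
    using rk_le[of "lab (a @ b)"] unfolding \<mu>_def by (simp only: split: if_split) linarith
  ultimately show ?thesis by linarith
qed

text \<open>For an inner chain the new vertex is a prefix of the label, hence comparable with all
  members, which are prefixes too. Otherwise it fits immediately below the least outer member, since
  every member under that one lies inside \<open>\<plusminus>I\<close>.\<close>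

lemma matching_insert:
  assumes s: "\<sigma> \<in> K" "\<not> crit \<sigma>" "V \<sigma> \<notin> set \<sigma>"
  shows "\<exists>a b. \<sigma> = a @ b \<and> a @ V \<sigma> # b \<in> K \<and> \<mu> (a @ V \<sigma> # b) = \<mu> \<sigma>"
proof -
  have sorted: "sorted_wrt (\<subset>) \<sigma>" using s by (simp add: K_iff)
  show ?thesis
  proof (cases "outer \<sigma> = []")
    case True
    note i = inner[OF s(1) True] and t = t0[OF s(1) True s(2)]
    let ?y = "lab \<sigma>" and ?t = "t0 (lab \<sigma>)"
    have V: "V \<sigma> = set (take ?t ?y)" using True by (simp add: V_def)
    have cV: "card (V \<sigma>) = ?t" unfolding V using card_take[OF i(4)] t(1) by (simp add: T_def)
    have vV: "vert (V \<sigma>)" "trace (V \<sigma>) = V \<sigma>" unfolding V using vert_take[OF i(4) t(1)] by auto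
    have "L \<subset> V \<sigma> \<or> V \<sigma> \<subset> L" if "L \<in> set \<sigma>" for L
    proof -
      have L: "L = set (take (card L) ?y)" using i(5) that by (simp add: compat_def)
      have "L \<noteq> V \<sigma>" using s(3) that by auto
      moreover have "L \<subseteq> V \<sigma> \<or> V \<sigma> \<subseteq> L"
        using set_take_subset_set_take[of ?t "card L" ?y] set_take_subset_set_take[of "card L" ?t ?y] V L
        by (metis nle_le)
      ultimately show ?thesis by auto
    qed
    from insert_comparable[OF sorted this] obtain a b where
      ab: "\<sigma> = a @ b" "sorted_wrt (\<subset>) (a @ V \<sigma> # b)" by blast
    define \<rho> where "\<rho> = a @ V \<sigma> # b"
    have set\<rho>: "set \<rho> = insert (V \<sigma>) (set \<sigma>)" unfolding \<rho>_def using ab(1)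
      by (metis Un_insert_right list.simps(15) set_append)
    have "\<rho> \<in> K" using ab(2) s(1) vV set\<rho> by (simp add: K_iff \<rho>_def[symmetric])
    moreover have "outer \<rho> = []" using True set\<rho> vV(2) by (simp add: filter_empty_conv)
    moreover have "lab \<rho> = ?y"
      using i cV V set\<rho> by (intro lab_unique) (auto simp: compat_def)
    ultimately have "\<rho> \<in> K" "\<mu> \<rho> = \<mu> \<sigma>" using True by (auto simp: \<mu>_def)
    then show ?thesis unfolding \<rho>_def using ab(1) by blast
  next
    case False
    let ?M = "hd (outer \<sigma>)"
    have M: "?M \<in> set (outer \<sigma>)" using False by (rule hd_in_set)
    then have M': "?M \<in> set \<sigma>" "trace ?M \<noteq> ?M" by auto
    have V: "V \<sigma> = trace ?M" using False by (simp add: V_def)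
    have "vert ?M" using M' s(1) by (auto simp: K_iff)
    then have vV: "vert (V \<sigma>)" "trace (V \<sigma>) = V \<sigma>" using V vert_trace by auto
    have "L \<subset> V \<sigma> \<or> V \<sigma> \<subset> L" if "L \<in> set \<sigma>" for L
    proof (cases "trace L = L")
      case True
      \<comment> \<open>A subset of a set inside \<open>\<plusminus>I\<close> is again inside, so
        \<open>L\<close> cannot contain an outer member.\<close>
      have "\<not> ?M \<subseteq> L" using True M'(2) trace_fixed_sub by blast
      then have "L \<subseteq> ?M" using K_comparable[OF s(1) that M'(1)] by auto
      then have "L \<subseteq> V \<sigma>" using trace_mono[of L ?M] True V by simp
      then show ?thesis using s(3) that by auto
    next
      case False
      then have "?M \<subseteq> L" using outer_hd_le[OF s(1)] that by simp
      moreover have "V \<sigma> \<subset> ?M" using V trace_sub[of ?M] M'(2) by auto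
      ultimately show ?thesis by auto
    qed
    from insert_comparable[OF sorted this] obtain a b where
      ab: "\<sigma> = a @ b" "sorted_wrt (\<subset>) (a @ V \<sigma> # b)" by blast
    define \<rho> where "\<rho> = a @ V \<sigma> # b"
    have set\<rho>: "set \<rho> = insert (V \<sigma>) (set \<sigma>)" unfolding \<rho>_def using ab(1)
      by (metis Un_insert_right list.simps(15) set_append)
    have "outer \<sigma> = outer (a @ b)" using ab(1) by simp
    then have "outer \<rho> = outer \<sigma>" using vV(2) unfolding \<rho>_def by simp
    then have "\<mu> \<rho> = \<mu> \<sigma>" using False by (simp add: \<mu>_def)
    moreover have "\<rho> \<in> K" using ab(2) s(1) vV set\<rho> by (simp add: K_iff \<rho>_def[symmetric])
    ultimately show ?thesis unfolding \<rho>_def using ab(1) by blast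
  qed
qed

text \<open>The size \<open>t0\<close> is no descent, so after the deletion the label still has all
  its descents at member sizes. In the outer case the deleted set is a trace and hence not itself
  outer.\<close>

lemma matching_delete:
  assumes s: "a @ x # b \<in> K" "\<not> crit (a @ x # b)" "V (a @ x # b) = x"
  shows "\<mu> (a @ b) = \<mu> (a @ x # b)"
proof (cases "outer (a @ x # b) = []")
  case True
  note i = inner[OF s(1) True] and t = t0[OF s(1) True s(2)]
  let ?y = "lab (a @ x # b)" and ?t = "t0 (lab (a @ x # b))"
  have x: "x = set (take ?t ?y)" using s(3) unfolding V_def True by (simp only: simp_thms if_True)
  have "card (set (take ?t ?y)) = ?t" using card_take[OF i(4)] t(1) by (simp add: T_def)
  then have cx: "card x = ?t" using x by (simp only:)
  have "Des ?y \<subseteq> card ` set (a @ b)"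
  proof
    fix t assume "t \<in> Des ?y"
    then obtain F where F: "F \<in> set (a @ x # b)" "t = card F" using i(6) by auto
    have "F \<noteq> x" using F cx t(2) \<open>t \<in> Des ?y\<close> by auto
    then show "t \<in> card ` set (a @ b)" using F by auto
  qed
  moreover have "compat ?y (a @ b)" using i(5) by (rule compat_subset) auto
  ultimately have "lab (a @ b) = ?y" using i(4) by (intro lab_unique)
  moreover have "outer (a @ b) = []" using True by (auto simp: filter_empty_conv split: if_splits)
  ultimately show ?thesis unfolding \<mu>_def True by (simp only: simp_thms if_True)
next
  case False
  then have "V (a @ x # b) = trace (hd (outer (a @ x # b)))" unfolding V_def by (simp only: if_False)
  then have "trace x = x" unfolding s(3) using trace_idem by metis
  then have "outer (a @ b) = outer (a @ x # b)" by simp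
  then show ?thesis unfolding \<mu>_def using False by (simp only: if_False)
qed

section \<open>The chain of all odd prefixes of a word, and critical chains\<close>

definition chain :: "int list \<Rightarrow> int set list" where
  "chain y = map (\<lambda>i. set (take (2 * i - 1) y)) [1..<Suc ((r + 1) div 2)]"

lemma T_image: "T = (\<lambda>i. 2 * i - 1) ` set [1..<Suc ((r + 1) div 2)]"
proof (intro equalityI subsetI)
  fix t assume "t \<in> T"
  then have "odd t" "t \<le> r" by (auto simp: T_def)
  then show "t \<in> (\<lambda>i. 2 * i - 1) ` set [1..<Suc ((r + 1) div 2)]"
    by (intro image_eqI[of _ _ "(t + 1) div 2"]) (auto elim!: oddE)
qed (auto simp: T_def)

lemma sorted_chain:
  assumes "y \<in> SB I"
  shows "sorted_wrt (\<subset>) (chain y)"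
  unfolding chain_def sorted_wrt_map
proof (rule sorted_wrt_mono_rel[OF _ sorted_wrt_upt])
  fix i j assume ij: "i \<in> set [1..<Suc ((r + 1) div 2)]" "j \<in> set [1..<Suc ((r + 1) div 2)]" "i < j"
  then have le: "2 * i - 1 < 2 * j - 1" "2 * j - 1 \<le> r" by auto
  then have "card (set (take (2 * i - 1) y)) \<noteq> card (set (take (2 * j - 1) y))"
    using card_take[OF assms, of "2 * i - 1"] card_take[OF assms, of "2 * j - 1"] by simp
  then show "set (take (2 * i - 1) y) \<subset> set (take (2 * j - 1) y)"
    using set_take_subset_set_take[of "2 * i - 1" "2 * j - 1" y] le(1) by (auto simp: psubset_eq)
qed

lemma chain_unique:
  assumes y: "y \<in> SB I" and s: "sorted_wrt (\<subset>) \<sigma>" "compat y \<sigma>" "card ` set \<sigma> = T"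
  shows "\<sigma> = chain y"
proof -
  have "set \<sigma> = (\<lambda>t. set (take t y)) ` card ` set \<sigma>"
    using s(2) by (force simp: compat_def)
  also have "\<dots> = set (chain y)" unfolding s(3) T_image chain_def by auto
  finally have "set \<sigma> = set (chain y)" .
  then show ?thesis using s(1) sorted_chain[OF y] by (intro sorted_psubset_unique)
qed

text \<open>The sizes of an inner chain lie between the descents of its label and \<open>T\<close>.
  When these two agree, the members are exactly the odd prefixes of the label.\<close>

lemma crit_chain:
  assumes "\<sigma> \<in> K" "crit \<sigma>"
  shows "\<sigma> = chain (lab \<sigma>)" "lab \<sigma> \<in> SB I" "Des (lab \<sigma>) = T"
proof -
  have o: "outer \<sigma> = []" and d: "Des (lab \<sigma>) = T" using assms(2) by (auto simp: crit_def)
  note i = inner[OF assms(1) o]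
  have "card ` set \<sigma> = T" using i(3,6) d by auto
  then show "\<sigma> = chain (lab \<sigma>)" using i by (intro chain_unique) auto
  show "lab \<sigma> \<in> SB I" "Des (lab \<sigma>) = T" using i d by auto
qed

lemma length_chain: "length (chain y) = (r + 1) div 2"
  by (simp add: chain_def)

lemma top_deg_eq: "top_deg I + 1 = int ((r + 1) div 2)"
  unfolding top_deg_def by (simp add: zdiv_int) 

end

section \<open>Fundamental cycles\<close>

text \<open>\<open>E w\<close> is the fundamental cycle of a word of even length read without the sign convention of
  \<^const>\<open>Fset\<close>; the two vertices of the join factor belonging to a block are appended last.\<close>

fun E :: "int list \<Rightarrow> (int set list \<Rightarrow>\<^sub>0 rat)" where
  "E (a # b # v) = snoc (set (b # v)) (E v) - snoc (set (a # v)) (E v)"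
| "E [] = basis []"
| "E [a] = 0"

text \<open>In odd length the first letter is a block of its own, which \<open>star\<close> negates;
  the suspension that it contributes has the largest vertices and therefore comes last.\<close>

definition EE :: "int list \<Rightarrow> (int set list \<Rightarrow>\<^sub>0 rat)" where
  "EE w = (if odd (length w)
    then snoc (set w) (E (tl w)) - snoc (set (- hd w # tl w)) (E (tl w)) else E w)"

text \<open>Moves the negation in \<open>Fset\<close> from the sets to the letters.\<close>

definition sg :: "int list \<Rightarrow> int list" where
  "sg w = (if odd (length w) then w else map uminus w)"

lemma sg_sg [simp]: "sg (sg w) = w"
  by (simp add: sg_def comp_def)

lemma length_sg [simp]: "length (sg w) = length w"
  by (simp add: sg_def)

text \<open>The sum in \<open>fund_cycle\<close> with arbitrary vertices; freed from words, it
  admits a recursion on the number of join factors.\<close>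

definition join_cycle :: "(nat \<Rightarrow> 'v) \<Rightarrow> (nat \<Rightarrow> 'v) \<Rightarrow> nat \<Rightarrow> ('v list \<Rightarrow>\<^sub>0 rat)" where
  "join_cycle p q m = (\<Sum>\<epsilon> \<in> {1..m} \<rightarrow>\<^sub>E {0, 1::nat}.
        qscale ((-1) ^ (\<Sum>i = 1..m. \<epsilon> i))
          (basis (map (\<lambda>i. if \<epsilon> i = 0 then p i else q i) [1..<Suc m])))"

lemma join_cycle_0: "join_cycle p q 0 = basis []"
  by (simp add: join_cycle_def)

text \<open>Splits the sum by the last coordinate of \<open>\<epsilon>\<close>: a further join
  factor is a suspension.\<close>

lemma join_cycle_Suc:
  "join_cycle p q (Suc m) = snoc (p (Suc m)) (join_cycle p q m) - snoc (q (Suc m)) (join_cycle p q m)"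
proof -
  define g where "g m \<epsilon> = qscale ((-1) ^ (\<Sum>i = 1..m. \<epsilon> i))
          (basis (map (\<lambda>i. if \<epsilon> i = (0::nat) then p i else q i) [1..<Suc m]))" for m \<epsilon>
  have jc: "join_cycle p q m = (\<Sum>\<epsilon> \<in> {1..m} \<rightarrow>\<^sub>E {0, 1}. g m \<epsilon>)" for m
    by (simp add: join_cycle_def g_def)
  have step: "g (Suc m) (\<epsilon>(Suc m := y)) =
      qscale ((-1) ^ y) (snoc (if y = 0 then p (Suc m) else q (Suc m)) (g m \<epsilon>))" for \<epsilon> y
  proof -
    have "(\<Sum>i = 1..Suc m. (\<epsilon>(Suc m := y)) i) = (\<Sum>i = 1..m. \<epsilon> i) + y" by simp
    moreover have "map (\<lambda>i. if (\<epsilon>(Suc m := y)) i = 0 then p i else q i) [1..<Suc (Suc m)] =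
        map (\<lambda>i. if \<epsilon> i = 0 then p i else q i) [1..<Suc m] @ [if y = 0 then p (Suc m) else q (Suc m)]"
      by auto
    ultimately show ?thesis unfolding g_def snoc_qscale by (simp only: snoc_basis) (simp add: power_add mult.commute)
  qed
  have ins: "{1..Suc m} = insert (Suc m) {1..m}" by auto
  have inj: "inj_on (\<lambda>(y, \<epsilon>). \<epsilon>(Suc m := y)) ({0, 1} \<times> ({1..m} \<rightarrow>\<^sub>E {0, 1::nat}))"
    by (rule inj_combinator) simp
  have "join_cycle p q (Suc m) = (\<Sum>(y, \<epsilon>) \<in> {0, 1} \<times> ({1..m} \<rightarrow>\<^sub>E {0, 1}). g (Suc m) (\<epsilon>(Suc m := y)))"
    unfolding jc ins PiE_insert_eq using inj
    by (simp only: sum.reindex o_def case_prod_unfold)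
  also have "\<dots> = (\<Sum>y \<in> {0, 1}. \<Sum>\<epsilon> \<in> {1..m} \<rightarrow>\<^sub>E {0, 1}. g (Suc m) (\<epsilon>(Suc m := y)))"
    by (simp add: sum.cartesian_product)
  also have "\<dots> = snoc (p (Suc m)) (join_cycle p q m) - snoc (q (Suc m)) (join_cycle p q m)"
    unfolding step by (simp add: jc snoc_sum sum_negf)
  finally show ?thesis .
qed

lemma join_cycle_cong:
  assumes "\<And>i. 1 \<le> i \<Longrightarrow> i \<le> m \<Longrightarrow> p i = p' i \<and> q i = q' i"
  shows "join_cycle p q m = join_cycle p' q' m"
  using assms by (induction m) (auto simp: join_cycle_0 join_cycle_Suc)

lemma swap_pairs_props [simp]:
  "length (swap_pairs w) = length w" "set (swap_pairs w) = set w"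
  "map uminus (swap_pairs w) = swap_pairs (map uminus w)"
  by (induction w rule: swap_pairs.induct) auto

text \<open>The vertices count letters from the right, so a new block on the left leaves all smaller
  vertices as they are; only the topmost pair is new.\<close>

lemma E_join_cycle:
  assumes "even (length w)"
  shows "E w = join_cycle (\<lambda>i. set (drop (length w - (2 * i - 1)) w))
      (\<lambda>i. set (drop (length w - (2 * i - 1)) (swap_pairs w))) (length w div 2)"
  using assms
proof (induction w rule: E.induct)
  case (1 a b v)
  let ?m = "length v div 2"
  have ev: "even (length v)" using 1 by simp
  then have lv: "length v = 2 * ?m" by simp
  have "length (a # b # v) div 2 = Suc ?m" by simp
  have IH: "E v = join_cycle (\<lambda>i. set (drop (length (a # b # v) - (2 * i - 1)) (a # b # v)))
      (\<lambda>i. set (drop (length (a # b # v) - (2 * i - 1)) (swap_pairs (a # b # v)))) ?m"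
    unfolding 1(1)[OF ev]
  proof (intro join_cycle_cong conjI)
    fix i assume i: "1 \<le> i" "i \<le> ?m"
    then have "length (a # b # v) - (2 * i - 1) = Suc (Suc (length v - (2 * i - 1)))"
      using lv by simp
    then show "set (drop (length v - (2 * i - 1)) v) = set (drop (length (a # b # v) - (2 * i - 1)) (a # b # v))"
      "set (drop (length v - (2 * i - 1)) (swap_pairs v)) =
        set (drop (length (a # b # v) - (2 * i - 1)) (swap_pairs (a # b # v)))"
      by simp_all
  qed
  \<comment> \<open>The top index drops a single letter: \<open>a\<close> from the word and
    \<open>b\<close> from its swap.\<close>
  have "length (a # b # v) - (2 * Suc ?m - 1) = 1" using lv by simp
  then show ?case
    unfolding \<open>length (a # b # v) div 2 = Suc ?m\<close> join_cycle_Suc IH[symmetric] by simp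
qed (auto simp: join_cycle_0)

text \<open>All later facts on \<open>fund_cycle\<close> pass through this recursive form. Odd words
  split off their first letter, even words are negated throughout.\<close>

lemma fund_cycle_EE: "fund_cycle w = EE (sg w)"
proof (cases "odd (length w)")
  case True
  then obtain a v where w: "w = a # v" by (cases w) auto
  then have ev: "even (length v)" using True by simp
  let ?m = "length v div 2"
  have lv: "length v = 2 * ?m" using ev by simp
  have m: "(length w + 1) div 2 = Suc ?m" using w by simp
  have st: "star w = - a # swap_pairs v" using True w by (simp add: star_def)
  have "fund_cycle w = join_cycle (\<lambda>i. Fset i w) (\<lambda>i. Fset i (star w)) (Suc ?m)"
    unfolding fund_cycle_def join_cycle_def Let_def m by (intro sum.cong refl) (simp add: if_distrib)
  also have "\<dots> = EE (sg w)"
  proof -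
    have "join_cycle (\<lambda>i. Fset i w) (\<lambda>i. Fset i (star w)) ?m = E v"
      unfolding E_join_cycle[OF ev]
    proof (intro join_cycle_cong conjI)
      fix i assume i: "1 \<le> i" "i \<le> ?m"
      then have "length w - (2 * i - 1) = Suc (length v - (2 * i - 1))" using lv w by simp
      then show "Fset i w = set (drop (length v - (2 * i - 1)) v)"
        "Fset i (star w) = set (drop (length v - (2 * i - 1)) (swap_pairs v))"
        using True unfolding st by (simp_all add: Fset_def w)
    qed
    moreover have "Fset (Suc ?m) w = set (a # v)" "Fset (Suc ?m) (star w) = set (- a # v)"
      using True lv unfolding st by (simp_all add: Fset_def w)
    ultimately show ?thesis using True unfolding join_cycle_Suc by (simp add: EE_def sg_def w)
  qed
  finally show ?thesis .
next
  case False
  let ?m = "length w div 2" and ?w = "map uminus w"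
  have m: "(length w + 1) div 2 = ?m" using False by simp
  have ev: "even (length ?w)" using False by simp
  have "fund_cycle w = join_cycle (\<lambda>i. Fset i w) (\<lambda>i. Fset i (star w)) ?m"
    unfolding fund_cycle_def join_cycle_def Let_def m by (intro sum.cong refl) (simp add: if_distrib)
  also have "\<dots> = E ?w"
  proof -
    have m': "length ?w div 2 = ?m" by simp
    have st: "star w = swap_pairs w" using False by (simp add: star_def)
    show ?thesis
      unfolding E_join_cycle[OF ev] m' st
    proof (intro join_cycle_cong conjI)
      fix i
      show "Fset i w = set (drop (length ?w - (2 * i - 1)) ?w)"
        using False by (simp add: Fset_def drop_map)
      have "drop (length ?w - (2 * i - 1)) (swap_pairs ?w) =
          map uminus (drop (length w - (2 * i - 1)) (swap_pairs w))"
        unfolding swap_pairs_props(3)[symmetric] drop_map length_map by (rule refl)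
      then show "Fset i (swap_pairs w) = set (drop (length ?w - (2 * i - 1)) (swap_pairs ?w))"
        using False by (simp add: Fset_def)
    qed
  qed
  finally show ?thesis using False by (simp add: EE_def sg_def)
qed

section \<open>Boundaries, supports and leading simplices of the cycles\<close>

lemma keys_snoc_diffE:
  assumes "\<sigma> \<in> supp (snoc p x - snoc q x)"
  obtains \<tau> c where "\<tau> \<in> supp x" "\<sigma> = \<tau> @ [c]" "c = p \<or> c = q"
proof -
  have "\<sigma> \<in> supp (snoc p x) \<union> supp (snoc q x)"
    using assms keys_diff[of "snoc p x" "snoc q x"] by auto
  then show ?thesis using that unfolding keys_snoc by blast
qed

lemma E_keys_length:
  "even (length v) \<Longrightarrow> \<sigma> \<in> supp (E v) \<Longrightarrow> length \<sigma> = length v div 2"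
proof (induction v arbitrary: \<sigma> rule: E.induct)
  case (1 a b v)
  from 1(4) obtain \<tau> c where "\<tau> \<in> supp (E v)" "\<sigma> = \<tau> @ [c]"
    unfolding E.simps by (rule keys_snoc_diffE)
  then show ?case using 1(1)[of \<tau>] 1(3) by simp
qed auto

text \<open>The two cones over a cycle have the same boundary, up to sign the cycle itself.\<close>

lemma bd_snoc_diff:
  assumes "\<And>\<sigma>. \<sigma> \<in> supp x \<Longrightarrow> length \<sigma> = l" "bd x = 0"
  shows "bd (snoc p x - snoc q x) = 0"
  by (simp add: linear_ext_diff bd_snoc[OF assms(1)] assms(2))

lemma bd_E: "even (length v) \<Longrightarrow> bd (E v) = 0"
proof (induction v rule: E.induct)
  case (1 a b v)
  then have "even (length v)" "bd (E v) = 0" by auto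
  then show ?case using bd_snoc_diff[OF E_keys_length] by simp
qed (auto simp: simplex_bd_def)

lemma bd_EE: "bd (EE w) = 0"
proof (cases "odd (length w)")
  case True
  then have ev: "even (length (tl w))" by simp
  show ?thesis using True bd_snoc_diff[OF E_keys_length[OF ev] bd_E[OF ev]] by (simp add: EE_def)
qed (simp add: EE_def bd_E)

text \<open>The number of members is a separate argument, so that parts of a word have chains
  too.\<close>

definition chainl :: "nat \<Rightarrow> int list \<Rightarrow> int set list" where
  "chainl m y = map (\<lambda>i. set (take (2 * i - 1) y)) [1..<Suc m]"

lemma chainl_Suc:
  "chainl (Suc m) y = chainl m y @ [set (take (2 * m + 1) y)]"
  by (simp add: chainl_def)

lemma chainl_append:
  "2 * m \<le> length y \<Longrightarrow> chainl m (y @ z) = chainl m y"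
proof -
  assume "2 * m \<le> length y"
  then have "take (2 * i - 1) (y @ z) = take (2 * i - 1) y" if "i \<in> set [1..<Suc m]" for i
    using that by auto
  then show ?thesis unfolding chainl_def by (intro map_cong refl) (simp only:)
qed

lemma lless_append: "y \<lless> z \<Longrightarrow> length y = length z \<Longrightarrow> y @ u \<lless> z @ v"
proof (erule llessE, assumption)
  fix p assume "length y = length z" "p < length y" "take p y = take p z" "y ! p < z ! p"
  then show "y @ u \<lless> z @ v" by (intro llessI[of p]) (simp_all add: nth_append)
qed

lemma lless_append_last: "a < b \<Longrightarrow> y @ a # u \<lless> y @ b # v"
  by (rule llessI[of "length y"]) simp_all

text \<open>Choosing a vertex from a join factor means choosing which letter of a block comes first
  in the reversed word, so the simplices are chains of words with some blocks swapped. Swapping a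
  descending block lowers the word.\<close>

lemma E_support:
  assumes "even (length v)" "\<sigma> \<in> supp (E v)"
  shows "\<exists>y'. mset y' = mset (rev v) \<and> \<sigma> = chainl (length v div 2) y' \<and>
    ((\<forall>i < length v div 2. rev v ! (2 * i) > rev v ! (2 * i + 1)) \<longrightarrow> y' = rev v \<or> y' \<lless> rev v)"
  using assms
proof (induction v arbitrary: \<sigma> rule: E.induct)
  case (1 a b v)
  let ?m = "length v div 2"
  have ev: "even (length v)" "length v = 2 * ?m" using 1(3) by auto
  obtain \<tau> c where \<tau>: "\<tau> \<in> supp (E v)" "\<sigma> = \<tau> @ [set (c # v)]" "c = b \<or> c = a"
    using 1(4) unfolding E.simps by (elim keys_snoc_diffE) blast
  \<comment> \<open>\<open>d\<close> is the letter of the block that is left over; it follows the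
    chosen letter \<open>c\<close> in the new word.\<close>
  obtain d where d: "c = b \<and> d = a \<or> c = a \<and> d = b" using \<tau>(3) by blast
  obtain y' where y': "mset y' = mset (rev v)" "\<tau> = chainl ?m y'"
    "(\<forall>i < ?m. rev v ! (2 * i) > rev v ! (2 * i + 1)) \<longrightarrow> y' = rev v \<or> y' \<lless> rev v"
    using 1(1)[OF ev(1) \<tau>(1)] by blast
  have ly: "length y' = 2 * ?m" "set y' = set v"
    using mset_eq_length[OF y'(1)] mset_eq_setD[OF y'(1)] ev by auto
  have rl: "length (rev v) = 2 * ?m" using ev by simp
  show ?case
  proof (intro exI[of _ "y' @ [c, d]"] conjI impI)
    show "mset (y' @ [c, d]) = mset (rev (a # b # v))" using y'(1) d by auto
    have "chainl (Suc ?m) (y' @ [c, d]) = \<tau> @ [insert c (set v)]"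
      using ly y'(2) by (auto simp: chainl_Suc chainl_append)
    then show "\<sigma> = chainl (length (a # b # v) div 2) (y' @ [c, d])" using \<tau>(2) by simp
    assume D: "\<forall>i < length (a # b # v) div 2. rev (a # b # v) ! (2 * i) > rev (a # b # v) ! (2 * i + 1)"
    have "rev (a # b # v) ! (2 * ?m) > rev (a # b # v) ! (2 * ?m + 1)" using D by simp
    then have "a < b" using rl by (simp add: nth_append)
    have "\<forall>i < ?m. rev v ! (2 * i) > rev v ! (2 * i + 1)"
    proof (intro allI impI)
      fix i assume i: "i < ?m"
      then have "rev (a # b # v) ! (2 * i) > rev (a # b # v) ! (2 * i + 1)" using D by simp
      then show "rev v ! (2 * i) > rev v ! (2 * i + 1)" using i rl by (simp add: nth_append)
    qed
    then have "y' = rev v \<or> y' \<lless> rev v" using y'(3) by blast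
    then show "y' @ [c, d] = rev (a # b # v) \<or> y' @ [c, d] \<lless> rev (a # b # v)"
    proof
      assume "y' = rev v"
      then show ?thesis using d \<open>a < b\<close> lless_append_last[of a b "rev v" "[b]" "[a]"] by auto
    next
      assume "y' \<lless> rev v"
      then have "y' @ [c, d] \<lless> rev v @ [b, a]" using ly rl by (intro lless_append) auto
      then show ?thesis by simp
    qed
  qed
qed (auto simp: chainl_def)

text \<open>The leading chain takes the first vertex from every factor. Distinct letters keep the
  two vertices of a factor apart, so it arises only once, with sign +1.\<close>

lemma E_leading:
  "even (length v) \<Longrightarrow> distinct v \<Longrightarrow>
    coef (E v) (chainl (length v div 2) (rev v)) = 1"
proof (induction v rule: E.induct)
  case (1 a b v)
  let ?m = "length v div 2"
  have ev: "even (length v)" "length v = 2 * ?m" using 1 by auto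
  have "chainl (length (a # b # v) div 2) (rev (a # b # v)) = chainl ?m (rev v) @ [insert b (set v)]"
    using ev(2) by (simp add: chainl_Suc chainl_append)
  moreover have "insert b (set v) \<noteq> insert a (set v)" using 1(4) by auto
  ultimately show ?case using 1 ev by (simp add: lookup_minus lookup_snoc)
qed (auto simp: chainl_def)

context index_set
begin

lemma chain_chainl: "chain y = chainl ((r + 1) div 2) y"
  by (simp add: chain_def chainl_def)

text \<open>A descent at an odd \<open>t < r\<close> is a block that descends when read from the
  right. In odd length the descent at \<open>r\<close> says that the unpaired letter is positive, so
  that negating it lowers the word too.\<close>

lemma EE_support:
  assumes w: "w \<in> SB I" and s: "\<sigma> \<in> supp (EE w)"
  shows "\<exists>y' \<in> SB I. \<sigma> = chain y' \<and> (T \<subseteq> Des (rev w) \<longrightarrow> y' = rev w \<or> y' \<lless> rev w)"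
proof -
  have rw: "rev w \<in> SB I" by (rule SB_mset[OF w]) simp
  have lw: "length w = r" using w by (rule SB_length)
  have desc: "rev w ! (2 * i) > rev w ! (2 * i + 1)" if "T \<subseteq> Des (rev w)" "i < r div 2" for i
  proof -
    have "2 * i + 1 \<in> T" using that(2) by (auto simp: T_def)
    then have "2 * i + 1 \<in> Des (rev w)" using that(1) by blast
    moreover have "2 * i + 1 < r" using that(2) by linarith
    ultimately show ?thesis using lw by (simp add: Des_def nth_append)
  qed
  show ?thesis
  proof (cases "odd r")
    case False
    then obtain y' where "mset y' = mset (rev w)" "\<sigma> = chainl (r div 2) y'"
      "T \<subseteq> Des (rev w) \<Longrightarrow> y' = rev w \<or> y' \<lless> rev w"
      using E_support[of w \<sigma>] s lw desc by (auto simp: EE_def)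
    then show ?thesis using SB_mset[OF rw] False by (auto simp: chain_chainl)
  next
    case True
    then obtain a v where wa: "w = a # v" using lw by (cases w) auto
    let ?m = "r div 2"
    have ev: "even (length v)" "length v div 2 = ?m" "length v = 2 * ?m" "(r + 1) div 2 = Suc ?m"
      using True lw wa by (auto simp: lw[symmetric])
    obtain \<tau> c where \<tau>: "\<tau> \<in> supp (E v)" "\<sigma> = \<tau> @ [set (c # v)]" "c = a \<or> c = - a"
    proof -
      have "EE w = snoc (set (a # v)) (E v) - snoc (set (- a # v)) (E v)"
        using ev(1) by (simp add: EE_def wa)
      then show thesis using s that by (metis keys_snoc_diffE)
    qed
    obtain y' where y': "mset y' = mset (rev v)" "\<tau> = chainl ?m y'"
      "(\<forall>i < ?m. rev v ! (2 * i) > rev v ! (2 * i + 1)) \<longrightarrow> y' = rev v \<or> y' \<lless> rev v"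
      using E_support[OF ev(1) \<tau>(1)] ev(2) by auto
    have ly: "length y' = 2 * ?m" "set y' = set v"
      using mset_eq_length[OF y'(1)] mset_eq_setD[OF y'(1)] ev by auto
    have "y' @ [a] \<in> SB I" using y'(1) by (intro SB_mset[OF rw]) (simp add: wa)
    then have "y' @ [c] \<in> SB I" by (rule SB_abs) (use \<tau>(3) in auto)
    moreover have "\<sigma> = chain (y' @ [c])"
      unfolding chain_chainl ev(4) using ly y'(2) \<tau>(2) by (simp add: chainl_Suc chainl_append)
    moreover have "y' @ [c] = rev w \<or> y' @ [c] \<lless> rev w" if D: "T \<subseteq> Des (rev w)"
    proof -
      have lv: "r - 1 = length v" "0 < r" using lw unfolding wa by auto
      have "r \<in> Des (rev w)" using D True by (auto simp: T_def)
      then have "(rev w @ [0]) ! r < (rev w @ [0]) ! (r - 1)" by (simp add: Des_def)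
      moreover have "(rev w @ [0]) ! r = 0" using lw by (metis length_rev nth_append_length)
      moreover have "(rev w @ [0]) ! (r - 1) = a" unfolding wa lv by (simp add: nth_append)
      ultimately have "0 < a" by simp
      have "rev v ! (2 * i) > rev v ! (2 * i + 1)" if "i < ?m" for i
        using desc[OF D that] that ev(3) by (simp add: wa nth_append)
      then have "y' = rev v \<or> y' \<lless> rev v" using y'(3) by blast
      then show ?thesis
      proof
        assume "y' = rev v"
        then show ?thesis using \<tau>(3) \<open>0 < a\<close> lless_append_last[of "- a" a "rev v" "[]" "[]"]
          by (auto simp: wa)
      next
        assume "y' \<lless> rev v"
        then have "y' @ [c] \<lless> rev v @ [a]" using ly ev by (intro lless_append) auto
        then show ?thesis by (simp add: wa)
      qed
    qed
    ultimately show ?thesis by blast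
  qed
qed

lemma EE_leading:
  assumes w: "w \<in> SB I"
  shows "coef (EE w) (chain (rev w)) = 1"
proof (cases "odd r")
  case False
  then show ?thesis using E_leading[of w] SB_distinct[OF w] SB_length[OF w]
    by (simp add: EE_def chain_chainl)
next
  case True
  have lw: "length w = r" using w by (rule SB_length)
  then obtain a v where wa: "w = a # v" using True by (cases w) auto
  let ?m = "r div 2"
  have ev: "even (length v)" "length v div 2 = ?m" "length v = 2 * ?m" "(r + 1) div 2 = Suc ?m"
    using True lw wa by (auto simp: lw[symmetric])
  have "chain (rev w) = chainl ?m (rev v) @ [insert a (set v)]"
    unfolding chain_chainl ev(4) using ev(3) by (simp add: chainl_Suc chainl_append wa)
  moreover have "insert a (set v) \<noteq> insert (- a) (set v)"
    using SB_distinct[OF w] SB_nz[OF w, of a] by (auto simp: wa)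
  ultimately show ?thesis using E_leading[OF ev(1)] SB_distinct[OF w] True lw ev(2)
    by (simp add: EE_def wa lookup_minus lookup_snoc)
qed

lemma chain_props:
  assumes "y \<in> SB I"
  shows "chain y \<in> simplices K (top_deg I)" "chain y \<in> K" "outer (chain y) = []" "compat y (chain y)"
    "card ` set (chain y) = T"
proof -
  have le: "2 * i - 1 \<le> r" if "i \<in> set [1..<Suc ((r + 1) div 2)]" for i using that by auto
  have T: "2 * i - 1 \<in> T" if "i \<in> set [1..<Suc ((r + 1) div 2)]" for i unfolding T_image using that by (rule imageI)
  show c: "compat y (chain y)"
    unfolding compat_def chain_def using card_take[OF assms le] by auto
  have "card ` set (chain y) = (\<lambda>i. 2 * i - 1) ` set [1..<Suc ((r + 1) div 2)]"
    unfolding chain_def set_map image_image using card_take[OF assms le] by (intro image_cong) auto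
  then show "card ` set (chain y) = T" unfolding T_image .
  show "outer (chain y) = []"
    unfolding filter_empty_conv chain_def using vert_take(2)[OF assms T] by auto
  show K: "chain y \<in> K"
    unfolding K_iff using sorted_chain[OF assms] vert_take(1)[OF assms T] by (auto simp: chain_def)
  then show "chain y \<in> simplices K (top_deg I)"
    by (simp add: simplices_def length_chain top_deg_eq)
qed

lemma EE_cycle:
  assumes "w \<in> SB I"
  shows "EE w \<in> cycles K (top_deg I)"
proof -
  have "supp (EE w) \<subseteq> simplices K (top_deg I)"
    using EE_support[OF assms] chain_props(1) by blast
  then show ?thesis by (simp add: cycles_def free_space_def bd_EE)
qed

definition \<zeta> :: "int set list \<Rightarrow> (int set list \<Rightarrow>\<^sub>0 rat)" where "\<zeta> \<sigma> = EE (rev (lab \<sigma>))"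

text \<open>Other words may have the same odd prefixes as \<open>y\<close>; the label is the least
  of them.\<close>

lemma \<mu>_chain:
  assumes "y \<in> SB I" shows "\<mu> (chain y) = rk (lab (chain y))" "rk (lab (chain y)) \<le> rk y"
proof -
  note c = chain_props[OF assms]
  show "\<mu> (chain y) = rk (lab (chain y))" using c(3) by (simp add: \<mu>_def)
  have "lab (chain y) = y \<or> lab (chain y) \<lless> y"
    using inner(1,2)[OF c(2,3)] c(4) assms by (intro lab_le) auto
  then show "rk (lab (chain y)) \<le> rk y" using rk_mono[OF inner(4)[OF c(2,3)]] by fastforce
qed

text \<open>Every other simplex of the cycle is the chain of a word strictly below the label of
  \<open>\<sigma>\<close>, and its own label is at most that word. A critical chain has one member
  for each odd size, which fixes its degree.\<close>

lemma zeta: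
  assumes "\<sigma> \<in> simplices K k" "crit \<sigma>"
  shows "\<zeta> \<sigma> \<in> cycles K k" "coef (\<zeta> \<sigma>) \<sigma> = 1"
    "\<And>\<tau>. \<tau> \<in> supp (\<zeta> \<sigma>) \<Longrightarrow> \<tau> \<noteq> \<sigma> \<Longrightarrow> \<mu> \<tau> < \<mu> \<sigma>" "k = top_deg I"
proof -
  have sK: "\<sigma> \<in> K" using assms by (simp add: simplices_def)
  note c = crit_chain[OF sK assms(2)]
  let ?y = "lab \<sigma>"
  have w: "rev ?y \<in> SB I" by (rule SB_mset[OF c(2)]) simp
  have "length \<sigma> = (r + 1) div 2" using c(1) length_chain by metis
  then show k: "k = top_deg I" using assms(1) top_deg_eq by (simp add: simplices_def)
  show "\<zeta> \<sigma> \<in> cycles K k" unfolding \<zeta>_def k by (rule EE_cycle[OF w])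
  show "coef (\<zeta> \<sigma>) \<sigma> = 1"
    using EE_leading[OF w] c(1) by (simp add: \<zeta>_def)
  fix \<tau> assume \<tau>: "\<tau> \<in> supp (\<zeta> \<sigma>)" "\<tau> \<noteq> \<sigma>"
  then obtain y' where y': "y' \<in> SB I" "\<tau> = chain y'" "y' = ?y \<or> y' \<lless> ?y"
    using EE_support[OF w, of \<tau>] c(3) by (auto simp: \<zeta>_def)
  then have "y' \<lless> ?y" using \<tau>(2) c(1) by auto
  then have "rk y' < rk ?y" using rk_mono y'(1) by blast
  moreover have "\<mu> \<sigma> = rk ?y" using assms(2) by (simp add: \<mu>_def crit_def)
  ultimately show "\<mu> \<tau> < \<mu> \<sigma>" using \<mu>_chain[OF y'(1)] y'(2) by simp
qed

lemma cycle_reduction: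
  assumes "z \<in> cycles K k"
  shows "\<exists>b c. b \<in> boundaries K k \<and> c \<in> carrier (free_space {\<sigma> \<in> simplices K k. crit \<sigma>}) \<and>
    z = b + linear_ext \<zeta> c"
proof (rule morse_reduction[where \<mu> = \<mu> and V = V])
  show "distinct \<sigma>" if "\<sigma> \<in> K" for \<sigma> using that sorted_psubset_distinct by (auto simp: K_iff)
  show "\<sigma> = \<tau>" if "\<sigma> \<in> K" "\<tau> \<in> K" "set \<sigma> = set \<tau>" for \<sigma> \<tau>
    using that sorted_psubset_unique by (auto simp: K_iff)
  show "face_closed K" by (rule face_closed_K)
  show "z \<in> cycles K k" by (rule assms)
  show "\<mu> (a @ b) = \<mu> (a @ x # b)"
    if "a @ x # b \<in> K" "\<not> crit (a @ x # b)" "V (a @ x # b) = x" for a x b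
    using that by (rule matching_delete)
  show "\<zeta> \<sigma> \<in> cycles K k \<and> coef (\<zeta> \<sigma>) \<sigma> = 1 \<and>
      (\<forall>\<tau> \<in> supp (\<zeta> \<sigma>). \<tau> \<noteq> \<sigma> \<longrightarrow> \<mu> \<tau> < \<mu> \<sigma>)"
    if "\<sigma> \<in> simplices K k" "crit \<sigma>" for \<sigma>
    using zeta(1-3)[OF that] by simp
qed (rule matching_face matching_insert; assumption)+

text \<open>There are no critical chains in these degrees, so the Morse reduction leaves only a
  boundary.\<close>

lemma lower_cycles_boundaries:
  assumes "k \<noteq> top_deg I"
  shows "cycles K k \<subseteq> boundaries K k"
proof
  fix z assume "z \<in> cycles K k"
  from cycle_reduction[OF this] obtain b c where
    bc: "b \<in> boundaries K k" "c \<in> carrier (free_space {\<sigma> \<in> simplices K k. crit \<sigma>})" "z = b + linear_ext \<zeta> c"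
    by blast
  have "{\<sigma> \<in> simplices K k. crit \<sigma>} = {}" using zeta(4) assms by blast
  with bc(2) have "c \<in> carrier (free_space {})" by (simp only:)
  then have "c = 0" by (simp add: free_space_def)
  then show "z \<in> boundaries K k" using bc by simp
qed

end

section \<open>The relations\<close>

text \<open>The effect on \<open>E\<close> of blocks to the left of a tail with letters
  \<open>S\<close>. It sees the tail's letters only through \<open>S\<close>, so a relation between
  tails on the same letters can be checked with nothing to their left.\<close>

fun prefix_op :: "int list \<Rightarrow> int set \<Rightarrow> (int set list \<Rightarrow>\<^sub>0 rat) \<Rightarrow> (int set list \<Rightarrow>\<^sub>0 rat)" where
  "prefix_op (a # b # u) S x =
    snoc (set (b # u) \<union> S) (prefix_op u S x) - snoc (set (a # u) \<union> S) (prefix_op u S x)"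
| "prefix_op u S x = x"

definition prefix_ext :: "int list \<Rightarrow> int set \<Rightarrow> (int set list \<Rightarrow>\<^sub>0 rat) \<Rightarrow> (int set list \<Rightarrow>\<^sub>0 rat)" where
  "prefix_ext u S x = (if odd (length u)
    then snoc (set u \<union> S) (prefix_op (tl u) S x) - snoc (set (- hd u # tl u) \<union> S) (prefix_op (tl u) S x)
    else prefix_op u S x)"

lemma prefix_op_add: "prefix_op u S (x + y) = prefix_op u S x + prefix_op u S y"
  by (induction u rule: swap_pairs.induct) (simp_all add: snoc_add)

lemma prefix_op_diff: "prefix_op u S (x - y) = prefix_op u S x - prefix_op u S y"
  by (induction u rule: swap_pairs.induct) (simp_all add: snoc_diff)

lemma prefix_op_zero: "prefix_op u S 0 = 0"
  by (induction u rule: swap_pairs.induct) simp_all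

lemma prefix_ext_add: "prefix_ext u S (x + y) = prefix_ext u S x + prefix_ext u S y"
  by (simp add: prefix_ext_def prefix_op_add snoc_add)

lemma prefix_ext_diff: "prefix_ext u S (x - y) = prefix_ext u S x - prefix_ext u S y"
  by (simp add: prefix_ext_def prefix_op_diff snoc_diff)

lemma prefix_ext_zero: "prefix_ext u S 0 = 0"
  by (simp add: prefix_ext_def prefix_op_zero)

lemma E_append: "even (length u) \<Longrightarrow> E (u @ t) = prefix_op u (set t) (E t)"
  by (induction u rule: swap_pairs.induct) simp_all

lemma EE_append:
  assumes "even (length t)"
  shows "EE (u @ t) = prefix_ext u (set t) (E t)"
proof (cases "odd (length u)")
  case True
  then obtain a v where "u = a # v" by (cases u) auto
  then show ?thesis using True assms E_append[of v t] by (simp add: EE_def prefix_ext_def)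
qed (use assms E_append[of u t] in \<open>simp add: EE_def prefix_ext_def\<close>)

lemma EE_H1:
  assumes "even (length v)"
  shows "EE (u @ [a, b] @ v) + EE (u @ [b, a] @ v) = 0"
proof -
  let ?S = "insert a (insert b (set v))"
  have "EE (u @ [a, b] @ v) = prefix_ext u ?S (E ([a, b] @ v))"
    using assms EE_append[of "[a, b] @ v" u] by simp
  moreover have "EE (u @ [b, a] @ v) = prefix_ext u ?S (E ([b, a] @ v))"
    using assms EE_append[of "[b, a] @ v" u] by (simp add: insert_commute)
  ultimately have "EE (u @ [a, b] @ v) + EE (u @ [b, a] @ v) = prefix_ext u ?S (E ([a, b] @ v) + E ([b, a] @ v))"
    by (simp only: prefix_ext_add)
  also have "E ([a, b] @ v) + E ([b, a] @ v) = 0" by simp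
  finally show ?thesis by (simp only: prefix_ext_zero)
qed

text \<open>Generic in \<open>f\<close>, so that one formula serves the basis elements, the cycles
  \<open>EE\<close> and the sign-adjusted words; \<open>H5_sum\<close> likewise.\<close>

definition H2_sum ::
    "(int list \<Rightarrow> 'x::ab_group_add) \<Rightarrow> int list \<Rightarrow> int \<Rightarrow> int \<Rightarrow> int \<Rightarrow> int \<Rightarrow> int list \<Rightarrow> 'x" where
  "H2_sum f u a b c d v = f (u @ [a, b, c, d] @ v) - f (u @ [a, c, b, d] @ v) + f (u @ [b, c, a, d] @ v)
      + f (u @ [a, d, b, c] @ v) - f (u @ [b, d, a, c] @ v) + f (u @ [c, d, a, b] @ v)"

definition H5_sum ::
    "(int list \<Rightarrow> 'x::ab_group_add) \<Rightarrow> int \<Rightarrow> int \<Rightarrow> int \<Rightarrow> int list \<Rightarrow> 'x" where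
  "H5_sum f a b c v = f ([a, b, c] @ v) - f ([a, - b, c] @ v)
      + f ([a, - c, b] @ v) - f ([a, - c, - b] @ v)
      - f ([b, a, c] @ v) + f ([b, - a, c] @ v)
      - f ([b, - c, a] @ v) + f ([b, - c, - a] @ v)
      + f ([c, a, b] @ v) - f ([c, - a, b] @ v)
      + f ([c, - b, a] @ v) - f ([c, - b, - a] @ v)"

lemma rel_H2_eq: "rel_H2 I = {H2_sum basis u a b c d v | u a b c d v.
    u @ [a, b, c, d] @ v \<in> SB I \<and> even (length v)}"
  unfolding rel_H2_def H2_sum_def ..

lemma rel_H5_eq: "rel_H5 I = {H5_sum basis a b c v | a b c v.
    [a, b, c] @ v \<in> SB I \<and> even (length v)}"
  unfolding rel_H5_def H5_sum_def ..

text \<open>With \<open>u\<close> removed, a simplex is given over the chains of \<open>v\<close> by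
  the one letter added first and the one letter missing from the triple above it. It arises from two
  of the six terms, which differ by exchanging the other two letters and have opposite
  signs.\<close>

lemma EE_H2:
  assumes "even (length v)"
  shows "H2_sum EE u a b c d v = 0"
proof -
  let ?S = "insert a (insert b (insert c (insert d (set v))))"
  have P: "EE (u @ [p, q, s, t] @ v) = prefix_ext u ?S (E ([] @ [p, q, s, t] @ v))"
    if "{p, q, s, t} = {a, b, c, d}" for p q s t
  proof -
    have "set ([p, q, s, t] @ v) = {p, q, s, t} \<union> set v" by simp
    also have "\<dots> = ?S" unfolding that by simp
    finally show ?thesis using EE_append[of "[p, q, s, t] @ v" u] assms by simp
  qed
  have "H2_sum EE u a b c d v = prefix_ext u ?S (H2_sum E [] a b c d v)"
    unfolding H2_sum_def prefix_ext_add prefix_ext_diff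
    by (intro arg_cong2[of _ _ _ _ "(+)"] arg_cong2[of _ _ _ _ "(-)"] P) auto
  also have "H2_sum E [] a b c d v = 0"
    by (simp add: H2_sum_def snoc_diff insert_commute)
  finally show ?thesis by (simp only: prefix_ext_zero)
qed

lemma EE_H3: "even (length v) \<Longrightarrow> EE (a # v) + EE (- a # v) = 0"
  by (simp add: EE_def)

lemma EE_H4:
  "even (length v) \<Longrightarrow>
    EE ([a, b] @ v) - EE ([a, - b] @ v) + EE ([b, - a] @ v) - EE ([- b, - a] @ v) = 0"
  by (simp add: EE_def)

lemma EE_H5: "even (length v) \<Longrightarrow> H5_sum EE a b c v = 0"
  by (simp add: H5_sum_def EE_def snoc_diff insert_commute)

text \<open>All six words have the same length, so \<open>sg\<close> applies one and the same sign
  to every letter of the relation.\<close>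

lemma H2_sum_sg:
  fixes u v :: "int list"
  defines "s \<equiv> if odd (length (u @ v)) then (\<lambda>x. x) else uminus"
  shows "H2_sum (\<lambda>w. f (sg w)) u a b c d v = H2_sum f (map s u) (s a) (s b) (s c) (s d) (map s v)"
    "sg (u @ [a, b, c, d] @ v) = map s u @ [s a, s b, s c, s d] @ map s v"
  by (simp_all add: H2_sum_def sg_def s_def)

lemma H5_sum_sg: "even (length v) \<Longrightarrow> H5_sum (\<lambda>w. f (sg w)) a b c v = H5_sum f a b c v"
  by (simp add: H5_sum_def sg_def)

abbreviation "FC \<equiv> linear_ext fund_cycle"

lemma FC_MB:
  assumes "f \<in> MB I"
  shows "FC f = 0"
proof -
  let ?N = "{f. FC f = 0}"
  have sub: "qvs.subspace ?N"
    by (auto simp: qvs.subspace_def linear_ext_add linear_ext_qscale)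
  have h1: "rel_H1 I \<subseteq> ?N"
  proof (clarsimp simp: rel_H1_def linear_ext_add fund_cycle_EE)
    fix u v :: "int list" and a b assume v: "even (length v)"
    show "EE (sg (u @ a # b # v)) + EE (sg (u @ b # a # v)) = 0"
      using EE_H1[OF v, of u a b] EE_H1[of "map uminus v" "map uminus u" "- a" "- b"] v
      by (simp add: sg_def)
  qed
  have h2: "rel_H2 I \<subseteq> ?N"
  proof (clarsimp simp: rel_H2_eq)
    fix u v :: "int list" and a b c d assume "even (length v)"
    then have "H2_sum (\<lambda>w. EE (sg w)) u a b c d v = 0" unfolding H2_sum_sg by (intro EE_H2) simp
    then show "FC (H2_sum basis u a b c d v) = 0"
      by (simp only: H2_sum_def linear_ext_add linear_ext_diff linear_ext_basis fund_cycle_EE)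
  qed
  have h3: "rel_H3 I \<subseteq> ?N"
  proof (clarsimp simp: rel_H3_def linear_ext_add fund_cycle_EE)
    fix v :: "int list" and a assume v: "even (length v)"
    show "EE (sg (a # v)) + EE (sg (- a # v)) = 0"
      using EE_H3[OF v, of a] v by (simp add: sg_def)
  qed
  have h4: "rel_H4 I \<subseteq> ?N"
  proof
    fix x assume "x \<in> rel_H4 I"
    then show "x \<in> ?N"
      unfolding rel_H4_def
    proof (elim CollectE exE conjE, intro CollectI)
      fix a b v
      assume x: "x = basis ([a, b] @ v) - basis ([a, - b] @ v) + basis ([b, - a] @ v) - basis ([- b, - a] @ v)"
        and v: "even (length v)"
      have s: "sg ([p, q] @ v) = [- p, - q] @ map uminus v" for p q using v by (simp add: sg_def)
      have "even (length (map uminus v))" using v by simp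
      \<comment> \<open>Even length makes \<open>sg\<close> negate all letters, which turns the
        relation into the one for \<open>- a\<close> and \<open>- b\<close>.\<close>
      from EE_H4[OF this, of "- a" "- b"] show "FC x = 0"
        unfolding x linear_ext_add linear_ext_diff linear_ext_basis fund_cycle_EE s .
    qed
  qed
  have h5: "rel_H5 I \<subseteq> ?N"
  proof (clarsimp simp: rel_H5_eq)
    fix v :: "int list" and a b c assume v: "even (length v)"
    have "H5_sum (\<lambda>w. EE (sg w)) a b c v = 0" unfolding H5_sum_sg[OF v] by (rule EE_H5[OF v])
    then show "FC (H5_sum basis a b c v) = 0"
      by (simp only: H5_sum_def linear_ext_add linear_ext_diff linear_ext_basis fund_cycle_EE)
  qed
  have "MB I \<subseteq> ?N" unfolding MB_def
    using h1 h2 h3 h4 h5 by (intro qvs.span_minimal sub) blast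
  then show ?thesis using assms by blast
qed

section \<open>Straightening\<close>

text \<open>Written for the reversed word, where it is a condition on descents; in the word itself
  the blocks ascend.\<close>

definition normal_blocks :: "int list \<Rightarrow> bool" where
  "normal_blocks v \<longleftrightarrow> (\<forall>i < length v div 2. rev v ! (2 * i + 1) < rev v ! (2 * i))"

lemma normal_blocks_Cons:
  assumes "even (length v)"
  shows "normal_blocks (a # b # v) \<longleftrightarrow> a < b \<and> normal_blocks v"
proof -
  have l: "length (rev v) = 2 * (length v div 2)" using assms by simp
  have "rev (a # b # v) ! (2 * i + 1) = rev v ! (2 * i + 1) \<and> rev (a # b # v) ! (2 * i) = rev v ! (2 * i)"
    if "i < length v div 2" for i
    using that l by (simp add: nth_append)
  moreover have "rev (a # b # v) ! (2 * (length v div 2) + 1) = a" "rev (a # b # v) ! (2 * (length v div 2)) = b"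
    using l by (simp_all add: nth_append)
  ultimately show ?thesis by (auto simp: normal_blocks_def All_less_Suc)
qed

lemma normal_blocks_append:
  "even (length u) \<Longrightarrow> even (length v) \<Longrightarrow>
    normal_blocks (u @ v) \<longleftrightarrow> normal_blocks u \<and> normal_blocks v"
proof (induction u rule: swap_pairs.induct)
  case (1 a b u)
  then show ?case using normal_blocks_Cons[of "u @ v" a b] normal_blocks_Cons[of u a b] by simp
qed (auto simp: normal_blocks_def)

definition normal :: "int list \<Rightarrow> bool" where
  "normal w \<longleftrightarrow> (if odd (length w) then 0 < hd w \<and> normal_blocks (tl w) else normal_blocks w)"

lemma normal_append:
  assumes "even (length v)"
  shows "normal (u @ v) \<longleftrightarrow> normal u \<and> normal_blocks v"
proof (cases "odd (length u)")
  case True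
  then obtain a u' where "u = a # u'" by (cases u) auto
  then show ?thesis using True assms normal_blocks_append[of u' v] by (auto simp: normal_def)
next
  case False
  then show ?thesis using assms normal_blocks_append[of u v] by (auto simp: normal_def)
qed

lemma normal_blocks_Nil: "normal_blocks []" by (simp add: normal_blocks_def)

lemma normal_blocks_2: "normal_blocks [a, b] \<longleftrightarrow> a < b"
  using normal_blocks_Cons[of "[]" a b] by (simp add: normal_blocks_Nil)

lemma normal_blocks_4: "normal_blocks [a, b, c, d] \<longleftrightarrow> a < b \<and> c < d"
  using normal_blocks_Cons[of "[c, d]" a b] by (simp add: normal_blocks_2)

lemma not_normal_blocks:
  "even (length v) \<Longrightarrow> \<not> normal_blocks v \<Longrightarrow> \<exists>u a b t. v = u @ [a, b] @ t \<and> even (length t) \<and> \<not> a < b"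
proof (induction v rule: swap_pairs.induct)
  case (1 a b v)
  show ?case
  proof (cases "a < b")
    case True
    then have "\<not> normal_blocks v" using 1(2,3) normal_blocks_Cons[of v a b] by simp
    then obtain u a' b' t where "v = u @ [a', b'] @ t" "even (length t)" "\<not> a' < b'" using 1 by auto
    then show ?thesis by (intro exI[of _ "a # b # u"]) auto
  next
    case False
    then show ?thesis using 1(2) by (intro exI[of _ "[]"] exI[of _ a] exI[of _ b] exI[of _ v]) auto
  qed
qed (auto simp: normal_blocks_def)

lemma not_normal:
  assumes "\<not> normal w"
  shows "(\<exists>u a b t. w = u @ [a, b] @ t \<and> even (length t) \<and> \<not> a < b) \<or>
    (\<exists>a v. w = a # v \<and> even (length v) \<and> \<not> 0 < a)"
proof (cases "odd (length w)")
  case True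
  then obtain a v where w: "w = a # v" by (cases w) auto
  then have v: "even (length v)" using True by simp
  show ?thesis
  proof (cases "0 < a")
    case True
    then have "\<not> normal_blocks v" using assms w v by (simp add: normal_def)
    from not_normal_blocks[OF v this] obtain u a' b' t where
      "v = u @ [a', b'] @ t" "even (length t)" "\<not> a' < b'" by blast
    then have "w = (a # u) @ [a', b'] @ t \<and> even (length t) \<and> \<not> a' < b'" using w by simp
    then show ?thesis by blast
  qed (use w v in blast)
next
  case False
  then show ?thesis using assms not_normal_blocks[of w] by (auto simp: normal_def)
qed

lemma lless_prefix: "x \<lless> y \<Longrightarrow> z @ x \<lless> z @ y"
  by (rule lexord_append_leftI)

context index_set
begin

text \<open>The odd positions below \<open>r\<close> are those inside the blocks; in odd length,
  position \<open>r\<close> compares the unpaired letter with the appended 0.\<close>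

lemma normal_iff:
  assumes "w \<in> SB I"
  shows "normal w \<longleftrightarrow> T \<subseteq> Des (rev w)"
proof -
  have lw: "length w = r" using assms by (rule SB_length)
  have mem: "2 * i + 1 \<in> Des (rev w) \<longleftrightarrow> rev w ! (2 * i + 1) < rev w ! (2 * i)" if "2 * i + 1 < r" for i
  proof -
    have "(rev w @ [0]) ! (2 * i + 1) = rev w ! (2 * i + 1)" "(rev w @ [0]) ! (2 * i) = rev w ! (2 * i)"
      using that lw by (simp_all add: nth_append)
    then show ?thesis using that lw by (simp add: Des_def)
  qed
  show ?thesis
  proof (cases "odd r")
    case False
    have "T \<subseteq> Des (rev w) \<longleftrightarrow> (\<forall>i < r div 2. 2 * i + 1 \<in> Des (rev w))"
    proof (intro iffI allI impI subsetI)
      fix t assume "\<forall>i < r div 2. 2 * i + 1 \<in> Des (rev w)" "t \<in> T"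
      then show "t \<in> Des (rev w)" using False by (auto simp: T_def elim!: oddE)
    qed (auto simp: T_def)
    then show ?thesis using mem False lw by (auto simp: normal_def normal_blocks_def)
  next
    case True
    then obtain a v where w: "w = a # v" using lw by (cases w) auto
    have r2: "r = 2 * (r div 2) + 1" using True by simp
    have l: "Suc (length v) = r" using lw w by simp
    then have "length v = 2 * (r div 2)" using r2 by linarith
    then have lv: "length v = r - 1" "length v div 2 = r div 2" "r = 2 * (r div 2) + 1"
      using r2 l by (linarith, simp, linarith)
    have D: "T \<subseteq> Des (rev w) \<longleftrightarrow> r \<in> Des (rev w) \<and> (\<forall>i < r div 2. 2 * i + 1 \<in> Des (rev w))"
    proof (intro iffI conjI allI impI subsetI)
      fix t assume h: "r \<in> Des (rev w) \<and> (\<forall>i < r div 2. 2 * i + 1 \<in> Des (rev w))" "t \<in> T"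
      show "t \<in> Des (rev w)"
      proof (cases "t = r")
        case False
        then have "t = 2 * (t div 2) + 1" "t < r" using h(2) True by (auto simp: T_def)
        moreover from this have "t div 2 < r div 2" using lv(3) by linarith
        ultimately show ?thesis using h(1) by metis
      qed (use h in simp)
    qed (use True in \<open>auto simp: T_def\<close>)
    have "(rev w @ [0]) ! r = 0" using lw by (metis length_rev nth_append_length)
    moreover have "(rev w @ [0]) ! (r - 1) = a" unfolding w lv(1)[symmetric] by (simp add: nth_append)
    moreover have "r \<in> {1..length (rev w)}" using l lw by simp
    ultimately have "r \<in> Des (rev w) \<longleftrightarrow> 0 < a" unfolding Des_def by simp
    moreover have "rev w ! (2 * i + 1) < rev w ! (2 * i) \<longleftrightarrow> rev v ! (2 * i + 1) < rev v ! (2 * i)"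
      if "i < r div 2" for i
    proof -
      have "2 * i + 1 < length (rev v)" using that lv by simp
      then show ?thesis by (simp add: w nth_append)
    qed
    moreover have "normal w \<longleftrightarrow> 0 < a \<and> (\<forall>i < r div 2. rev v ! (2 * i + 1) < rev v ! (2 * i))"
      unfolding normal_def normal_blocks_def using True lw w lv(2) by simp
    moreover have "2 * i + 1 < r" if "i < r div 2" for i using that lv(3) by linarith
    ultimately show ?thesis unfolding D using mem by blast
  qed
qed

text \<open>\<open>s\<close> stands for odd \<open>r\<close>, and \<open>e\<close> in
  \<open>alternation_test\<close> for an even index; so abstracted, the comparisons are a finite
  case check.\<close>

lemma sign_test:
  fixes x :: int
  shows "x \<noteq> 0 \<Longrightarrow> P = (0 < (if s then 1 else - 1) * x) \<Longrightarrow> (P = s) = (0 < x)"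
  by (cases s) auto

lemma alternation_test:
  fixes x y :: int
  shows "x \<noteq> y \<Longrightarrow> P = ((if s then 1 else - 1) * x < (if s then 1 else - 1) * y) \<Longrightarrow>
    Q = (if s then \<not> e else e) \<Longrightarrow> (P = Q) = (if e then y < x else x < y)"
  by (cases s; cases e) auto

text \<open>Letters \<open>j\<close> and \<open>Suc j\<close> are compared at position
  \<open>r - 1 - j\<close> of the reversed word. The parity of this position depends on that of
  \<open>r\<close>, and so does the sign applied by \<open>sg\<close>; the two effects
  cancel.\<close>

lemma snakes_iff: "w \<in> snakes I \<longleftrightarrow> w \<in> SB I \<and> Des (rev (sg w)) = T"
proof (cases "w \<in> SB I")
  case True
  have lw: "length w = r" using True by (rule SB_length)
  let ?y = "rev (sg w)" and ?s = "if odd r then 1 else (-1::int)"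
  have yn: "?y ! (r - 1 - j) = ?s * w ! j" if "j < r" for j
    using that lw by (simp add: rev_nth sg_def)
  have ly: "length ?y = r" using lw by simp
  have A: "r - 1 - j \<in> Des ?y \<longleftrightarrow> ?s * w ! j < ?s * w ! Suc j" if "Suc j < r" for j
  proof -
    have "(?y @ [0]) ! (r - 1 - j) = ?s * w ! j" "(?y @ [0]) ! (r - 1 - j - 1) = ?s * w ! Suc j"
      using yn[of j] yn[of "Suc j"] that ly by (simp_all add: nth_append)
    moreover have "r - 1 - j \<in> {1..length ?y}" using that unfolding ly by auto
    ultimately show ?thesis unfolding Des_def by simp
  qed
  have B: "r \<in> Des ?y \<longleftrightarrow> 0 < ?s * w ! 0" if "0 < r"
  proof -
    have "(?y @ [0]) ! r = 0" using ly by (metis nth_append_length)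
    moreover have "(?y @ [0]) ! (r - 1) = ?s * w ! 0" using yn[of 0] that ly by (simp add: nth_append)
    ultimately show ?thesis using that unfolding Des_def ly by simp
  qed
  have ne: "w ! j \<noteq> w ! Suc j" if "Suc j < r" for j
    using that SB_distinct[OF True] lw by (simp add: nth_eq_iff_index_eq)
  have nz: "w ! 0 \<noteq> 0" if "0 < r" using SB_nz[OF True, of "w ! 0"] that lw by simp
  have "Des ?y \<subseteq> {1..r}" unfolding Des_def ly by auto
  moreover have "T = {t \<in> {1..r}. odd t}" by (auto simp: T_def odd_pos Suc_le_eq)
  ultimately have "Des ?y = T \<longleftrightarrow> (\<forall>t \<in> {1..r}. t \<in> Des ?y \<longleftrightarrow> odd t)" by blast
  also have "\<dots> \<longleftrightarrow> (0 < r \<longrightarrow> (r \<in> Des ?y \<longleftrightarrow> odd r)) \<and>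
      (\<forall>j. Suc j < r \<longrightarrow> (r - 1 - j \<in> Des ?y \<longleftrightarrow> odd (r - 1 - j)))"
  proof (rule iffI)
    assume h: "(0 < r \<longrightarrow> (r \<in> Des ?y \<longleftrightarrow> odd r)) \<and>
      (\<forall>j. Suc j < r \<longrightarrow> (r - 1 - j \<in> Des ?y \<longleftrightarrow> odd (r - 1 - j)))"
    show "\<forall>t \<in> {1..r}. t \<in> Des ?y \<longleftrightarrow> odd t"
    proof
      fix t assume t: "t \<in> {1..r}"
      show "t \<in> Des ?y \<longleftrightarrow> odd t"
      proof (cases "t = r")
        case True
        then have "0 < r" using t by simp
        then show ?thesis using h True by blast
      next
        case False
        then have "Suc (r - 1 - t) < r" "r - 1 - (r - 1 - t) = t" using t by auto
        then show ?thesis using h by metis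
      qed
    qed
  next
    assume h: "\<forall>t \<in> {1..r}. t \<in> Des ?y \<longleftrightarrow> odd t"
    have "r \<in> {1..r}" if "0 < r" using that by simp
    moreover have "r - 1 - j \<in> {1..r}" if "Suc j < r" for j using that by auto
    ultimately show "(0 < r \<longrightarrow> (r \<in> Des ?y \<longleftrightarrow> odd r)) \<and>
      (\<forall>j. Suc j < r \<longrightarrow> (r - 1 - j \<in> Des ?y \<longleftrightarrow> odd (r - 1 - j)))"
      using h by blast
  qed
  also have "\<dots> \<longleftrightarrow> (0 < r \<longrightarrow> 0 < w ! 0) \<and>
      (\<forall>j. Suc j < r \<longrightarrow> (if even j then w ! j > w ! Suc j else w ! j < w ! Suc j))"
  proof -
    have "(r \<in> Des ?y \<longleftrightarrow> odd r) \<longleftrightarrow> 0 < w ! 0" if "0 < r"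
      using nz[OF that] B[OF that] by (rule sign_test)
    then have e1: "(0 < r \<longrightarrow> (r \<in> Des ?y \<longleftrightarrow> odd r)) \<longleftrightarrow> (0 < r \<longrightarrow> 0 < w ! 0)" by blast
    have e2: "(r - 1 - j \<in> Des ?y \<longleftrightarrow> odd (r - 1 - j)) \<longleftrightarrow>
        (if even j then w ! j > w ! Suc j else w ! j < w ! Suc j)" if j: "Suc j < r" for j
    proof -
      have "odd (r - 1 - j) \<longleftrightarrow> (if odd r then odd j else even j)" using j by auto
      with ne[OF j] A[OF j] show ?thesis by (rule alternation_test)
    qed
    have "(\<forall>j. Suc j < r \<longrightarrow> (r - 1 - j \<in> Des ?y \<longleftrightarrow> odd (r - 1 - j))) \<longleftrightarrow>
        (\<forall>j. Suc j < r \<longrightarrow> (if even j then w ! j > w ! Suc j else w ! j < w ! Suc j))"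
      by (intro all_cong1 imp_cong[OF refl]) (rule e2)
    with e1 show ?thesis by (simp only:)
  qed
  also have "\<dots> \<longleftrightarrow> w \<in> snakes I"
  proof -
    have "0 < r \<longleftrightarrow> w \<noteq> []" unfolding lw[symmetric] by simp
    moreover have "w \<noteq> [] \<Longrightarrow> hd w = w ! 0" by (rule hd_conv_nth)
    ultimately have "(w \<noteq> [] \<longrightarrow> 0 < hd w) \<longleftrightarrow> (0 < r \<longrightarrow> 0 < w ! 0)" by auto
    with True show ?thesis by (simp only: snakes_def mem_Collect_eq lw simp_thms)
  qed
  finally show ?thesis using True by blast
qed (simp add: snakes_def)

lemma SB_uminus: "w \<in> SB I \<Longrightarrow> map uminus w \<in> SB I"
  by (rule SB_abs) auto

lemma SB_sg: "w \<in> SB I \<Longrightarrow> sg w \<in> SB I"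
  by (simp add: sg_def SB_uminus)

lemma SB_rev: "w \<in> SB I \<Longrightarrow> rev w \<in> SB I"
  by (rule SB_mset) auto

section \<open>Reduction of sign-adjusted words to snakes modulo the relations\<close>

abbreviation sbasis :: "int list \<Rightarrow> (int list \<Rightarrow>\<^sub>0 rat)" where "sbasis w \<equiv> basis (sg w)"

lemma MB_rel:
  "x \<in> rel_H1 I \<Longrightarrow> x \<in> MB I" "x \<in> rel_H2 I \<Longrightarrow> x \<in> MB I" "x \<in> rel_H3 I \<Longrightarrow> x \<in> MB I"
  "x \<in> rel_H4 I \<Longrightarrow> x \<in> MB I" "x \<in> rel_H5 I \<Longrightarrow> x \<in> MB I"
  unfolding MB_def by (auto intro: qvs.span_base)

lemma sbasis_H1:
  assumes "u @ [a, b] @ v \<in> SB I" "even (length v)"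
  shows "sbasis (u @ [a, b] @ v) + sbasis (u @ [b, a] @ v) \<in> MB I"
proof -
  let ?f = "if odd (length (u @ v)) then (\<lambda>x. x) else (uminus :: int \<Rightarrow> int)"
  have s: "sg (u @ [p, q] @ v) = map ?f u @ [?f p, ?f q] @ map ?f v" for p q
    by (simp add: sg_def)
  have "sg (u @ [a, b] @ v) \<in> SB I" using assms(1) by (rule SB_sg)
  then show ?thesis unfolding s using assms(2)
    by (intro MB_rel(1)) (unfold rel_H1_def, rule CollectI, intro exI conjI, rule refl, assumption, simp)
qed

lemma sbasis_H2:
  assumes "u @ [a, b, c, d] @ v \<in> SB I" "even (length v)"
  shows "H2_sum sbasis u a b c d v \<in> MB I"
proof (rule MB_rel(2))
  show "H2_sum sbasis u a b c d v \<in> rel_H2 I"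
    unfolding H2_sum_sg(1)[where f = "\<lambda>w. basis w"] rel_H2_eq
    by (rule CollectI, intro exI conjI, rule refl, rule SB_sg[OF assms(1), unfolded H2_sum_sg(2)], simp add: assms(2))
qed

lemma sbasis_H3:
  assumes "a # v \<in> SB I" "even (length v)"
  shows "sbasis (a # v) + sbasis (- a # v) \<in> MB I"
  using assms by (intro MB_rel(3)) (auto simp: rel_H3_def sg_def)

lemma sbasis_H4:
  assumes "[a, b] @ v \<in> SB I" "even (length v)"
  shows "sbasis ([a, b] @ v) - sbasis ([a, - b] @ v) + sbasis ([b, - a] @ v) - sbasis ([- b, - a] @ v) \<in> MB I"
proof -
  have s: "sg ([p, q] @ v) = [- p, - q] @ map uminus v" for p q
    using assms(2) by (simp add: sg_def)
  have "sg ([a, b] @ v) \<in> SB I" using assms(1) by (rule SB_sg)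
  then show ?thesis unfolding s using assms(2)
    by (intro MB_rel(4)) (unfold rel_H4_def, rule CollectI, intro exI conjI, rule refl, assumption, simp)
qed

lemma sbasis_H5:
  assumes "[a, b, c] @ v \<in> SB I" "even (length v)"
  shows "H5_sum sbasis a b c v \<in> MB I"
proof (rule MB_rel(5))
  show "H5_sum sbasis a b c v \<in> rel_H5 I"
    unfolding H5_sum_sg[OF assms(2), where f = "\<lambda>w. basis w"] rel_H5_eq using assms by blast
qed

definition Sp :: "(int list \<Rightarrow>\<^sub>0 rat) set" where
  "Sp = qvs.span (MB I \<union> basis ` snakes I)"

lemma Sp_MB: "x \<in> MB I \<Longrightarrow> x \<in> Sp"
  unfolding Sp_def by (auto intro: qvs.span_base)

lemmas Sp_add = qvs.span_add[of _ "MB I \<union> basis ` snakes I", folded Sp_def]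
lemmas Sp_diff = qvs.span_diff[of _ "MB I \<union> basis ` snakes I", folded Sp_def]

lemma Sp_swap:
  assumes "x + y \<in> MB I" "y \<in> Sp" shows "x \<in> Sp"
proof -
  show ?thesis using Sp_diff[OF Sp_MB[OF assms(1)] assms(2)] by simp
qed

text \<open>A normal word that is no snake has a further descent, at an even \<open>t\<close>, to
  the left of the block \<open>cd\<close>. The cases are what stands there: another block, the
  unpaired letter, or nothing, when the appended 0 takes its place.\<close>

lemma nonsnake_cases:
  assumes w: "w \<in> SB I" and n: "normal w" and ns: "Des (rev w) \<noteq> T"
  obtains (four) u a b c d v where "w = u @ [a, b, c, d] @ v" "even (length v)" "normal u" "normal_blocks v"
      "a < b" "b < c" "c < d"
    | (three) a b c v where "w = [a, b, c] @ v" "even (length v)" "normal_blocks v" "0 < a" "a < b" "b < c"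
    | (two) a b v where "w = [a, b] @ v" "even (length v)" "normal_blocks v" "0 < a" "a < b"
proof -
  have lw: "length w = r" using w by (rule SB_length)
  have "T \<subseteq> Des (rev w)" using n normal_iff[OF w] by simp
  then obtain t where t: "t \<in> Des (rev w)" "t \<notin> T" using ns by blast
  then have t': "1 \<le> t" "t \<le> r" "even t" "(rev w @ [0]) ! t < (rev w @ [0]) ! (t - 1)"
    using lw by (auto simp: Des_def T_def)
  then have t2: "2 \<le> t" by (cases "t = 1") auto
  define U where "U = take (r - t) w"
  have wU: "w = U @ drop (r - t) w" by (simp add: U_def)
  have "length (drop (r - t) w) = t" using lw t' by simp
  then obtain c d v where V: "drop (r - t) w = c # d # v" "length v = t - 2"
    using t2 by (cases "drop (r - t) w"; cases "tl (drop (r - t) w)") auto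
  have wc: "w = U @ [c, d] @ v" using wU V by simp
  have ev: "even (length v)" "even (length ([c, d] @ v))" using V t' t2 by auto
  have nU: "normal U" "c < d" "normal_blocks v"
    using n normal_append[OF ev(2), of U] normal_blocks_Cons[OF ev(1), of c d] by (auto simp: wc)
  \<comment> \<open>In the reversed word, position \<open>t\<close> falls between \<open>c\<close>
    and the part coming from \<open>U\<close>, or between \<open>c\<close> and the appended 0 if
    \<open>U\<close> is empty.\<close>
  have rt: "rev w @ [0] = (rev v @ [d, c]) @ (rev U @ [0])" by (simp add: wc)
  have lt: "length (rev v @ [d, c]) = t" using V t2 by simp
  have "(rev w @ [0]) ! t = (rev U @ [0]) ! 0" unfolding rt using lt by (metis add.right_neutral nth_append_length_plus)
  moreover have "(rev w @ [0]) ! (t - 1) = c"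
  proof -
    have "t - 1 = Suc (length (rev v))" using V t2 by simp
    then show ?thesis by (simp add: wc nth_append)
  qed
  ultimately have lc: "(rev U @ [0]) ! 0 < c" using t'(4) by simp
  show thesis
  proof (cases U rule: rev_cases)
    case Nil
    then show thesis using lc two[of c d v] wc ev nU by simp
  next
    case (snoc u b)
    then have bc: "b < c" using lc by simp
    show thesis
    proof (cases u rule: rev_cases)
      case Nil
      then have "0 < b" using nU(1) snoc by (simp add: normal_def)
      then show thesis using three[of b c d v] wc ev nU bc snoc Nil by simp
    next
      case (snoc u' a)
      have U: "U = u' @ [a, b]" using \<open>U = u @ [b]\<close> snoc by simp
      have "normal u'" "a < b" using nU(1) normal_append[of "[a, b]" u'] by (auto simp: U normal_blocks_2)
      then show thesis using four[of u' a b c d v] wc ev nU bc U by simp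
    qed
  qed
qed

text \<open>Read from the right, the increasing word is the largest in its relation: every other
  term ends in a smaller letter, or in the same letter preceded by a smaller one.\<close>

lemma straighten_normal:
  assumes "w \<in> SB I" "normal w"
  shows "sbasis w \<in> Sp"
  using assms
proof (induction "rk (rev w)" arbitrary: w rule: less_induct)
  case less
  have IH: "sbasis w' \<in> Sp" if "w' \<in> SB I" "normal w'" "rev w' \<lless> rev w" for w'
    using that less(1) rk_mono[OF SB_rev[OF that(1)]] by blast
  show ?case
  proof (cases "Des (rev w) = T")
    case True
    then have "sg w \<in> snakes I" using SB_sg[OF less(2)] by (simp add: snakes_iff)
    then show ?thesis unfolding Sp_def by (auto intro: qvs.span_base)
  next
    case False
    from less(2,3) False show ?thesis
    proof (cases rule: nonsnake_cases)
      case (four u a b c d v)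
      have I: "sbasis (u @ [p, q, s, t] @ v) \<in> Sp"
        if "mset [p, q, s, t] = mset [a, b, c, d]" "p < q" "s < t" "t < d \<or> (t = d \<and> s < c)" for p q s t
      proof (rule IH)
        show "u @ [p, q, s, t] @ v \<in> SB I" by (rule SB_mset[OF less(2)]) (use that in \<open>simp add: four\<close>)
        show "normal (u @ [p, q, s, t] @ v)"
          using four that normal_append[of "[p, q, s, t] @ v" u] normal_blocks_append[of "[p, q, s, t]" v]
          by (simp add: normal_blocks_4)
        have "[t, s, q, p] @ rev u \<lless> [d, c, b, a] @ rev u" using that by auto
        then show "rev (u @ [p, q, s, t] @ v) \<lless> rev w" using lless_prefix by (simp add: four)
      qed
      have R: "H2_sum sbasis u a b c d v \<in> Sp"
        using four less(2) by (intro Sp_MB sbasis_H2) auto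
      have J: "sbasis (u @ [a, c, b, d] @ v) \<in> Sp" "sbasis (u @ [b, c, a, d] @ v) \<in> Sp"
        "sbasis (u @ [a, d, b, c] @ v) \<in> Sp" "sbasis (u @ [b, d, a, c] @ v) \<in> Sp"
        "sbasis (u @ [c, d, a, b] @ v) \<in> Sp"
        by (rule I; use four in \<open>simp add: add_mset_commute\<close>)+
      show ?thesis unfolding four(1)
        using Sp_diff[OF Sp_add[OF Sp_diff[OF Sp_diff[OF Sp_add[OF R J(1)] J(2)] J(3)] J(4)] J(5)]
        by (simp add: H2_sum_def algebra_simps)
    next
      case (three a b c v)
      \<comment> \<open>The unsigned arrangement behind \<open>p\<close>, \<open>q\<close>,
        \<open>s\<close> is supplied separately, because membership in \<open>SB I\<close> is shown
        by permuting first and changing signs afterwards.\<close>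
      have I: "sbasis ([p, q, s] @ v) \<in> Sp"
        if "\<exists>p' q' s'. mset [p', q', s'] = mset [a, b, c] \<and> \<bar>p\<bar> = \<bar>p'\<bar> \<and> \<bar>q\<bar> = \<bar>q'\<bar> \<and> \<bar>s\<bar> = \<bar>s'\<bar>"
          "0 < p" "q < s" "s < c \<or> (s = c \<and> q < b)" for p q s
      proof (rule IH)
        from that(1) obtain p' q' s' where p': "mset [p', q', s'] = mset [a, b, c]"
          "\<bar>p\<bar> = \<bar>p'\<bar>" "\<bar>q\<bar> = \<bar>q'\<bar>" "\<bar>s\<bar> = \<bar>s'\<bar>" by blast
        have "[p', q', s'] @ v \<in> SB I"
          by (rule SB_mset[OF less(2)]) (simp only: three(1) mset_append p'(1))
        then show "[p, q, s] @ v \<in> SB I" by (rule SB_abs) (use p' in simp)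
        show "normal ([p, q, s] @ v)"
          using three that normal_blocks_Cons[of v q s] by (simp add: normal_def)
        have "[s, q, p] \<lless> [c, b, a]" using that by auto
        then show "rev ([p, q, s] @ v) \<lless> rev w" using lless_prefix by (simp add: three)
      qed
      have R: "H5_sum sbasis a b c v \<in> Sp"
        using three less(2) by (intro Sp_MB sbasis_H5) auto
      have J: "sbasis ([a, - b, c] @ v) \<in> Sp" "sbasis ([a, - c, b] @ v) \<in> Sp" "sbasis ([a, - c, - b] @ v) \<in> Sp"
        "sbasis ([b, a, c] @ v) \<in> Sp" "sbasis ([b, - a, c] @ v) \<in> Sp" "sbasis ([b, - c, a] @ v) \<in> Sp"
        "sbasis ([b, - c, - a] @ v) \<in> Sp" "sbasis ([c, a, b] @ v) \<in> Sp" "sbasis ([c, - a, b] @ v) \<in> Sp"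
        "sbasis ([c, - b, a] @ v) \<in> Sp" "sbasis ([c, - b, - a] @ v) \<in> Sp"
        by (rule I[OF exI[of _ a, OF exI[of _ b, OF exI[of _ c]]]]
              I[OF exI[of _ a, OF exI[of _ c, OF exI[of _ b]]]]
              I[OF exI[of _ b, OF exI[of _ a, OF exI[of _ c]]]]
              I[OF exI[of _ b, OF exI[of _ c, OF exI[of _ a]]]]
              I[OF exI[of _ c, OF exI[of _ a, OF exI[of _ b]]]]
              I[OF exI[of _ c, OF exI[of _ b, OF exI[of _ a]]]];
            use three in \<open>simp add: add_mset_commute; fail\<close>)+
      have "sbasis ([a, b, c] @ v) = H5_sum sbasis a b c v
          + sbasis ([a, - b, c] @ v) - sbasis ([a, - c, b] @ v) + sbasis ([a, - c, - b] @ v)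
          + sbasis ([b, a, c] @ v) - sbasis ([b, - a, c] @ v) + sbasis ([b, - c, a] @ v)
          - sbasis ([b, - c, - a] @ v) - sbasis ([c, a, b] @ v) + sbasis ([c, - a, b] @ v)
          - sbasis ([c, - b, a] @ v) + sbasis ([c, - b, - a] @ v)"
        by (simp only: H5_sum_def algebra_simps)
      also have "\<dots> \<in> Sp" by (intro Sp_add Sp_diff R J)
      finally show ?thesis unfolding three(1) .
    next
      case (two a b v)
      have S: "[p, q] @ v \<in> SB I" if "\<bar>p\<bar> = \<bar>a\<bar> \<and> \<bar>q\<bar> = \<bar>b\<bar> \<or> \<bar>p\<bar> = \<bar>b\<bar> \<and> \<bar>q\<bar> = \<bar>a\<bar>" for p q
      proof -
        have "[b, a] @ v \<in> SB I" by (rule SB_mset[OF less(2)]) (simp add: two add_mset_commute)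
        then show ?thesis using that SB_abs[of "[b, a] @ v" "[p, q] @ v"] SB_abs[OF less(2), of "[p, q] @ v"]
          by (auto simp: two)
      qed
      have I: "sbasis ([p, q] @ v) \<in> Sp"
        if "\<bar>p\<bar> = \<bar>a\<bar> \<and> \<bar>q\<bar> = \<bar>b\<bar> \<or> \<bar>p\<bar> = \<bar>b\<bar> \<and> \<bar>q\<bar> = \<bar>a\<bar>" "p < q" "q < b \<or> (q = b \<and> p < a)" for p q
      proof (rule IH)
        show "[p, q] @ v \<in> SB I" by (rule S[OF that(1)])
        show "normal ([p, q] @ v)"
          using two that normal_blocks_Cons[of v p q] by (simp add: normal_def)
        have "[q, p] \<lless> [b, a]" using that by auto
        then show "rev ([p, q] @ v) \<lless> rev w" using lless_prefix by (simp add: two)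
      qed
      have J: "sbasis ([- b, a] @ v) \<in> Sp" "sbasis ([- a, b] @ v) \<in> Sp" "sbasis ([- b, - a] @ v) \<in> Sp"
        by (rule I; use two in simp)+
      \<comment> \<open>Two words of (H4) have a descending block; (H1) exchanges them for their
        sorted forms, up to sign.\<close>
      have "sbasis ([a, - b] @ v) + sbasis ([- b, a] @ v) \<in> MB I"
        using sbasis_H1[of "[]" a "- b" v] S[of a "- b"] two by simp
      then have J1: "sbasis ([a, - b] @ v) \<in> Sp" using J(1) by (rule Sp_swap)
      have "sbasis ([b, - a] @ v) + sbasis ([- a, b] @ v) \<in> MB I"
        using sbasis_H1[of "[]" b "- a" v] S[of b "- a"] two by simp
      then have J2: "sbasis ([b, - a] @ v) \<in> Sp" using J(2) by (rule Sp_swap)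
      have R: "sbasis ([a, b] @ v) - sbasis ([a, - b] @ v) + sbasis ([b, - a] @ v) - sbasis ([- b, - a] @ v) \<in> Sp"
        using two less(2) by (intro Sp_MB sbasis_H4) auto
      show ?thesis unfolding two(1)
        using Sp_add[OF Sp_diff[OF Sp_add[OF R J1] J2] J(3)] by (simp add: algebra_simps)
    qed
  qed
qed

text \<open>Sorting a block, or making the unpaired letter positive, moves the word up, against the
  direction of \<open>straighten_normal\<close>; so this induction runs on the distance from the top
  of the order.\<close>

lemma straighten:
  assumes "w \<in> SB I"
  shows "sbasis w \<in> Sp"
  using assms
proof (induction "Suc (card (SB I)) - rk (rev w)" arbitrary: w rule: less_induct)
  case less
  have IH: "sbasis w' \<in> Sp" if "w' \<in> SB I" "rev w \<lless> rev w'" for w'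
  proof (rule less(1)[OF _ that(1)])
    have "rk (rev w) < rk (rev w')" using rk_mono[OF SB_rev[OF less(2)]] that(2) by blast
    then show "Suc (card (SB I)) - rk (rev w') < Suc (card (SB I)) - rk (rev w)"
      using rk_le[of "rev w'"] by linarith
  qed
  show ?case
  proof (cases "normal w")
    case True
    then show ?thesis using straighten_normal less(2) by blast
  next
    case False
    from not_normal[OF False] show ?thesis
    proof (elim disjE exE conjE)
      fix u a b t assume w: "w = u @ [a, b] @ t" "even (length t)" "\<not> a < b"
      have "a \<noteq> b" using SB_distinct[OF less(2)] by (auto simp: w)
      then have ba: "b < a" using w(3) by simp
      have s: "u @ [b, a] @ t \<in> SB I" by (rule SB_mset[OF less(2)]) (simp add: w add_mset_commute)
      have "[b, a] @ rev u \<lless> [a, b] @ rev u" using ba by auto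
      then have "rev w \<lless> rev (u @ [b, a] @ t)" using lless_prefix by (simp add: w)
      then have "sbasis (u @ [b, a] @ t) \<in> Sp" by (rule IH[OF s])
      with sbasis_H1[of u a b t] less(2) show ?thesis unfolding w(1)
        using w(1,2) by (intro Sp_swap[of "sbasis (u @ [a, b] @ t)"]) auto
    next
      fix a v assume w: "w = a # v" "even (length v)" "\<not> 0 < a"
      have "a \<noteq> 0" using SB_nz[OF less(2), of a] by (simp add: w)
      then have "a < - a" using w(3) by simp
      then have "rev w \<lless> rev (- a # v)" using lless_prefix[of "[a]" "[- a]" "rev v"] by (simp add: w)
      moreover have "- a # v \<in> SB I" by (rule SB_abs[OF less(2)]) (simp add: w)
      ultimately have "sbasis (- a # v) \<in> Sp" using IH by blast
      with sbasis_H3[of a v] less(2) show ?thesis unfolding w(1)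
        using w(1,2) by (intro Sp_swap[of "sbasis (a # v)"]) auto
    qed
  qed
qed

lemma MB_sub: "MB I \<subseteq> carrier (free_space (SB I))" "qvs.subspace (MB I)"
proof -
  let ?F = "carrier (free_space (SB I))"
  have b: "basis w \<in> ?F" if "w \<in> SB I" for w using that by (simp add: free_space_def)
  note sub = qvs.subspace_add[OF subspace_free] qvs.subspace_diff[OF subspace_free]
  \<comment> \<open>The words of a relation agree up to order and signs of the letters, and
    membership in \<open>SB I\<close> ignores both.\<close>
  have perm: "y \<in> SB I" if "x \<in> SB I" "mset (map abs y) = mset (map abs x)" for x y
  proof -
    have "length y = length x" "distinct (map abs y) \<longleftrightarrow> distinct (map abs x)" "abs ` set y = abs ` set x"
      using that(2) mset_eq_length[OF that(2)] mset_eq_imp_distinct_iff[OF that(2)] mset_eq_setD[OF that(2)]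
      by auto
    then show ?thesis using that(1) unfolding SB_iff by auto
  qed
  have "rel_H1 I \<union> rel_H2 I \<union> rel_H3 I \<union> rel_H4 I \<union> rel_H5 I \<subseteq> ?F"
    unfolding rel_H1_def rel_H2_def rel_H3_def rel_H4_def rel_H5_def
    by (intro Un_least subsetI; elim CollectE exE conjE; hypsubst; intro sub b; (erule perm; simp add: add_mset_commute))
  then show "MB I \<subseteq> ?F" unfolding MB_def by (intro qvs.span_minimal subspace_free)
  show "qvs.subspace (MB I)" unfolding MB_def by (rule qvs.subspace_span)
qed

lemma span_snakes:
  assumes "f \<in> carrier (free_space (SB I))"
  shows "\<exists>g \<in> carrier (free_space (snakes I)). f - g \<in> MB I"
proof -
  have "basis w \<in> Sp" if "w \<in> SB I" for w
    using straighten[OF SB_sg[OF that]] by simp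
  then have "linear_ext basis f \<in> Sp"
    unfolding linear_ext_def Sp_def using assms
    by (intro qvs.span_sum qvs.span_scale) (auto simp: free_space_def)
  then have "f \<in> qvs.span (MB I \<union> basis ` snakes I)" by (simp add: poly_mapping_basis_sum Sp_def)
  then obtain m g where mg: "m \<in> qvs.span (MB I)" "g \<in> qvs.span (basis ` snakes I)" "f = m + g"
    unfolding qvs.span_Un by blast
  have "qvs.span (basis ` snakes I) \<subseteq> carrier (free_space (snakes I))"
    by (intro qvs.span_minimal subspace_free) (auto simp: free_space_def)
  moreover have "m \<in> MB I" using mg(1) MB_sub(2) by (simp only: qvs.span_eq_iff[THEN iffD2])
  ultimately show ?thesis using mg by (intro bexI[of _ g]) auto
qed

end

section \<open>Independence of the snake cycles\<close>

text \<open>Only the two faces that omit one of the equal neighbours can be free of repetitions;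
  they coincide and carry opposite signs.\<close>

lemma alternating_sum_zero:
  assumes xs: "xs = p @ c # c # q" and h: "\<And>\<tau>. \<not> distinct \<tau> \<Longrightarrow> h \<tau> = (0 :: 'b \<Rightarrow>\<^sub>0 rat)"
  shows "(\<Sum>i<length xs. qscale ((-1) ^ i) (h (take i xs @ drop (Suc i) xs))) = 0"
proof -
  let ?j = "length p" and ?g = "\<lambda>i. qscale ((-1) ^ i) (h (take i xs @ drop (Suc i) xs))"
  have "?g i = 0" if "i \<notin> {?j, Suc ?j}" for i
  proof -
    have "\<not> distinct (take i xs @ drop (Suc i) xs)"
    proof (cases "i < ?j")
      case True
      then have "take i xs @ drop (Suc i) xs = take i p @ drop (Suc i) p @ c # c # q" by (simp add: xs)
      then show ?thesis by simp
    next
      case False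
      define k where "k = i - Suc (Suc ?j)"
      have "i = ?j + Suc (Suc k)" using False that unfolding k_def by auto
      then have i: "i = length (p @ [c, c]) + k" "Suc i = length (p @ [c, c]) + Suc k" by simp_all
      have xs': "xs = (p @ [c, c]) @ q" by (simp add: xs)
      have "take i xs = (p @ [c, c]) @ take k q" unfolding i(1) xs' by (simp only: take_append) simp
      moreover have "drop (Suc i) xs = drop (Suc k) q" unfolding i(2) xs' by (simp only: drop_append) simp
      ultimately have "take i xs @ drop (Suc i) xs = p @ c # c # take k q @ drop (Suc k) q" by simp
      then show ?thesis by simp
    qed
    then show ?thesis by (simp add: h)
  qed
  then have "(\<Sum>i<length xs. ?g i) = (\<Sum>i\<in>{?j, Suc ?j}. ?g i)"
    by (intro sum.mono_neutral_right) (auto simp: xs)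
  also have "\<dots> = 0" by (simp add: xs)
  finally show ?thesis .
qed

lemma ex_adjacent:
  assumes "Suc j < length xs" "xs ! j = xs ! Suc j"
  shows "\<exists>p c q. xs = p @ c # c # q"
  using assms by (metis Cons_nth_drop_Suc Suc_lessD append_take_drop_id)

context index_set
begin

abbreviation "S \<equiv> snakes I"
abbreviation "k0 \<equiv> top_deg I"
abbreviation "Fr \<equiv> carrier (free_space S)"

lemma snake_SB: "\<alpha> \<in> S \<Longrightarrow> \<alpha> \<in> SB I"
  by (simp add: snakes_def)

lemma finite_snakes: "finite S"
  using finite_SB by (rule finite_subset[rotated]) (auto simp: snakes_def)

definition yw :: "int list \<Rightarrow> int list" where "yw w = rev (sg w)"

lemma yw_inj: "yw v = yw w \<Longrightarrow> v = w"
  unfolding yw_def by (metis rev_rev_ident sg_sg)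

lemma snake_yw: "\<alpha> \<in> S \<Longrightarrow> yw \<alpha> \<in> SB I" "\<alpha> \<in> S \<Longrightarrow> Des (yw \<alpha>) = T"
  by (auto simp: yw_def snakes_iff intro: SB_rev SB_sg)

lemma fund_cycle_cycle: "w \<in> SB I \<Longrightarrow> fund_cycle w \<in> cycles K k0"
  unfolding fund_cycle_EE by (intro EE_cycle SB_sg)

lemma FC_cycle: "f \<in> carrier (free_space (SB I)) \<Longrightarrow> FC f \<in> cycles K k0"
  unfolding linear_ext_def
  by (intro qvs.subspace_sum[OF cycles_subspace] qvs.subspace_scale[OF cycles_subspace] fund_cycle_cycle)
    (auto simp: free_space_def)

lemma Fr_SB: "f \<in> Fr \<Longrightarrow> f \<in> carrier (free_space (SB I))"
  using snake_SB by (auto simp: free_space_def)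

text \<open>Undoing reversal and sign turns the labels of critical chains into snakes, and
  \<open>\<zeta>\<close> into \<open>fund_cycle\<close>.\<close>

lemma cycles_spanned:
  assumes "z \<in> cycles K k0"
  shows "\<exists>g \<in> Fr. z - FC g \<in> boundaries K k0"
proof -
  obtain b c where bc: "b \<in> boundaries K k0" "c \<in> carrier (free_space {\<sigma> \<in> simplices K k0. crit \<sigma>})"
      "z = b + linear_ext \<zeta> c"
    using cycle_reduction[OF assms] by blast
  define s where "s \<sigma> = sg (rev (lab \<sigma>))" for \<sigma>
  have sS: "s \<sigma> \<in> S" if "\<sigma> \<in> supp c" for \<sigma>
  proof -
    have "\<sigma> \<in> K" "crit \<sigma>" using that bc(2) by (auto simp: free_space_def simplices_def)
    from crit_chain[OF this] show ?thesis by (simp add: s_def snakes_iff SB_sg SB_rev)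
  qed
  define g where "g = linear_ext (\<lambda>\<sigma>. basis (s \<sigma>)) c"
  have "g \<in> Fr" unfolding g_def linear_ext_def
    using sS by (intro qvs.subspace_sum[OF subspace_free] qvs.subspace_scale[OF subspace_free])
      (simp add: free_space_def)
  moreover have "FC g = linear_ext \<zeta> c" unfolding g_def
    by (rule linear_ext_compose) (simp add: \<zeta>_def fund_cycle_EE s_def)
  ultimately show ?thesis using bc by (intro bexI[of _ g]) auto
qed

text \<open>The coefficient of a snake \<open>\<alpha>\<close> in \<open>leading z\<close> is the value on \<open>z\<close> of the cocycle dual to the
  chain of \<open>\<alpha>\<close>, pulled back along the retraction \<^const>\<open>trace\<close>.\<close>

definition lead :: "int set list \<Rightarrow> (int list \<Rightarrow>\<^sub>0 rat)" where
  "lead \<tau> = (\<Sum>\<alpha>\<in>S. if chain (yw \<alpha>) = \<tau> then basis \<alpha> else 0)"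

definition leading :: "(int set list \<Rightarrow>\<^sub>0 rat) \<Rightarrow> (int list \<Rightarrow>\<^sub>0 rat)" where
  "leading = linear_ext (\<lambda>\<sigma>. lead (map trace \<sigma>))"

lemma lookup_lead:
  "\<beta> \<in> S \<Longrightarrow> coef (lead \<tau>) \<beta> = (if chain (yw \<beta>) = \<tau> then 1 else 0)"
proof -
  assume b: "\<beta> \<in> S"
  have "coef (lead \<tau>) \<beta> = (\<Sum>\<alpha>\<in>S. if \<alpha> = \<beta> then (if chain (yw \<beta>) = \<tau> then 1 else 0) else 0)"
    unfolding lead_def lookup_sum by (intro sum.cong) (auto simp: lookup_single when_def)
  then show ?thesis using b finite_snakes by simp
qed

lemma lead_not_distinct: "\<not> distinct \<tau> \<Longrightarrow> lead \<tau> = 0"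
  unfolding lead_def
  using sorted_psubset_distinct[OF sorted_chain[OF snake_yw(1)]] by (intro sum.neutral) auto

text \<open>Pigeonhole: the simplex has one vertex more than there are odd sizes up to
  \<open>r\<close>, so its weakly increasing traces cannot all be different.\<close>

lemma trace_repeats:
  assumes "\<sigma> \<in> simplices K (k0 + 1)"
  shows "\<exists>p c q. map trace \<sigma> = p @ c # c # q"
proof (rule ccontr)
  let ?xs = "map trace \<sigma>"
  assume neg: "\<not> ?thesis"
  have s: "sorted_wrt (\<subset>) \<sigma>" "\<And>L. L \<in> set \<sigma> \<Longrightarrow> vert L"
    using assms by (auto simp: simplices_def K_iff)
  have "?xs ! i \<subset> ?xs ! Suc i" if "Suc i < length ?xs" for i
  proof -
    have "\<sigma> ! i \<subseteq> \<sigma> ! Suc i"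
      using sorted_wrt_nth_less[OF s(1), of i "Suc i"] that by auto
    then have "?xs ! i \<subseteq> ?xs ! Suc i" using that by (simp add: trace_mono)
    moreover have "?xs ! i \<noteq> ?xs ! Suc i" using neg ex_adjacent[OF that] by blast
    ultimately show ?thesis by blast
  qed
  then have sx: "sorted_wrt (\<subset>) ?xs"
    by (subst sorted_wrt_iff_nth_Suc_transp) (auto simp: transp_def)
  have fixd: "vert L" "trace L = L" if "L \<in> set ?xs" for L using that s(2) vert_trace by auto
  have "sorted_wrt (\<lambda>A B. card A < card B) ?xs"
  proof (rule sorted_wrt_mono_rel[OF _ sx])
    fix A B assume "A \<in> set ?xs" "B \<in> set ?xs" "A \<subset> B"
    then show "card A < card B" using psubset_card_mono[OF finite_sset[OF vert_sset[OF fixd]]] by blast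
  qed
  then have "distinct (map card ?xs)" by (metis sorted_wrt_map strict_sorted_iff)
  then have "length ?xs = card (card ` set ?xs)" by (metis distinct_card length_map set_map)
  also have "\<dots> \<le> card T"
  proof (rule card_mono)
    show "finite T" by (simp add: T_image)
    show "card ` set ?xs \<subseteq> T" using fixed_card_T[OF fixd] by blast
  qed
  also have "\<dots> \<le> (r + 1) div 2" unfolding T_image
    by (rule order_trans[OF card_image_le[OF finite_set] order_trans[OF card_length]]) simp
  finally have "length \<sigma> \<le> (r + 1) div 2" by simp
  then show False using assms top_deg_eq by (simp add: simplices_def)
qed

lemma leading_linear: "Vector_Spaces.linear qscale qscale leading"
  unfolding leading_def by (rule linear_linear_ext)

text \<open>A simplex of degree \<open>k0 + 1\<close> degenerates under \<open>trace\<close>, and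
  its faces cancel because \<open>lead\<close> ignores lists with repetitions.\<close>

lemma leading_boundary:
  assumes "b \<in> boundaries K k0"
  shows "leading b = 0"
proof -
  obtain w where w: "w \<in> carrier (free_space (simplices K (k0 + 1)))" "b = bd w"
    using assms by (auto simp: boundaries_def)
  have "leading (simplex_bd \<sigma>) = 0" if s: "\<sigma> \<in> supp w" for \<sigma>
  proof -
    have "\<sigma> \<in> simplices K (k0 + 1)" using s w(1) by (auto simp: free_space_def)
    from trace_repeats[OF this] obtain p c q where x: "map trace \<sigma> = p @ c # c # q" by blast
    have "leading (simplex_bd \<sigma>) = (\<Sum>i<length (map trace \<sigma>). qscale ((-1) ^ i)
        (lead (take i (map trace \<sigma>) @ drop (Suc i) (map trace \<sigma>))))"
      by (simp add: leading_def simplex_bd_def linear_ext_sum linear_ext_qscale take_map drop_map)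
    also have "\<dots> = 0" by (rule alternating_sum_zero[OF x lead_not_distinct])
    finally show ?thesis .
  qed
  then have "leading (bd w) = linear_ext (\<lambda>_. 0) w"
    unfolding leading_def by (intro linear_ext_compose) simp
  then show ?thesis by (simp add: w linear_ext_def)
qed

lemma lookup_leading_fund:
  assumes "\<alpha> \<in> SB I" "\<beta> \<in> S"
  shows "coef (leading (fund_cycle \<alpha>)) \<beta> = coef (EE (sg \<alpha>)) (chain (yw \<beta>))"
proof -
  let ?e = "EE (sg \<alpha>)"
  have tr: "map trace \<sigma> = \<sigma>" if s: "\<sigma> \<in> supp ?e" for \<sigma>
  proof -
    obtain y where "y \<in> SB I" "\<sigma> = chain y" using EE_support[OF SB_sg[OF assms(1)] s] by blast
    then have "outer \<sigma> = []" using chain_props(3) by blast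
    then show ?thesis by (intro map_idI) (auto simp: filter_empty_conv)
  qed
  have "coef (leading (fund_cycle \<alpha>)) \<beta> =
      (\<Sum>\<sigma>\<in>supp ?e. coef ?e \<sigma> * (if chain (yw \<beta>) = map trace \<sigma> then 1 else 0))"
    unfolding leading_def fund_cycle_EE lookup_linear_ext_keys lookup_lead[OF assms(2)] ..
  also have "\<dots> = (\<Sum>\<sigma>\<in>supp ?e. if \<sigma> = chain (yw \<beta>) then coef ?e \<sigma> else 0)"
    using tr by (intro sum.cong) auto
  also have "\<dots> = coef ?e (chain (yw \<beta>))" by (simp add: in_keys_iff)
  finally show ?thesis .
qed

lemma lab_chain_snake: "\<alpha> \<in> S \<Longrightarrow> lab (chain (yw \<alpha>)) = yw \<alpha>"
  using chain_props[OF snake_yw(1)] snake_yw by (intro lab_unique) auto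

text \<open>If the chain of \<open>\<beta>\<close> occurs in the cycle of \<open>\<alpha>\<close>,
  it is the chain of a word at most \<open>yw \<alpha>\<close>, while its label
  \<open>yw \<beta>\<close> is the least word compatible with it.\<close>

lemma leading_fund_triangular:
  assumes "\<alpha> \<in> S" "\<beta> \<in> S" "\<alpha> \<noteq> \<beta>" "rk (yw \<alpha>) \<le> rk (yw \<beta>)"
  shows "coef (leading (fund_cycle \<alpha>)) \<beta> = 0"
proof (rule ccontr)
  assume "\<not> ?thesis"
  then have "chain (yw \<beta>) \<in> supp (EE (sg \<alpha>))"
    using lookup_leading_fund[OF snake_SB[OF assms(1)] assms(2)] by (simp add: in_keys_iff)
  from EE_support[OF SB_sg[OF snake_SB[OF assms(1)]] this] obtain y where
    y: "y \<in> SB I" "chain (yw \<beta>) = chain y" "y = yw \<alpha> \<or> y \<lless> yw \<alpha>"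
    using snake_yw(2)[OF assms(1)] unfolding yw_def by blast
  have "rk (yw \<beta>) \<le> rk y" using \<mu>_chain(2)[OF y(1)] lab_chain_snake[OF assms(2)] y(2) by simp
  moreover have "y \<lless> yw \<alpha> \<Longrightarrow> rk y < rk (yw \<alpha>)" using rk_mono[OF y(1)] by blast
  ultimately have "y = yw \<alpha>" using y(3) assms(4) by auto
  then have "yw \<alpha> = yw \<beta>" using lab_chain_snake[OF assms(1)] lab_chain_snake[OF assms(2)] y(2) by simp
  then show False using yw_inj assms(3) by blast
qed

text \<open>At the snake of largest rank in \<open>g\<close> only its own cycle contributes, with
  coefficient 1.\<close>

lemma leading_FC_inj:
  assumes "g \<in> Fr" "leading (FC g) = 0"
  shows "g = 0"
proof (rule ccontr)
  assume "g \<noteq> 0"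
  then have ne: "supp g \<noteq> {}" by simp
  have "Max ((\<lambda>\<alpha>. rk (yw \<alpha>)) ` supp g) \<in> (\<lambda>\<alpha>. rk (yw \<alpha>)) ` supp g"
    using ne by (intro Max_in) auto
  then obtain \<beta> where b0: "\<beta> \<in> supp g"
    "Max ((\<lambda>\<alpha>. rk (yw \<alpha>)) ` supp g) = rk (yw \<beta>)" by auto
  have b: "\<beta> \<in> supp g"
    "\<And>\<alpha>. \<alpha> \<in> supp g \<Longrightarrow> rk (yw \<alpha>) \<le> rk (yw \<beta>)"
    using b0(1) by (auto simp flip: b0(2))
  have kS: "\<alpha> \<in> S" if "\<alpha> \<in> supp g" for \<alpha> using assms(1) that by (auto simp: free_space_def)
  have one: "coef (leading (fund_cycle \<beta>)) \<beta> = 1"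
    using lookup_leading_fund[OF snake_SB[OF kS[OF b(1)]] kS[OF b(1)]] EE_leading[OF SB_sg[OF snake_SB]] kS[OF b(1)]
    by (simp add: yw_def)
  have "leading (FC g) = linear_ext (\<lambda>\<alpha>. leading (fund_cycle \<alpha>)) g"
    unfolding leading_def by (rule linear_ext_compose) (rule refl)
  then have "0 = (\<Sum>\<alpha>\<in>supp g. coef g \<alpha> * coef (leading (fund_cycle \<alpha>)) \<beta>)"
    using assms(2) by (metis lookup_linear_ext_keys lookup_zero)
  also have "\<dots> = (\<Sum>\<alpha>\<in>supp g. if \<alpha> = \<beta> then coef g \<beta> else 0)"
    using leading_fund_triangular kS b one by (intro sum.cong) auto
  also have "\<dots> = coef g \<beta>" using b by simp
  finally show False using b(1) by (simp add: in_keys_iff)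
qed

section \<open>The three isomorphisms from the span of the snakes\<close>

abbreviation "QM \<equiv> quot_space (free_space (SB I)) (MB I)"
abbreviation "Hom \<equiv> red_homology K k0"
abbreviation "Coh \<equiv> red_cohomology K k0"

lemma subquotient_MB: "subquotient (free_space (SB I)) (carrier (free_space (SB I))) (MB I)"
  using MB_sub by (intro subquotient_free subspace_free) auto

lemma carrier_update_self: "M\<lparr>carrier := carrier M\<rparr> = (M :: (rat, 'z) module)"
  by simp

lemmas closed_QM = subquotient.closed_space_Q[OF subquotient_MB, unfolded carrier_update_self]

text \<open>Independence is seen on cycles: \<open>FC\<close> kills \<open>MB I\<close>, and
  \<open>leading\<close> still separates the snakes after \<open>FC\<close>. Spanning is the
  straightening.\<close>

lemma snakes_iso_QM: "(\<lambda>x. MB I +>\<^bsub>free_space (SB I)\<^esub> x) \<in> linear_isos (free_space S) QM"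
proof -
  have "(\<lambda>x. MB I +>\<^bsub>free_space (SB I)\<^esub> x) \<in> linear_isos (free_space S)
      (quot_space (free_space (SB I)\<lparr>carrier := carrier (free_space (SB I))\<rparr>) (MB I))"
  proof (rule subquotient.free_space_iso_quotient[OF subquotient_MB])
    show "x \<in> carrier (free_space (SB I))" if "x \<in> Fr" for x using that by (rule Fr_SB)
    show "x = 0" if "x \<in> Fr" "x \<in> MB I" for x
      using leading_FC_inj[OF that(1)] FC_MB[OF that(2)] lin.linear_0[OF leading_linear] by simp
    show "\<exists>x \<in> Fr. y \<ominus>\<^bsub>free_space (SB I)\<^esub> x \<in> MB I" if "y \<in> carrier (free_space (SB I))" for y
      using span_snakes[OF that] diff_free[OF that Fr_SB] by auto
  qed simp_all
  then show ?thesis unfolding carrier_update_self .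
qed

lemma snakes_iso_Hom: "(\<lambda>x. homology_class K k0 (FC x)) \<in> linear_isos (free_space S) Hom"
  unfolding homology_class_def red_homology_def
proof (rule subquotient.free_space_iso_quotient[OF subquotient_homology[OF face_closed_K]])
  show "FC x \<in> cycles K k0" if "x \<in> Fr" for x using that by (intro FC_cycle Fr_SB)
  show "x = 0" if "x \<in> Fr" "FC x \<in> boundaries K k0" for x
    using leading_FC_inj[OF that(1)] leading_boundary[OF that(2)] by simp
  show "\<exists>x \<in> Fr. y \<ominus>\<^bsub>free_space (simplices K k0)\<^esub> FC x \<in> boundaries K k0" if y: "y \<in> cycles K k0" for y
  proof -
    obtain g where g: "g \<in> Fr" "y - FC g \<in> boundaries K k0" using cycles_spanned[OF y] by blast
    have "y \<ominus>\<^bsub>free_space (simplices K k0)\<^esub> FC g = y - FC g"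
      using y FC_cycle[OF Fr_SB[OF g(1)]] by (intro diff_free) (auto simp: cycles_def)
    then show ?thesis using g by (intro bexI[of _ g]) auto
  qed
qed (simp_all add: linear_ext_add linear_ext_qscale)

text \<open>A left inverse \<open>G\<close> of \<open>leading\<close> after \<open>FC\<close>
  inverts the triangular matrix of the snakes. Pairing \<open>x\<close> with
  \<open>G (leading z)\<close> vanishes on boundaries, since \<open>leading\<close> does, and takes
  the coefficients of \<open>x\<close> as values on the snake cycles.\<close>

lemma ex_dual_cocycles:
  "\<exists>\<phi>. (\<forall>x. \<phi> x \<in> cocycles K k0) \<and> (\<forall>x y. \<phi> (x + y) = (\<lambda>\<sigma>. \<phi> x \<sigma> + \<phi> y \<sigma>)) \<and>
    (\<forall>c x. \<phi> (qscale c x) = (\<lambda>\<sigma>. c * \<phi> x \<sigma>)) \<and>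
    (\<forall>x. \<forall>g \<in> Fr. evaluate (\<phi> x) (FC g) = evaluate (coef x) g)"
proof -
  have lin: "Vector_Spaces.linear qscale qscale (\<lambda>g. leading (FC g))"
    using Vector_Spaces.linear_compose[OF linear_linear_ext leading_linear] by (simp add: o_def)
  have "inj_on (\<lambda>g. leading (FC g)) Fr"
  proof (rule inj_onI)
    fix x y assume xy: "x \<in> Fr" "y \<in> Fr" "leading (FC x) = leading (FC y)"
    then have "leading (FC (x - y)) = 0" by (simp add: lin.linear_diff[OF lin])
    then have "x - y = 0" using leading_FC_inj[OF qvs.subspace_diff[OF subspace_free xy(1,2)]] by blast
    then show "x = y" by simp
  qed
  from lin.linear_exists_left_inverse_on[OF lin subspace_free this] obtain G where
    G: "Vector_Spaces.linear qscale qscale G" "\<And>g. g \<in> Fr \<Longrightarrow> G (leading (FC g)) = g" by blast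
  define \<phi> where "\<phi> x \<sigma> = (if \<sigma> \<in> simplices K k0 then
      evaluate (coef x) (G (leading (basis \<sigma>))) else 0)" for x \<sigma>
  have ev: "evaluate (\<phi> x) z = evaluate (coef x) (G (leading z))"
    if z: "z \<in> carrier (free_space (simplices K k0))" for x z
  proof -
    have "evaluate (\<phi> x) z = evaluate (\<lambda>\<sigma>. evaluate (coef x) (G (leading (basis \<sigma>)))) z"
      unfolding evaluate_def \<phi>_def using z by (intro sum.cong) (auto simp: free_space_def)
    also have "\<dots> = evaluate (coef x) (linear_ext (\<lambda>\<sigma>. G (leading (basis \<sigma>))) z)"
      by (simp only: evaluate_linear_ext)
    also have "linear_ext (\<lambda>\<sigma>. G (leading (basis \<sigma>))) z = G (leading z)"
    proof -
      have "Vector_Spaces.linear qscale qscale (\<lambda>z. G (leading z))"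
        using Vector_Spaces.linear_compose[OF leading_linear G(1)] by (simp add: o_def)
      from linear_ext_linear[OF this, of z] show ?thesis by simp
    qed
    finally show ?thesis .
  qed
  have "\<phi> x \<in> cocycles K k0" for x
  proof (rule cocyclesI)
    show "\<phi> x \<in> carrier (dual_space (simplices K k0))" by (simp add: \<phi>_def dual_space_def)
    fix b assume b: "b \<in> boundaries K k0"
    then have "b \<in> carrier (free_space (simplices K k0))"
      using boundaries_cycles[OF face_closed_K] by (auto simp: cycles_def)
    then show "evaluate (\<phi> x) b = 0"
      using leading_boundary[OF b] by (simp add: ev lin.linear_0[OF G(1)])
  qed
  moreover have "\<phi> (x + y) = (\<lambda>\<sigma>. \<phi> x \<sigma> + \<phi> y \<sigma>)" for x y
    by (auto simp: \<phi>_def lookup_add evaluate_fun_add[symmetric] plus_poly_mapping.rep_eq)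
  moreover have "\<phi> (qscale c x) = (\<lambda>\<sigma>. c * \<phi> x \<sigma>)" for c x
  proof -
    have "coef (qscale c x) = (\<lambda>i. c * coef x i)" by auto
    then show ?thesis by (auto simp: \<phi>_def evaluate_fun_smult)
  qed
  moreover have "evaluate (\<phi> x) (FC g) = evaluate (coef x) g" if "g \<in> Fr" for x g
    using FC_cycle[OF Fr_SB[OF that]] by (subst ev) (auto simp: cycles_def G(2)[OF that])
  ultimately show ?thesis by blast
qed

section \<open>Cohomology classes dual to the snake cycles\<close>

definition dual_cocycle :: "(int list \<Rightarrow>\<^sub>0 rat) \<Rightarrow> (int set list \<Rightarrow> rat)" where
  "dual_cocycle = (SOME \<phi>. (\<forall>x. \<phi> x \<in> cocycles K k0) \<and> (\<forall>x y. \<phi> (x + y) = (\<lambda>\<sigma>. \<phi> x \<sigma> + \<phi> y \<sigma>)) \<and>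
    (\<forall>c x. \<phi> (qscale c x) = (\<lambda>\<sigma>. c * \<phi> x \<sigma>)) \<and>
    (\<forall>x. \<forall>g \<in> Fr. evaluate (\<phi> x) (FC g) = evaluate (coef x) g))"

lemma dual_cocycle:
  "dual_cocycle x \<in> cocycles K k0" "dual_cocycle (x + y) = (\<lambda>\<sigma>. dual_cocycle x \<sigma> + dual_cocycle y \<sigma>)"
  "dual_cocycle (qscale c x) = (\<lambda>\<sigma>. c * dual_cocycle x \<sigma>)"
  "g \<in> Fr \<Longrightarrow> evaluate (dual_cocycle x) (FC g) = evaluate (coef x) g"
  using someI_ex[OF ex_dual_cocycles] unfolding dual_cocycle_def[symmetric] by blast+

lemma basis_Fr: "\<alpha> \<in> S \<Longrightarrow> basis \<alpha> \<in> Fr"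
  by (simp add: free_space_def)

lemma dual_cocycle_fund: "\<beta> \<in> S \<Longrightarrow> evaluate (dual_cocycle x) (fund_cycle \<beta>) = coef x \<beta>"
  using dual_cocycle(4)[OF basis_Fr, of \<beta> x] by simp

abbreviation "dcl x \<equiv> coboundaries K k0 +>\<^bsub>dual_space (simplices K k0)\<^esub> dual_cocycle x"

lemma snakes_iso_Coh: "(\<lambda>x. dcl x) \<in> linear_isos (free_space S) Coh"
  unfolding red_cohomology_def
proof (rule subquotient.free_space_iso_quotient[OF subquotient_cohomology])
  show "dual_cocycle x \<in> cocycles K k0" for x by (rule dual_cocycle)
  show "x = 0" if "x \<in> Fr" "dual_cocycle x \<in> coboundaries K k0" for x
  proof (rule poly_mapping_eqI)
    fix \<beta>
    show "coef x \<beta> = coef 0 \<beta>"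
    proof (cases "\<beta> \<in> S")
      case True
      then show ?thesis
        using evaluate_coboundary_cycle[OF that(2) fund_cycle_cycle[OF snake_SB[OF True]]]
          dual_cocycle_fund[OF True, of x] by simp
    qed (use that(1) in \<open>simp add: carrier_free_iff\<close>)
  qed
  show "\<exists>x \<in> Fr. \<phi> \<ominus>\<^bsub>dual_space (simplices K k0)\<^esub> dual_cocycle x \<in> coboundaries K k0"
    if p: "\<phi> \<in> cocycles K k0" for \<phi>
  proof -
    \<comment> \<open>The coefficients record the values of \<open>\<phi>\<close> on the snake
      cycles. As these span homology, \<open>\<phi>\<close> and \<open>dual_cocycle x\<close> then
      agree on all cycles.\<close>
    define x where "x = (\<Sum>\<alpha>\<in>S. qscale (evaluate \<phi> (fund_cycle \<alpha>)) (basis \<alpha>))"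
    have x: "x \<in> Fr" unfolding x_def
      by (intro qvs.subspace_sum[OF subspace_free] qvs.subspace_scale[OF subspace_free] basis_Fr)
    have lx: "coef x \<beta> = evaluate \<phi> (fund_cycle \<beta>)" if "\<beta> \<in> S" for \<beta>
      using that finite_snakes
      by (simp add: x_def lookup_sum lookup_single when_def if_distrib cong: if_cong)
    let ?d = "\<lambda>\<sigma>. \<phi> \<sigma> - dual_cocycle x \<sigma>"
    have dual: "\<phi> \<in> carrier (dual_space (simplices K k0))"
      "dual_cocycle x \<in> carrier (dual_space (simplices K k0))"
      using p dual_cocycle(1)[of x] by (auto simp: cocycles_def)
    have "?d \<in> coboundaries K k0"
    proof (rule coboundariesI[OF face_closed_K])
      show "?d \<in> carrier (dual_space (simplices K k0))" using dual by (simp add: dual_space_def)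
      fix z assume "z \<in> cycles K k0"
      then obtain g where g: "g \<in> Fr" "z - FC g \<in> boundaries K k0" using cycles_spanned by blast
      have ez: "evaluate \<psi> z = evaluate \<psi> (FC g)" if "\<psi> \<in> cocycles K k0" for \<psi>
        using evaluate_cocycle_boundary[OF that g(2)] by (simp add: evaluate_diff)
      have "evaluate \<phi> z = evaluate \<phi> (FC g)" by (rule ez[OF p])
      also have "\<dots> = evaluate (coef x) g"
        unfolding evaluate_linear_ext using g(1) lx
        by (simp add: evaluate_def free_space_def subset_iff)
      also have "\<dots> = evaluate (dual_cocycle x) (FC g)" using dual_cocycle(4)[OF g(1)] by simp
      also have "\<dots> = evaluate (dual_cocycle x) z"
        by (rule ez[OF dual_cocycle(1), symmetric])
      finally show "evaluate ?d z = 0" by (simp add: evaluate_fun_diff)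
    qed
    then show ?thesis using x diff_dual[OF dual] by (intro bexI[of _ x]) auto
  qed
qed (simp_all add: dual_cocycle dual_space_def)

lemma kronecker_dual:
  assumes "\<beta> \<in> S"
  shows "kronecker (dcl x) (homology_class K k0 (fund_cycle \<beta>)) = coef x \<beta>"
  using kronecker_cosets[OF face_closed_K dual_cocycle(1) fund_cycle_cycle[OF snake_SB[OF assms]], of x]
    dual_cocycle_fund[OF assms] by simp

lemmas closed_Hom = subquotient.closed_space_Q[OF subquotient_homology[OF face_closed_K, of k0], folded red_homology_def]
lemmas closed_Coh = subquotient.closed_space_Q[OF subquotient_cohomology[of K k0], folded red_cohomology_def]

lemma Psi_hom_eq: "Psi_hom n I x = homology_class K k0 (FC x)"
  by (simp add: Psi_hom_def)

text \<open>The classes \<open>dcl\<close> provide one isomorphism as required by the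
  \<open>THE\<close>. Any other agrees with it on the basis, because a class \<open>dcl x\<close>
  with \<open>x\<close> in \<open>Fr\<close> is determined by its pairings with the snake
  cycles.\<close>

lemma dual_basis_iso_eq:
  assumes x: "x \<in> Fr"
  shows "dual_basis_iso n I (homology_class K k0 (FC x)) = dcl x"
proof -
  let ?q = "\<lambda>x. homology_class K k0 (FC x)"
  let ?D = "restrict ((\<lambda>x. dcl x) \<circ> inv_into Fr ?q) (carrier Hom)"
  note q = linear_isosD[OF snakes_iso_Hom] and d = linear_isosD[OF snakes_iso_Coh]
  have Dq: "?D (?q x) = dcl x" if "x \<in> Fr" for x
    using q(1)[OF that] inv_into_f_f[OF q(4) that] by (simp only: restrict_apply' o_apply)
  have "(\<lambda>x. dcl x) \<circ> inv_into Fr ?q \<in> linear_isos Hom Coh"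
    by (rule linear_isos_comp[OF linear_isos_inv[OF snakes_iso_Hom closed_space_free] snakes_iso_Coh])
  then have Diso: "?D \<in> linear_isos Hom Coh"
    by (rule linear_isos_cong[OF _ closed_Hom]) simp
  have Dkr: "kronecker (?D (Psi_hom n I (basis \<alpha>))) (Psi_hom n I (basis \<beta>)) = (if \<alpha> = \<beta> then 1 else 0)"
    if "\<alpha> \<in> S" "\<beta> \<in> S" for \<alpha> \<beta>
    unfolding Psi_hom_eq Dq[OF basis_Fr[OF that(1)]] using kronecker_dual[OF that(2)]
    by (simp add: lookup_single when_def)
  have "dual_basis_iso n I = ?D"
    unfolding dual_basis_iso_def
  proof (rule the_equality)
    show "?D \<in> extensional (carrier Hom) \<and> ?D \<in> linear_isos Hom Coh \<and>
      (\<forall>\<alpha> \<in> S. \<forall>\<beta> \<in> S. kronecker (?D (Psi_hom n I (basis \<alpha>))) (Psi_hom n I (basis \<beta>)) =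
          (if \<alpha> = \<beta> then 1 else 0))"
      using Diso Dkr by (intro conjI ballI restrict_extensional)
    fix D assume D: "D \<in> extensional (carrier Hom) \<and> D \<in> linear_isos Hom Coh \<and>
      (\<forall>\<alpha> \<in> S. \<forall>\<beta> \<in> S. kronecker (D (Psi_hom n I (basis \<alpha>))) (Psi_hom n I (basis \<beta>)) =
          (if \<alpha> = \<beta> then 1 else 0))"
    have Dq': "D \<circ> ?q \<in> linear_isos (free_space S) Coh" using linear_isos_comp[OF snakes_iso_Hom] D by blast
    have "(D \<circ> ?q) (basis \<alpha>) = dcl (basis \<alpha>)" if a: "\<alpha> \<in> S" for \<alpha>
    proof -
      have "(D \<circ> ?q) (basis \<alpha>) \<in> carrier Coh" using linear_isosD(1)[OF Dq' basis_Fr[OF a]] .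
      then have "(D \<circ> ?q) (basis \<alpha>) \<in> (\<lambda>x. dcl x) ` Fr" by (simp only: d(5))
      then obtain x where x: "x \<in> Fr" "(D \<circ> ?q) (basis \<alpha>) = dcl x" by blast
      have "coef x \<beta> = coef (basis \<alpha>) \<beta>" for \<beta>
      proof (cases "\<beta> \<in> S")
        case True
        have "coef x \<beta> = kronecker ((D \<circ> ?q) (basis \<alpha>)) (Psi_hom n I (basis \<beta>))"
          unfolding x(2) Psi_hom_eq using kronecker_dual[OF True] by simp
        also have "\<dots> = (if \<alpha> = \<beta> then 1 else 0)" using D a True by (simp add: Psi_hom_eq)
        finally show ?thesis by (simp add: lookup_single when_def)
      next
        case False
        then show ?thesis using x(1) basis_Fr[OF a] unfolding carrier_free_iff by simp
      qed
      then have "x = basis \<alpha>" by (intro poly_mapping_eqI)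
      then show ?thesis using x by simp
    qed
    then have eq: "(D \<circ> ?q) x = dcl x" if "x \<in> Fr" for x
      using linear_maps_eq_on_free[OF linear_isosD(6)[OF Dq'] d(6) closed_Coh _ that] by blast
    show "D = ?D"
    proof (rule extensionalityI[of _ "carrier Hom"])
      show "D \<in> extensional (carrier Hom)" using D by blast
      fix h assume "h \<in> carrier Hom"
      then have "h \<in> ?q ` Fr" by (simp only: q(5))
      then obtain x where "x \<in> Fr" "h = ?q x" by blast
      then show "D h = ?D h" using eq[of x] Dq[of x] by (simp only: o_apply)
    qed (rule restrict_extensional)
  qed
  then show ?thesis using Dq[OF x] by simp
qed

text \<open>\<open>the_elem\<close> needs the image of the coset to be a singleton; this is
  \<open>FC_MB\<close>.\<close>

lemma Psi_quot_eq:
  assumes "x \<in> Fr"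
  shows "Psi_quot n I (MB I +>\<^bsub>free_space (SB I)\<^esub> x) = homology_class K k0 (FC x)"
proof -
  have "Psi_hom n I y = homology_class K k0 (FC x)" if y: "y \<in> MB I +>\<^bsub>free_space (SB I)\<^esub> x" for y
  proof -
    obtain m where "m \<in> MB I" "y = m + x" using y unfolding a_r_coset_def' by auto
    then show ?thesis by (simp add: Psi_hom_eq linear_ext_add FC_MB)
  qed
  moreover have "x \<in> MB I +>\<^bsub>free_space (SB I)\<^esub> x"
    using subquotient.self_in_coset[OF subquotient_MB Fr_SB[OF assms]] .
  ultimately have "Psi_hom n I ` (MB I +>\<^bsub>free_space (SB I)\<^esub> x) = {homology_class K k0 (FC x)}"
    by blast
  then show ?thesis by (simp add: Psi_quot_def)
qed

text \<open>Every coset is represented by a combination \<open>x\<close> of snakes, and on these the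
  passage through homology amounts to sending the coset of \<open>x\<close> to
  \<open>dcl x\<close>.\<close>

lemma summand_iso: "(\<lambda>X. dual_basis_iso n I (Psi_quot n I X)) \<in> linear_isos QM Coh"
proof -
  let ?a = "\<lambda>x. MB I +>\<^bsub>free_space (SB I)\<^esub> x"
  note a = linear_isosD[OF snakes_iso_QM]
  have "(\<lambda>x. dcl x) \<circ> inv_into Fr ?a \<in> linear_isos QM Coh"
    by (rule linear_isos_comp[OF linear_isos_inv[OF snakes_iso_QM closed_space_free] snakes_iso_Coh])
  then show ?thesis
  proof (rule linear_isos_cong[OF _ closed_QM])
    fix X assume "X \<in> carrier QM"
    then have "X \<in> ?a ` Fr" by (simp only: a(5))
    then obtain x where x: "x \<in> Fr" "X = ?a x" by blast
    then show "dual_basis_iso n I (Psi_quot n I X) = ((\<lambda>x. dcl x) \<circ> inv_into Fr ?a) X"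
      using inv_into_f_f[OF a(4) x(1)] by (simp only: x(2) o_apply Psi_quot_eq[OF x(1)] dual_basis_iso_eq[OF x(1)])
  qed
qed

lemma quotient_iso_snakes: "\<exists>h. h \<in> linear_isos QM (free_space S)"
  using linear_isos_inv[OF snakes_iso_QM closed_space_free] by blast

lemma cohomology_outside_top:
  "k \<noteq> k0 \<Longrightarrow> carrier (red_cohomology K k) = {\<zero>\<^bsub>red_cohomology K k\<^esub>}"
  by (intro cohomology_trivial face_closed_K lower_cycles_boundaries)

end

section \<open>Assembling the direct sums\<close>

lemma finite_direct_sum_carrier:
  "finite J \<Longrightarrow> carrier (direct_sum J V) = (\<Pi>\<^sub>E i\<in>J. carrier (V i))"
  by (auto simp: direct_sum_def)

lemma direct_sum_ops:
  "\<zero>\<^bsub>direct_sum J V\<^esub> = (\<lambda>i\<in>J. \<zero>\<^bsub>V i\<^esub>)"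
  "f \<oplus>\<^bsub>direct_sum J V\<^esub> g = (\<lambda>i\<in>J. f i \<oplus>\<^bsub>V i\<^esub> g i)"
  "c \<odot>\<^bsub>direct_sum J V\<^esub> f = (\<lambda>i\<in>J. c \<odot>\<^bsub>V i\<^esub> f i)"
  by (auto simp: direct_sum_def)

lemma closed_direct_sum:
  assumes "finite J" "\<And>i. i \<in> J \<Longrightarrow> closed_space (V i)"
  shows "closed_space (direct_sum J V)"
proof -
  have V: "\<zero>\<^bsub>V i\<^esub> \<in> carrier (V i)" "x \<in> carrier (V i) \<Longrightarrow> y \<in> carrier (V i) \<Longrightarrow> x \<oplus>\<^bsub>V i\<^esub> y \<in> carrier (V i)"
    "x \<in> carrier (V i) \<Longrightarrow> c \<odot>\<^bsub>V i\<^esub> x \<in> carrier (V i)" "x \<in> carrier (V i) \<Longrightarrow> 0 \<odot>\<^bsub>V i\<^esub> x = \<zero>\<^bsub>V i\<^esub>"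
    if "i \<in> J" for i x y c
    using assms(2)[OF that] by (auto simp: closed_space_def)
  show ?thesis
    unfolding closed_space_def finite_direct_sum_carrier[OF assms(1)] direct_sum_ops restrict_PiE_iff
    by (intro conjI ballI allI restrict_ext V; (assumption | rule PiE_mem; assumption))
qed

lemma closed_red_cohomology: "closed_space (red_cohomology K k)"
  unfolding red_cohomology_def by (rule subquotient.closed_space_Q[OF subquotient_cohomology])

lemma singular_cobd_add:
  "singular_cobd p X (\<lambda>i. x i + y i) = (\<lambda>i. singular_cobd p X x i + singular_cobd p X y i)"
  by (auto simp: singular_cobd_def sum.distrib distrib_left)

lemma singular_cobd_smult: "singular_cobd p X (\<lambda>i. c * x i) = (\<lambda>i. c * singular_cobd p X x i)"
  by (auto simp: singular_cobd_def sum_distrib_left mult.left_commute)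

lemma closed_singular_cohomology: "closed_space (singular_cohomology p X)"
  unfolding singular_cohomology_def
proof (rule subquotient.closed_space_Q, rule subquotient_dual)
  show "fun_subspace (singular_cocycles p X)"
    unfolding fun_subspace_def singular_cocycles_def
    by (auto simp: singular_cobd_add singular_cobd_smult dual_space_def)
      (auto simp: singular_cobd_def)
  show "fun_subspace (singular_coboundaries p X)"
  proof (cases "p = 0")
    case False
    let ?D = "carrier (dual_space (singular_simplex_set (p - 1) X))"
    have D: "(\<lambda>_. 0) \<in> ?D" "\<And>x y. x \<in> ?D \<Longrightarrow> y \<in> ?D \<Longrightarrow> (\<lambda>i. x i + y i) \<in> ?D"
      "\<And>c x. x \<in> ?D \<Longrightarrow> (\<lambda>i. c * x i) \<in> ?D"
      by (auto simp: dual_space_def)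
    have "singular_cobd p X (\<lambda>_. 0) = (\<lambda>_. 0)" by (auto simp: singular_cobd_def)
    then have z: "(\<lambda>_. 0) \<in> singular_cobd p X ` ?D" by (rule image_eqI[OF sym D(1)])
    have "fun_subspace (singular_cobd p X ` ?D)"
      unfolding fun_subspace_def
    proof (intro conjI ballI allI)
      show "(\<lambda>_. 0) \<in> singular_cobd p X ` ?D" by (rule z)
    qed (elim imageE, hypsubst, unfold singular_cobd_add[symmetric] singular_cobd_smult[symmetric],
        intro imageI D; assumption)+
    then show ?thesis using False by (simp add: singular_coboundaries_def)
  qed (simp add: singular_coboundaries_def fun_subspace_def)
  show "singular_cocycles p X \<subseteq> carrier (dual_space (singular_simplex_set p X))"
    by (auto simp: singular_cocycles_def)
  show "singular_coboundaries p X \<subseteq> carrier (dual_space (singular_simplex_set p X))"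
    by (auto simp: singular_coboundaries_def dual_space_def singular_cobd_def)
qed

text \<open>Each \<open>I\<close> contributes in the single degree \<open>top_deg I + 1\<close>,
  outside of which its cohomology is zero; so the two sides have the same summands, merely sorted by
  degree on one of them.\<close>

lemma Psi_iso:
  assumes \<Phi>: "\<And>k. \<Phi> k \<in> linear_isos (singular_cohomology k (XB n)) (complex_cohomology n k)"
  shows "Psi n \<Phi> \<in> linear_isos (quotient_sum n) (total_cohomology (XB n))"
proof -
  let ?J = "Pow {1..int n}"
  let ?Q = "\<lambda>I. quot_space (free_space (SB I)) (MB I)"
  let ?H = "\<lambda>k I. red_cohomology (KB_sub n I) k"
  let ?S = "\<lambda>k. singular_cohomology k (XB n)" and ?C = "\<lambda>k. complex_cohomology n k"
  define \<Theta> where "\<Theta> I X = dual_basis_iso n I (Psi_quot n I X)" for I X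
  have finJ: "finite ?J" by simp
  have idx: "index_set n I" if "I \<in> ?J" for I using that by (simp add: index_set_def)
  have \<Theta>: "\<Theta> I \<in> linear_isos (?Q I) (?H (top_deg I) I)" if "I \<in> ?J" for I
    using index_set.summand_iso[OF idx[OF that]] unfolding \<Theta>_def .
  note \<Theta>D = linear_isosD[OF \<Theta>]
  have triv: "carrier (?H k I) = {\<zero>\<^bsub>?H k I\<^esub>}" if "I \<in> ?J" "k \<noteq> top_deg I" for I k
    using index_set.cohomology_outside_top[OF idx[OF that(1)] that(2)] .
  have cC: "carrier (?C k) = (\<Pi>\<^sub>E I\<in>?J. carrier (?H (int k - 1) I))" for k
    unfolding complex_cohomology_def by (rule finite_direct_sum_carrier[OF finJ])
  have cQ: "carrier (quotient_sum n) = (\<Pi>\<^sub>E I\<in>?J. carrier (?Q I))"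
    unfolding quotient_sum_def by (rule finite_direct_sum_carrier[OF finJ])
  have closC: "closed_space (?C k)" for k
    unfolding complex_cohomology_def by (intro closed_direct_sum finJ closed_red_cohomology)
  have closS: "closed_space (?S k)" for k by (rule closed_singular_cohomology)
  define g where "g k = inv_into (carrier (?S k)) (\<Phi> k)" for k
  have g: "g k \<in> linear_isos (?C k) (?S k)" for k
    unfolding g_def by (rule linear_isos_inv[OF \<Phi> closS])
  note gD = linear_isosD[OF g]
  \<comment> \<open>The degree \<open>k\<close> part of the image before \<open>\<Phi> k\<close> is
    inverted. Summands belonging to other degrees get zero, which by \<open>triv\<close> is the only
    class there.\<close>
  define cp where "cp u k = (\<lambda>I\<in>?J. if int k - 1 = top_deg I then \<Theta> I (u I) else \<zero>\<^bsub>?H (int k - 1) I\<^esub>)" for u k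
  have Psi: "Psi n \<Phi> u = (\<lambda>k. g k (cp u k))" for u
    unfolding Psi_def g_def cp_def \<Theta>_def by (rule refl)
  have zH: "\<zero>\<^bsub>?H k I\<^esub> \<in> carrier (?H k I)" "\<zero>\<^bsub>?H k I\<^esub> \<oplus>\<^bsub>?H k I\<^esub> \<zero>\<^bsub>?H k I\<^esub> = \<zero>\<^bsub>?H k I\<^esub>"
    "c \<odot>\<^bsub>?H k I\<^esub> \<zero>\<^bsub>?H k I\<^esub> = \<zero>\<^bsub>?H k I\<^esub>" for k I c
    using subquotient.zero_closed_Q[OF subquotient_cohomology] subquotient.add_zero_Q[OF subquotient_cohomology]
      subquotient.smult_zero_right_Q[OF subquotient_cohomology]
    unfolding red_cohomology_def by blast+
  have cp: "cp u k \<in> carrier (?C k)" if u: "u \<in> carrier (quotient_sum n)" for u k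
    unfolding cC cp_def
  proof (rule restrict_PiE_iff[THEN iffD2], rule ballI)
    fix I assume I: "I \<in> ?J"
    then have "u I \<in> carrier (?Q I)" using u by (auto simp: cQ)
    then show "(if int k - 1 = top_deg I then \<Theta> I (u I) else \<zero>\<^bsub>?H (int k - 1) I\<^esub>) \<in> carrier (?H (int k - 1) I)"
      using \<Theta>D(1)[OF I] zH(1) by simp
  qed
  \<comment> \<open>\<open>total_cohomology\<close> is a direct sum over all degrees, so the image
    needs finite support.\<close>
  have fin: "finite {k. \<exists>I \<in> ?J. int k - 1 = top_deg I}"
  proof (rule finite_subset)
    show "{k. \<exists>I \<in> ?J. int k - 1 = top_deg I} \<subseteq> (\<lambda>I. nat (top_deg I + 1)) ` ?J"
    proof
      fix k assume "k \<in> {k. \<exists>I \<in> ?J. int k - 1 = top_deg I}"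
      then obtain I where I: "I \<in> ?J" "int k - 1 = top_deg I" by blast
      then have "k = nat (top_deg I + 1)" by linarith
      then show "k \<in> (\<lambda>I. nat (top_deg I + 1)) ` ?J" using I(1) by (rule image_eqI)
    qed
  qed simp
  show ?thesis
  proof (rule linear_isosI)
    fix u assume u: "u \<in> carrier (quotient_sum n)"
    have "{k. Psi n \<Phi> u k \<noteq> \<zero>\<^bsub>?S k\<^esub>} \<subseteq> {k. \<exists>I \<in> ?J. int k - 1 = top_deg I}"
    proof (rule subsetI, rule ccontr)
      fix k assume k: "k \<in> {k. Psi n \<Phi> u k \<noteq> \<zero>\<^bsub>?S k\<^esub>}" "k \<notin> {k. \<exists>I \<in> ?J. int k - 1 = top_deg I}"
      then have "cp u k = \<zero>\<^bsub>?C k\<^esub>"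
        unfolding complex_cohomology_def direct_sum_ops cp_def by (intro restrict_ext) auto
      then have "Psi n \<Phi> u k = \<zero>\<^bsub>?S k\<^esub>"
        unfolding Psi using linear_map_zero[OF gD(6) closC closS] by simp
      then show False using k(1) by simp
    qed
    then have "finite {k. Psi n \<Phi> u k \<noteq> \<zero>\<^bsub>?S k\<^esub>}" using fin finite_subset by blast
    moreover have "Psi n \<Phi> u k \<in> carrier (?S k)" for k unfolding Psi by (rule gD(1)[OF cp[OF u]])
    ultimately show "Psi n \<Phi> u \<in> carrier (total_cohomology (XB n))"
      by (simp add: total_cohomology_def direct_sum_def PiE_UNIV_domain Pi_iff)
    fix c
    have "cp (c \<odot>\<^bsub>quotient_sum n\<^esub> u) k = c \<odot>\<^bsub>?C k\<^esub> cp u k" for k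
      unfolding complex_cohomology_def quotient_sum_def direct_sum_ops cp_def
    proof (rule restrict_ext)
      fix I assume I: "I \<in> ?J"
      then have "u I \<in> carrier (?Q I)" using u by (auto simp: cQ)
      then show "(if int k - 1 = top_deg I then \<Theta> I ((\<lambda>I\<in>?J. c \<odot>\<^bsub>?Q I\<^esub> u I) I) else \<zero>\<^bsub>?H (int k - 1) I\<^esub>) =
          c \<odot>\<^bsub>?H (int k - 1) I\<^esub> (\<lambda>I\<in>?J. if int k - 1 = top_deg I then \<Theta> I (u I) else \<zero>\<^bsub>?H (int k - 1) I\<^esub>) I"
        using I \<Theta>D(3)[OF I] zH(3) by simp
    qed
    then show "Psi n \<Phi> (c \<odot>\<^bsub>quotient_sum n\<^esub> u) = c \<odot>\<^bsub>total_cohomology (XB n)\<^esub> Psi n \<Phi> u"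
      unfolding total_cohomology_def direct_sum_ops Psi using gD(3)[OF cp[OF u]] by (simp add: restrict_def)
    fix u' assume u': "u' \<in> carrier (quotient_sum n)"
    have "cp (u \<oplus>\<^bsub>quotient_sum n\<^esub> u') k = cp u k \<oplus>\<^bsub>?C k\<^esub> cp u' k" for k
      unfolding complex_cohomology_def quotient_sum_def direct_sum_ops cp_def
    proof (rule restrict_ext)
      fix I assume I: "I \<in> ?J"
      then have "u I \<in> carrier (?Q I)" "u' I \<in> carrier (?Q I)" using u u' by (auto simp: cQ)
      then show "(if int k - 1 = top_deg I then \<Theta> I ((\<lambda>I\<in>?J. u I \<oplus>\<^bsub>?Q I\<^esub> u' I) I) else \<zero>\<^bsub>?H (int k - 1) I\<^esub>) =
          (\<lambda>I\<in>?J. if int k - 1 = top_deg I then \<Theta> I (u I) else \<zero>\<^bsub>?H (int k - 1) I\<^esub>) I \<oplus>\<^bsub>?H (int k - 1) I\<^esub>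
          (\<lambda>I\<in>?J. if int k - 1 = top_deg I then \<Theta> I (u' I) else \<zero>\<^bsub>?H (int k - 1) I\<^esub>) I"
        using I \<Theta>D(2)[OF I] zH(2) by simp
    qed
    then show "Psi n \<Phi> (u \<oplus>\<^bsub>quotient_sum n\<^esub> u') = Psi n \<Phi> u \<oplus>\<^bsub>total_cohomology (XB n)\<^esub> Psi n \<Phi> u'"
      unfolding total_cohomology_def direct_sum_ops Psi using gD(2)[OF cp[OF u] cp[OF u']] by (simp add: restrict_def)
  next
    \<comment> \<open>For \<open>I = {}\<close> the degree \<open>top_deg I\<close> is -1, so the
      shift by 1 always gives a natural number.\<close>
    have deg: "int (nat (top_deg I + 1)) - 1 = top_deg I" for I
    proof -
      have "0 \<le> top_deg I + 1" unfolding top_deg_def by presburger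
      then show ?thesis by (simp only: int_nat_eq if_True add_diff_cancel)
    qed
    show "inj_on (Psi n \<Phi>) (carrier (quotient_sum n))"
    proof (rule inj_onI)
      fix u u' assume u: "u \<in> carrier (quotient_sum n)" "u' \<in> carrier (quotient_sum n)" "Psi n \<Phi> u = Psi n \<Phi> u'"
      have eq: "cp u k = cp u' k" for k
        using fun_cong[OF u(3), of k] gD(4)[of k] cp[OF u(1), of k] cp[OF u(2), of k]
        unfolding Psi by (simp add: inj_on_eq_iff)
      have "u I = u' I" if I: "I \<in> ?J" for I
      proof -
        have "\<Theta> I (u I) = \<Theta> I (u' I)"
          using fun_cong[OF eq[of "nat (top_deg I + 1)"], of I] I deg[of I] by (simp add: cp_def)
        moreover have "u I \<in> carrier (?Q I)" "u' I \<in> carrier (?Q I)" using u I by (auto simp: cQ)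
        ultimately show ?thesis using \<Theta>D(4)[OF I] by (simp add: inj_on_eq_iff)
      qed
      then show "u = u'" using u(1,2) unfolding cQ by (intro PiE_ext)
    qed
    fix f assume f: "f \<in> carrier (total_cohomology (XB n))"
    then have "f \<in> (\<Pi>\<^sub>E k\<in>UNIV. carrier (?S k))"
      unfolding total_cohomology_def direct_sum_def by simp
    then have fk: "f k \<in> carrier (?S k)" for k by (rule PiE_mem) (rule UNIV_I)
    define F where "F k = \<Phi> k (f k)" for k
    have F: "F k \<in> carrier (?C k)" for k unfolding F_def using linear_isosD(1)[OF \<Phi> fk] .
    have gF: "g k (F k) = f k" for k
      unfolding g_def F_def using linear_isosD(4)[OF \<Phi>] fk by (rule inv_into_f_f)
    \<comment> \<open>The preimage at \<open>I\<close> is read off from \<open>F\<close> in the one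
      degree that belongs to \<open>I\<close>.\<close>
    define u where "u = (\<lambda>I\<in>?J. inv_into (carrier (?Q I)) (\<Theta> I) (F (nat (top_deg I + 1)) I))"
    have FI: "F k I \<in> carrier (?H (int k - 1) I)" if "I \<in> ?J" for k I
      using F[of k] that unfolding cC by (rule PiE_mem)
    have uI: "u I \<in> carrier (?Q I)" "\<Theta> I (u I) = F (nat (top_deg I + 1)) I" if I: "I \<in> ?J" for I
    proof -
      have "F (nat (top_deg I + 1)) I \<in> \<Theta> I ` carrier (?Q I)"
        using FI[OF I, of "nat (top_deg I + 1)"] \<Theta>D(5)[OF I] deg[of I] by simp
      then show "u I \<in> carrier (?Q I)" "\<Theta> I (u I) = F (nat (top_deg I + 1)) I"
        using I by (simp_all add: u_def inv_into_into f_inv_into_f)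
    qed
    have "u \<in> carrier (quotient_sum n)" unfolding cQ
      using uI(1) by (intro PiE_I) (auto simp: u_def)
    moreover have "cp u k = F k" for k
    proof (rule PiE_ext[of _ ?J "\<lambda>I. carrier (?H (int k - 1) I)"])
      show "F k \<in> (\<Pi>\<^sub>E I\<in>?J. carrier (?H (int k - 1) I))" using F[of k] unfolding cC .
      show "cp u k \<in> (\<Pi>\<^sub>E I\<in>?J. carrier (?H (int k - 1) I))"
        using cp[OF \<open>u \<in> carrier (quotient_sum n)\<close>, of k] unfolding cC .
      fix I assume I: "I \<in> ?J"
      show "cp u k I = F k I"
      proof (cases "int k - 1 = top_deg I")
        case True
        then have "nat (top_deg I + 1) = k" by linarith
        then show ?thesis using uI(2)[OF I] True I by (simp add: cp_def)
      next
        case False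
        then show ?thesis using triv[OF I False] FI[OF I, of k] I by (simp add: cp_def)
      qed
    qed
    ultimately show "\<exists>u \<in> carrier (quotient_sum n). Psi n \<Phi> u = f"
      using gF by (intro bexI[of _ u]) (auto simp: Psi)
  qed
qed

theorem theorem1p2:
  fixes n :: nat
  assumes "n > 0"
  shows "(\<forall>I. I \<subseteq> {1..int n} \<longrightarrow>
            (\<exists>h. h \<in> linear_isos (quot_space (free_space (SB I)) (MB I)) (free_space (snakes I)))) \<and>
         (\<forall>\<Phi>. (\<forall>k. \<Phi> k \<in> linear_isos (singular_cohomology k (XB n)) (complex_cohomology n k)) \<longrightarrow>
            Psi n \<Phi> \<in> linear_isos (quotient_sum n) (total_cohomology (XB n)))"
proof (intro conjI allI impI)
  fix I assume "I \<subseteq> {1..int n}"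
  then show "\<exists>h. h \<in> linear_isos (quot_space (free_space (SB I)) (MB I)) (free_space (snakes I))"
    by (intro index_set.quotient_iso_snakes index_set.intro)
next
  fix \<Phi> assume "\<forall>k. \<Phi> k \<in> linear_isos (singular_cohomology k (XB n)) (complex_cohomology n k)"
  then show "Psi n \<Phi> \<in> linear_isos (quotient_sum n) (total_cohomology (XB n))"
    by (intro Psi_iso) blast
qed

end
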